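(* Let $\pi_{\mathbb{E}}:\mathbb{E}\to M$ be a smooth real vector bundle. Then the induced map $\pi_{\mathbb{E}}^1:J_p^1\mathbb{E}\to J_p^1M$, $\pi_{\mathbb{E}}^1(j^1\Phi)=j^1(\pi_{\mathbb{E}}\circ\Phi)$, is a vector bundle, so that the manifold $J_p^1\mathbb{E}$ has two vector bundle structures: its primary vector bundle structure as the first jet bundle of the manifold $\mathbb{E}$ (with base manifold $\mathbb{E}$ and projection $\tilde\pi$), and a secondary structure with $J_p^1M$ as the base manifold (with projection $\pi_{\mathbb{E}}^1$). Moreover, the charts induced on $J_p^1\mathbb{E}$ by the primary structure and by the secondary structure belong to the same atlas.
   Context: Fix $p\ge 1$; $u_1,\dots,u_p$ are the standard coordinates of $\mathbb{R}^p$. For a smooth manifold $N$ with $\dim N=n$, two smooth maps $\phi,\xi:\mathbb{R}^p\to N$ are equivalent if for every $f\in C^\infty(N)$ one has $f(\phi(0))=f(\xi(0))$ and $\partial(f\circ\phi)/\partial u_\alpha|_0=\partial(f\circ\xi)/\partial u_\alpha|_0$ for $\alpha=1,\dots,p$. The class of $\phi$ is its 1-jet $j^1\phi$, and $J_p^1N$ is the set of all classes. For a chart $(U,x_1,\dots,x_n)$ of $N$, set $J_p^1U=\{j^1\phi:\phi(0)\in U\}$; it has the chart $x_i(j^1\phi)=x_i(\phi(0))$, $x^i_\alpha(j^1\phi)=\partial(x_i\circ\phi)/\partial u_\alpha|_0$, and these charts make $J_p^1N$ a smooth manifold. A smooth map $h:N\to N'$ induces a smooth map $h^1:J_p^1N\to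 J_p^1N'$, $h^1(j^1\phi)=j^1(h\circ\phi)$. If $N=V$ is a finite-dimensional real vector space, $J_p^1V$ is a vector space with $j^1f+j^1g=j^1(f+g)$ and $\lambda j^1f=j^1(\lambda f)$. One identifies $J_p^1(N\times N')$ with $J_p^1N\times J_p^1N'$ via $j^1(f_1,f_2)\mapsto(j^1f_1,j^1f_2)$. Let $m=\dim M$, let $E$ be the $k$-dimensional typical fibre of $\mathbb{E}$, let $\psi:\pi_{\mathbb{E}}^{-1}(U)\to U\times E$ denote a local vector bundle trivialization, with $U$ the domain of a chart $(x_1,\dots,x_m)$ of $M$ and $y_1,\dots,y_k$ linear coordinates on $E$. Put $\bar x_i=x_i\circ\pi_{\mathbb{E}}$ and $\bar y_j=y_j\circ pr_2\circ\psi$. Primary structure: the projection is $\tilde\pi:J_p^1\mathbb{E}\to\mathbb{E}$, $\tilde\pi(j^1\Phi)=\Phi(0)$; writing $j^1\Phi=[x,y;X_\alpha,Y_\alpha]$ with $\Phi(0)=\psi^{-1}(x,y)$, $X_\alpha=(\partial(\bar x_i\circ\Phi)/\partial u_\alpha|_0)_i$, $Y_\alpha=(\partial(\bar y_j\circ\Phi)/\partial u_\alpha|_0)_j$, the fibre operations are $[x,y;X_\alpha,Y_\alpha]+_1[x,y;X'_\alpha,Y'_\alpha]=[x,y;X_\alpha+X'_\alpha,Y_\alpha+Y'_\alpha]$ and $\lambda\bullet_1[x,y;X_\alpha,Y_\alpha]=[x,y;\lambda X_\alpha,\lambda Y_\alpha]$. Its induced charts are $j^1\Phi\mapsto(x,y,(X_\alpha,Y_\alpha))$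 with values in (open subset of $\mathbb{R}^m$)$\times E\times L(\mathbb{R}^p,\mathbb{R}^{m+k})$, where $L(\mathbb{R}^p,\mathbb{R}^{m+k})\cong L(\mathbb{R}^p,\mathbb{R}^m)\times L(\mathbb{R}^p,\mathbb{R}^k)$. Secondary structure: the projection is $\pi_{\mathbb{E}}^1$; its local trivializations are $\psi^1:J_p^1(\pi_{\mathbb{E}}^{-1}(U))\to J_p^1(U\times E)\cong J_p^1U\times J_p^1E$, $j^1\Phi\mapsto(j^1(\pi_{\mathbb{E}}\circ\Phi),j^1(pr_2\circ\psi\circ\Phi))$; writing $j^1\Phi=[x,X_\alpha;y,Y_\alpha]$ with the same components, the operations on a fibre over $[x;X_\alpha]\in J_p^1M$ are $[x,X_\alpha;y,Y_\alpha]+_2[x,X_\alpha;y',Y'_\alpha]=[x,X_\alpha;y+y',Y_\alpha+Y'_\alpha]$ and $\lambda\bullet_2[x,X_\alpha;y,Y_\alpha]=[x,X_\alpha;\lambda y,\lambda Y_\alpha]$. Its induced charts are obtained by composing $\psi^1$ with the charts of $J_p^1U$ and $J_p^1E$, with values in (open subset of $\mathbb{R}^m$)$\times L(\mathbb{R}^p,\mathbb{R}^m)\times E\times L(\mathbb{R}^p,\mathbb{R}^k)$. Two families of charts belong to the same atlas if they are smoothly compatible, i.e. the identity map of $J_p^1\mathbb{E}$ is a diffeomorphism between the two resulting manifold structures. *)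

theory Defs
  imports "HOL-Analysis.Analysis"
begin

text \<open>
  Model spaces of manifolds and of fibres.  This is the class of Euclidean vector spaces
  including the zero space: \<^class>\<open>euclidean_space\<close> has a nonempty basis and so would exclude
  manifolds of dimension 0 and bundles of rank 0.
\<close>

class fin_dim_inner = real_inner +
  assumes finite_generating_set: "\<exists>B. finite B \<and> (\<forall>v. \<exists>c. v = (\<Sum>b\<in>B. c b *\<^sub>R b))"

lemma fin_dim_inner_iff_span:
  "finite B \<and> (\<forall>v. \<exists>c. v = (\<Sum>b\<in>B. c b *\<^sub>R b)) \<longleftrightarrow> finite B \<and> span B = UNIV"
  for B :: "'a::real_vector set"
  by (rule conj_cong) (simp_all add: span_finite set_eq_iff image_iff)

lemma finite_spanning_set: "\<exists>B::'a::fin_dim_inner set. finite B \<and> span B = UNIV"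
  using finite_generating_set[where 'a='a] unfolding fin_dim_inner_iff_span .

instance euclidean_space \<subseteq> fin_dim_inner
  by standard (rule exI[of _ Basis], unfold fin_dim_inner_iff_span, simp)

instance prod :: (fin_dim_inner, fin_dim_inner) fin_dim_inner
proof
  obtain A :: "'a set" where A: "finite A" "span A = UNIV"
    using finite_spanning_set by blast
  obtain B :: "'b set" where B: "finite B" "span B = UNIV"
    using finite_spanning_set by blast
  let ?C = "(\<lambda>a. (a, 0)) ` A \<union> (\<lambda>b. (0, b)) ` B :: ('a \<times> 'b) set"
  have lin: "linear (\<lambda>a::'a. (a, 0::'b))" "linear (\<lambda>b::'b. (0::'a, b))"
    by (auto intro!: linearI)
  have "(a, b) \<in> span ?C" for a b
  proof -
    have "(a, 0) \<in> span ((\<lambda>a. (a, 0::'b)) ` A)"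
      using A(2) by (subst linear_span_image[OF lin(1)]) auto
    moreover have "(0, b) \<in> span ((\<lambda>b. (0::'a, b)) ` B)"
      using B(2) by (subst linear_span_image[OF lin(2)]) auto
    ultimately have "(a, 0) + (0, b) \<in> span ?C"
      using span_mono[OF Un_upper1] span_mono[OF Un_upper2] by (intro span_add) blast+
    then show ?thesis by simp
  qed
  then have "finite ?C \<and> span ?C = UNIV"
    using A(1) B(1) by auto
  then show "\<exists>C::('a \<times> 'b) set. finite C \<and> (\<forall>v. \<exists>c. v = (\<Sum>b\<in>C. c b *\<^sub>R b))"
    unfolding fin_dim_inner_iff_span by (rule exI)
qed

instance vec :: (fin_dim_inner, finite) fin_dim_inner
proof
  obtain A :: "'a set" where A: "finite A" "span A = UNIV"
    using finite_spanning_set by blast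
  let ?C = "\<Union>i::'b. axis i ` A"
  have lin: "linear (axis i :: 'a \<Rightarrow> 'a^'b)" for i
    by (rule linearI) (auto simp: axis_def vec_eq_iff)
  have "v \<in> span ?C" for v :: "'a^'b"
  proof -
    have "axis i (v $ i) \<in> span ?C" for i
    proof -
      have "axis i (v $ i) \<in> span (axis i ` A)"
        using A(2) by (subst linear_span_image[OF lin]) auto
      then show ?thesis
        using span_mono[of "axis i ` A" ?C] by blast
    qed
    moreover have "v = (\<Sum>i\<in>UNIV. axis i (v $ i))"
      by (simp add: vec_eq_iff axis_def)
    ultimately show ?thesis
      using span_sum[of UNIV "\<lambda>i. axis i (v $ i)" ?C] by simp
  qed
  then have "finite ?C \<and> span ?C = UNIV"
    using A(1) by auto
  then show "\<exists>C::('a^'b) set. finite C \<and> (\<forall>v. \<exists>c. v = (\<Sum>b\<in>C. c b *\<^sub>R b))"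
    unfolding fin_dim_inner_iff_span by (rule exI)
qed


section \<open>Smooth maps between open subsets of Euclidean spaces\<close>

primrec Ck_on :: "nat \<Rightarrow> 'a::real_normed_vector set \<Rightarrow> ('a \<Rightarrow> 'b::real_normed_vector) \<Rightarrow> bool" where
  "Ck_on 0 W f \<longleftrightarrow> continuous_on W f"
| "Ck_on (Suc k) W f \<longleftrightarrow>
     (\<forall>x\<in>W. f differentiable (at x)) \<and> (\<forall>v. Ck_on k W (\<lambda>x. frechet_derivative f (at x) v))"

definition Cinf_on :: "'a::real_normed_vector set \<Rightarrow> ('a \<Rightarrow> 'b::real_normed_vector) \<Rightarrow> bool" where
  "Cinf_on W f \<longleftrightarrow> (\<forall>k. Ck_on k W f)"


section \<open>Smooth manifolds\<close>

text \<open>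
  A manifold is given by an atlas, not necessarily maximal.  A chart is a domain with a total
  function on the underlying type, whose values outside the domain are irrelevant.
\<close>

type_synonym ('a, 'm) chart = "'a set \<times> ('a \<Rightarrow> 'm)"

type_synonym ('a, 'm) atlas = "('a, 'm) chart set"

definition compatible ::
    "('a, 'm::real_normed_vector) chart \<Rightarrow> ('a, 'n::real_normed_vector) chart \<Rightarrow> bool" where
  "compatible = (\<lambda>(U, x) (V, y). open (x ` (U \<inter> V)) \<and> Cinf_on (x ` (U \<inter> V)) (y \<circ> inv_into U x))"

definition smooth_atlas :: "('a, 'm::fin_dim_inner) atlas \<Rightarrow> bool" where
  "smooth_atlas A \<longleftrightarrow>
     (\<forall>(U, x)\<in>A. inj_on x U \<and> open (x ` U)) \<and> (\<forall>c\<in>A. \<forall>d\<in>A. compatible c d)"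

definition points :: "('a, 'm) atlas \<Rightarrow> 'a set" where
  "points A = (\<Union>(U, x)\<in>A. U)"

definition mtopology :: "('a, 'm::fin_dim_inner) atlas \<Rightarrow> 'a topology" where
  "mtopology A = topology (\<lambda>W. W \<subseteq> points A \<and> (\<forall>(U, x)\<in>A. open (x ` (W \<inter> U))))"

definition smooth_manifold :: "('a, 'm::fin_dim_inner) atlas \<Rightarrow> bool" where
  "smooth_manifold A \<longleftrightarrow>
     smooth_atlas A \<and> Hausdorff_space (mtopology A) \<and> second_countable (mtopology A)"

text \<open>All charts of the manifold, i.e. the maximal atlas containing \<open>A\<close>.\<close>

definition charts :: "('a, 'm::fin_dim_inner) atlas \<Rightarrow> ('a, 'm) atlas" where
  "charts A = {c. fst c \<subseteq> points A \<and> smooth_atlas (insert c A)}"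

definition std_manifold :: "('m, 'm) atlas" where
  "std_manifold = {(UNIV, \<lambda>x. x)}"

definition open_submanifold :: "('a, 'm) atlas \<Rightarrow> 'a set \<Rightarrow> ('a, 'm) atlas" where
  "open_submanifold A W = (\<lambda>(U, x). (U \<inter> W, x)) ` A"

definition prod_manifold :: "('a, 'm) atlas \<Rightarrow> ('b, 'n) atlas \<Rightarrow> ('a \<times> 'b, 'm \<times> 'n) atlas" where
  "prod_manifold A B = (\<lambda>((U, x), (V, y)). (U \<times> V, map_prod x y)) ` (A \<times> B)"

definition smooth_map ::
    "('a, 'm::fin_dim_inner) atlas \<Rightarrow> ('b, 'n::fin_dim_inner) atlas \<Rightarrow> ('a \<Rightarrow> 'b) \<Rightarrow> bool" where
  "smooth_map A B f \<longleftrightarrow>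
     continuous_map (mtopology A) (mtopology B) f \<and>
     (\<forall>(U, x)\<in>A. \<forall>(V, y)\<in>B. Cinf_on (x ` (U \<inter> f -` V)) (y \<circ> f \<circ> inv_into U x))"

definition diffeomorphism ::
    "('a, 'm::fin_dim_inner) atlas \<Rightarrow> ('b, 'n::fin_dim_inner) atlas \<Rightarrow> ('a \<Rightarrow> 'b) \<Rightarrow> bool" where
  "diffeomorphism A B f \<longleftrightarrow>
     bij_betw f (points A) (points B) \<and>
     smooth_map A B f \<and> smooth_map B A (inv_into (points A) f)"


section \<open>Vector spaces and vector bundles\<close>

definition vector_space_on :: "'a set \<Rightarrow> ('a \<Rightarrow> 'a \<Rightarrow> 'a) \<Rightarrow> (real \<Rightarrow> 'a \<Rightarrow> 'a) \<Rightarrow> bool" where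
  "vector_space_on S add scl \<longleftrightarrow>
     (\<forall>v\<in>S. \<forall>w\<in>S. add v w \<in> S) \<and> (\<forall>r. \<forall>v\<in>S. scl r v \<in> S) \<and>
     (\<forall>u\<in>S. \<forall>v\<in>S. \<forall>w\<in>S. add (add u v) w = add u (add v w)) \<and>
     (\<forall>v\<in>S. \<forall>w\<in>S. add v w = add w v) \<and>
     (\<exists>z\<in>S. \<forall>v\<in>S. add z v = v \<and> (\<exists>w\<in>S. add v w = z)) \<and>
     (\<forall>r. \<forall>v\<in>S. \<forall>w\<in>S. scl r (add v w) = add (scl r v) (scl r w)) \<and>
     (\<forall>r s. \<forall>v\<in>S. scl (r + s) v = add (scl r v) (scl s v)) \<and>
     (\<forall>r s. \<forall>v\<in>S. scl (r * s) v = scl r (scl s v)) \<and>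
     (\<forall>v\<in>S. scl 1 v = v)"

record ('f, 'k) vspace =
  vman :: "('f, 'k) atlas"
  vadd :: "'f \<Rightarrow> 'f \<Rightarrow> 'f"
  vscale :: "real \<Rightarrow> 'f \<Rightarrow> 'f"

definition linear_coords :: "('f, 'k::fin_dim_inner) vspace \<Rightarrow> ('f \<Rightarrow> 'k) \<Rightarrow> bool" where
  "linear_coords V y \<longleftrightarrow>
     (points (vman V), y) \<in> charts (vman V) \<and> y ` points (vman V) = UNIV \<and>
     (\<forall>v\<in>points (vman V). \<forall>w\<in>points (vman V). y (vadd V v w) = y v + y w) \<and>
     (\<forall>r. \<forall>v\<in>points (vman V). y (vscale V r v) = r *\<^sub>R y v)"

text \<open>A finite-dimensional real vector space with its standard smooth structure.\<close>

definition smooth_vspace :: "('f, 'k::fin_dim_inner) vspace \<Rightarrow> bool" where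
  "smooth_vspace V \<longleftrightarrow>
     smooth_manifold (vman V) \<and> vector_space_on (points (vman V)) (vadd V) (vscale V) \<and>
     (\<exists>y. linear_coords V y)"

definition std_vspace :: "('k::real_vector, 'k) vspace" where
  "std_vspace = \<lparr>vman = std_manifold, vadd = (+), vscale = scaleR\<rparr>"

record ('a, 't, 'c, 'm, 'f, 'k) vbundle =
  total_man :: "('a, 't) atlas"
  base_man :: "('c, 'm) atlas"
  proj :: "'a \<Rightarrow> 'c"
  badd :: "'a \<Rightarrow> 'a \<Rightarrow> 'a"
  bscale :: "real \<Rightarrow> 'a \<Rightarrow> 'a"
  fibre :: "('f, 'k) vspace"

definition over :: "('a, 't, 'c, 'm, 'f, 'k) vbundle \<Rightarrow> 'c set \<Rightarrow> 'a set" where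
  "over B U = {e \<in> points (total_man B). proj B e \<in> U}"

definition local_trivialization ::
    "('a, 't::fin_dim_inner, 'c, 'm::fin_dim_inner, 'f, 'k::fin_dim_inner) vbundle \<Rightarrow>
     'c set \<Rightarrow> ('a \<Rightarrow> 'c \<times> 'f) \<Rightarrow> bool" where
  "local_trivialization B U \<psi> \<longleftrightarrow>
     openin (mtopology (base_man B)) U \<and>
     diffeomorphism (open_submanifold (total_man B) (over B U))
       (prod_manifold (open_submanifold (base_man B) U) (vman (fibre B))) \<psi> \<and>
     (\<forall>e\<in>over B U. fst (\<psi> e) = proj B e) \<and>
     (\<forall>e\<in>over B U. \<forall>e'\<in>over B U. proj B e = proj B e' \<longrightarrow>
        snd (\<psi> (badd B e e')) = vadd (fibre B) (snd (\<psi> e)) (snd (\<psi> e'))) \<and>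
     (\<forall>r. \<forall>e\<in>over B U. snd (\<psi> (bscale B r e)) = vscale (fibre B) r (snd (\<psi> e)))"

definition smooth_vector_bundle ::
    "('a, 't::fin_dim_inner, 'c, 'm::fin_dim_inner, 'f, 'k::fin_dim_inner) vbundle \<Rightarrow> bool" where
  "smooth_vector_bundle B \<longleftrightarrow>
     smooth_manifold (total_man B) \<and> smooth_manifold (base_man B) \<and> smooth_vspace (fibre B) \<and>
     smooth_map (total_man B) (base_man B) (proj B) \<and>
     (\<forall>x\<in>points (base_man B). vector_space_on (over B {x}) (badd B) (bscale B)) \<and>
     (\<forall>x\<in>points (base_man B). \<exists>U \<psi>. x \<in> U \<and> local_trivialization B U \<psi>)"


section \<open>First order jets at the origin\<close>

text \<open>The partial derivative \<open>\<partial>g/\<partial>u\<^sub>\<alpha>\<close> at the origin of \<open>\<real>\<^sup>p\<close>.\<close>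

definition partial0 :: "'p::finite \<Rightarrow> (real^'p \<Rightarrow> 'v::real_normed_vector) \<Rightarrow> 'v" where
  "partial0 \<alpha> g = vector_derivative (\<lambda>t. g (t *\<^sub>R axis \<alpha> 1)) (at 0)"

definition jet_equiv ::
    "('a, 'm::fin_dim_inner) atlas \<Rightarrow> (real^'p::finite \<Rightarrow> 'a) \<Rightarrow> (real^'p \<Rightarrow> 'a) \<Rightarrow> bool" where
  "jet_equiv A \<phi> \<xi> \<longleftrightarrow>
     (\<forall>f::'a \<Rightarrow> real. smooth_map A std_manifold f \<longrightarrow>
        f (\<phi> 0) = f (\<xi> 0) \<and> (\<forall>\<alpha>. partial0 \<alpha> (f \<circ> \<phi>) = partial0 \<alpha> (f \<circ> \<xi>)))"

text \<open>
  Members of a jet are globally smooth, but \<open>\<phi>\<close> itself is not required to be.  This makes sense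
  of \<open>jet A \<phi>\<close> for \<open>\<phi>\<close> smooth only near the origin, which is needed for \<open>h \<circ> \<phi>\<close> with \<open>h\<close> defined
  on an open subset (such as a local trivialization): the value is then the class of any globally
  smooth map that agrees with \<open>\<phi>\<close> near the origin.
\<close>

definition jet ::
    "('a, 'm::fin_dim_inner) atlas \<Rightarrow> (real^'p::finite \<Rightarrow> 'a) \<Rightarrow> (real^'p \<Rightarrow> 'a) set" where
  "jet A \<phi> = {\<xi>. smooth_map std_manifold A \<xi> \<and> jet_equiv A \<phi> \<xi>}"

definition jets_over ::
    "('a, 'm::fin_dim_inner) atlas \<Rightarrow> 'a set \<Rightarrow> (real^'p::finite \<Rightarrow> 'a) set set" where
  "jets_over A U = {jet A \<phi> | \<phi>. smooth_map std_manifold A \<phi> \<and> \<phi> 0 \<in> U}"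

definition jet_rep :: "(real^'p::finite \<Rightarrow> 'a) set \<Rightarrow> real^'p \<Rightarrow> 'a" where
  "jet_rep j = (SOME \<phi>. \<phi> \<in> j)"

text \<open>
  The coordinates \<open>(x\<^sub>i, x\<^sup>i\<^sub>\<alpha>)\<close> of a jet; \<open>'m^'p\<close> holds the columns of an element of \<open>L(\<real>\<^sup>p, 'm)\<close>.
\<close>

definition jet_coord ::
    "('a \<Rightarrow> 'm) \<Rightarrow> (real^'p::finite \<Rightarrow> 'a) set \<Rightarrow> 'm::real_normed_vector \<times> ('m^'p)" where
  "jet_coord x j = (x (jet_rep j 0), \<chi> \<alpha>. partial0 \<alpha> (x \<circ> jet_rep j))"

definition jet_manifold ::
    "('a, 'm::fin_dim_inner) atlas \<Rightarrow> ((real^'p::finite \<Rightarrow> 'a) set, 'm \<times> ('m^'p)) atlas" where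
  "jet_manifold A = (\<lambda>(U, x). (jets_over A U, jet_coord x)) ` charts A"

text \<open>The map \<open>h\<^sup>1\<close> induced by \<open>h\<close>, with target manifold \<open>A'\<close>.\<close>

definition jet_map ::
    "('b, 'n::fin_dim_inner) atlas \<Rightarrow> ('a \<Rightarrow> 'b) \<Rightarrow>
     (real^'p::finite \<Rightarrow> 'a) set \<Rightarrow> (real^'p \<Rightarrow> 'b) set" where
  "jet_map A' h j = jet A' (h \<circ> jet_rep j)"

definition jet_proj :: "(real^'p::finite \<Rightarrow> 'a) set \<Rightarrow> 'a" where
  "jet_proj j = jet_rep j 0"

definition jet_vspace ::
    "('f, 'k::fin_dim_inner) vspace \<Rightarrow> ((real^'p::finite \<Rightarrow> 'f) set, 'k \<times> ('k^'p)) vspace" where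
  "jet_vspace V =
     \<lparr>vman = jet_manifold (vman V),
      vadd = (\<lambda>j j'. jet (vman V) (\<lambda>u. vadd V (jet_rep j u) (jet_rep j' u))),
      vscale = (\<lambda>r j. jet (vman V) (\<lambda>u. vscale V r (jet_rep j u)))\<rparr>"


section \<open>The two vector bundle structures on the first jet manifold of a vector bundle\<close>

text \<open>
  Bundle charts \<open>(U, x, \<psi>, y)\<close>: \<open>(U, x)\<close> is a chart of the base, \<open>\<psi>\<close> a local trivialization over
  \<open>U\<close>, and \<open>y\<close> are linear coordinates on the typical fibre.
\<close>

definition bundle_charts ::
    "('a, 't::fin_dim_inner, 'c, 'm::fin_dim_inner, 'f, 'k::fin_dim_inner) vbundle \<Rightarrow>
     ('c set \<times> ('c \<Rightarrow> 'm) \<times> ('a \<Rightarrow> 'c \<times> 'f) \<times> ('f \<Rightarrow> 'k)) set" where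
  "bundle_charts B =
     {(U, x, \<psi>, y). (U, x) \<in> charts (base_man B) \<and> local_trivialization B U \<psi> \<and>
        linear_coords (fibre B) y}"

text \<open>The components \<open>(x, y, X\<^sub>\<alpha>, Y\<^sub>\<alpha>)\<close> of a jet in a bundle chart.\<close>

definition jet_comps ::
    "('a, 't, 'c, 'm::fin_dim_inner, 'f, 'k::fin_dim_inner) vbundle \<Rightarrow>
     ('c set \<times> ('c \<Rightarrow> 'm) \<times> ('a \<Rightarrow> 'c \<times> 'f) \<times> ('f \<Rightarrow> 'k)) \<Rightarrow>
     (real^'p::finite \<Rightarrow> 'a) set \<Rightarrow> 'm \<times> 'k \<times> ('m^'p) \<times> ('k^'p)" where
  "jet_comps B = (\<lambda>(U, x, \<psi>, y) j.
     let \<Phi> = jet_rep j; xbar = x \<circ> proj B; ybar = y \<circ> snd \<circ> \<psi>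
     in (xbar (\<Phi> 0), ybar (\<Phi> 0),
         \<chi> \<alpha>. partial0 \<alpha> (xbar \<circ> \<Phi>), \<chi> \<alpha>. partial0 \<alpha> (ybar \<circ> \<Phi>)))"

text \<open>
  The jet whose components are obtained by applying \<open>h\<close> to those of \<open>j\<close> and \<open>j'\<close>, simultaneously
  in all bundle charts around \<open>j\<close>.  The fibre operations below are of this form; part of the claim
  that they yield vector bundles is that such a jet exists, i.e. that the operations do not depend
  on the bundle chart.
\<close>

definition jet_op ::
    "('a, 't::fin_dim_inner, 'c, 'm::fin_dim_inner, 'f, 'k::fin_dim_inner) vbundle \<Rightarrow>
     ('m \<times> 'k \<times> ('m^'p) \<times> ('k^'p) \<Rightarrow> 'm \<times> 'k \<times> ('m^'p) \<times> ('k^'p) \<Rightarrow> 'm \<times> 'k \<times> ('m^'p) \<times> ('k^'p)) \<Rightarrow>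
     (real^'p::finite \<Rightarrow> 'a) set \<Rightarrow> (real^'p \<Rightarrow> 'a) set \<Rightarrow> (real^'p \<Rightarrow> 'a) set" where
  "jet_op B h j j' = (THE l. l \<in> jets_over (total_man B) (points (total_man B)) \<and>
     (\<forall>(U, x, \<psi>, y)\<in>bundle_charts B. j \<in> jets_over (total_man B) (over B U) \<longrightarrow>
        l \<in> jets_over (total_man B) (over B U) \<and>
        jet_comps B (U, x, \<psi>, y) l =
          h (jet_comps B (U, x, \<psi>, y) j) (jet_comps B (U, x, \<psi>, y) j')))"

definition primary_bundle ::
    "('a, 't::fin_dim_inner, 'c, 'm::fin_dim_inner, 'f, 'k::fin_dim_inner) vbundle \<Rightarrow>
     ((real^'p::finite \<Rightarrow> 'a) set, 't \<times> ('t^'p), 'a, 't, ('m \<times> 'k)^'p, ('m \<times> 'k)^'p) vbundle" where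
  "primary_bundle B =
     \<lparr>total_man = jet_manifold (total_man B),
      base_man = total_man B,
      proj = jet_proj,
      badd = jet_op B (\<lambda>(x, y, X, Y) (x', y', X', Y'). (x, y, X + X', Y + Y')),
      bscale = (\<lambda>r j. jet_op B (\<lambda>(x, y, X, Y) _. (x, y, r *\<^sub>R X, r *\<^sub>R Y)) j j),
      fibre = std_vspace\<rparr>"

definition primary_trivialization ::
    "('a, 't, 'c, 'm::fin_dim_inner, 'f, 'k::fin_dim_inner) vbundle \<Rightarrow>
     ('c set \<times> ('c \<Rightarrow> 'm) \<times> ('a \<Rightarrow> 'c \<times> 'f) \<times> ('f \<Rightarrow> 'k)) \<Rightarrow>
     (real^'p::finite \<Rightarrow> 'a) set \<Rightarrow> 'a \<times> (('m \<times> 'k)^'p)" where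
  "primary_trivialization B c j =
     (case jet_comps B c j of (x, y, X, Y) \<Rightarrow> (jet_proj j, \<chi> \<alpha>. (X $ \<alpha>, Y $ \<alpha>)))"

definition primary_charts ::
    "('a, 't::fin_dim_inner, 'c, 'm::fin_dim_inner, 'f, 'k::fin_dim_inner) vbundle \<Rightarrow>
     ((real^'p::finite \<Rightarrow> 'a) set, 'm \<times> 'k \<times> (('m \<times> 'k)^'p)) atlas" where
  "primary_charts B =
     (\<lambda>(U, x, \<psi>, y).
        (jets_over (total_man B) (over B U),
         \<lambda>j. case jet_comps B (U, x, \<psi>, y) j of (a, b, X, Y) \<Rightarrow>
           (a, b, \<chi> \<alpha>. (X $ \<alpha>, Y $ \<alpha>)))) ` bundle_charts B"

definition secondary_bundle ::
    "('a, 't::fin_dim_inner, 'c, 'm::fin_dim_inner, 'f, 'k::fin_dim_inner) vbundle \<Rightarrow>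
     ((real^'p::finite \<Rightarrow> 'a) set, 't \<times> ('t^'p), (real^'p \<Rightarrow> 'c) set, 'm \<times> ('m^'p),
      (real^'p \<Rightarrow> 'f) set, 'k \<times> ('k^'p)) vbundle" where
  "secondary_bundle B =
     \<lparr>total_man = jet_manifold (total_man B),
      base_man = jet_manifold (base_man B),
      proj = jet_map (base_man B) (proj B),
      badd = jet_op B (\<lambda>(x, y, X, Y) (x', y', X', Y'). (x, y + y', X, Y + Y')),
      bscale = (\<lambda>r j. jet_op B (\<lambda>(x, y, X, Y) _. (x, r *\<^sub>R y, X, r *\<^sub>R Y)) j j),
      fibre = jet_vspace (fibre B)\<rparr>"

text \<open>\<open>\<psi>\<^sup>1\<close>, with the jets of \<open>U \<times> E\<close> identified with pairs of jets.\<close>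

definition secondary_trivialization ::
    "('a, 't, 'c, 'm::fin_dim_inner, 'f, 'k::fin_dim_inner) vbundle \<Rightarrow> ('a \<Rightarrow> 'c \<times> 'f) \<Rightarrow>
     (real^'p::finite \<Rightarrow> 'a) set \<Rightarrow> (real^'p \<Rightarrow> 'c) set \<times> (real^'p \<Rightarrow> 'f) set" where
  "secondary_trivialization B \<psi> j =
     (jet_map (base_man B) (proj B) j, jet_map (vman (fibre B)) (snd \<circ> \<psi>) j)"

definition secondary_charts ::
    "('a, 't::fin_dim_inner, 'c, 'm::fin_dim_inner, 'f, 'k::fin_dim_inner) vbundle \<Rightarrow>
     ((real^'p::finite \<Rightarrow> 'a) set, ('m \<times> ('m^'p)) \<times> ('k \<times> ('k^'p))) atlas" where
  "secondary_charts B =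
     (\<lambda>(U, x, \<psi>, y).
        (jets_over (total_man B) (over B U),
         map_prod (jet_coord x) (jet_coord y) \<circ> secondary_trivialization B \<psi>)) ` bundle_charts B"

end

theory Submission
  imports Defs
begin

text \<open>
  In a chart \<open>x\<close>, the jet of \<open>\<phi>\<close> is given by the point \<open>x (\<phi> 0)\<close> and the first derivative of \<open>x \<circ> \<phi>\<close> at the
  origin, and a change of coordinates \<open>\<tau>\<close> acts by its first prolongation
  \<open>(a, X) \<mapsto> (\<tau> a, D\<tau>(a) X)\<close>, which is smooth.  So the jets of a manifold form a manifold
  (\<open>smooth_manifold_jet_manifold\<close>).  Two points need work.  Jets are defined by globally smooth functions,
  and these determine the coordinates of a jet only because functions in a chart extend after
  multiplication by a bump function; here the Hausdorff property enters (\<open>jet_equiv_iff\<close>).  Conversely,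
  every pair \<open>(a, X)\<close> must be the jet of a map defined on all of \<open>\<real>\<^sup>p\<close> (\<open>smooth_curve_with_jet\<close>).

  The bundle coordinates \<open>e \<mapsto> (x (\<pi> e), y (pr\<^sub>2 (\<psi> e)))\<close> are coordinates on the manifold \<open>E\<close>
  (\<open>chart_of_bundle_coord\<close>), although their values do not lie in its model space.  They induce coordinates
  \<open>((x, y), (X\<^sub>\<alpha>, Y\<^sub>\<alpha>))\<close> on jets.  The primary and the secondary charts list the same components in other
  orders, so each family consists of charts of the jet manifold of \<open>E\<close>.  This is the compatibility claim,
  and it also makes the trivializations of both bundles diffeomorphisms, since they become the
  identity in suitable coordinates (\<open>diffeomorphismI_global_charts\<close>).

  What remains is that the fibre operations, which are defined by components, do not depend on the
  bundle chart.  For the primary structure this holds because the components \<open>(X\<^sub>\<alpha>, Y\<^sub>\<alpha>)\<close> of jets at one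
  point change by the linear map \<open>D\<tau>\<close> (\<open>primary_combination\<close>).  For the secondary structure, jets with the
  same projection have representatives \<open>\<Phi>\<close>, \<open>\<Phi>'\<close> with the same projection to \<open>M\<close>.  The jet of the
  pointwise combination \<open>r \<Phi> + s \<Phi>'\<close>, taken in the fibres of \<open>E\<close>, has the required components in every
  bundle chart, as all trivializations are linear on fibres (\<open>secondary_combination\<close>).
\<close>

section \<open>Finite-dimensional inner product spaces\<close>

text \<open>
  Orthogonalizing a spanning set may produce zero vectors; they are discarded before normalizing.
  The expansion also holds in the zero space, with the empty basis.
\<close>

lemma orthonormal_expansion_exists:
  "\<exists>C::'a::fin_dim_inner set. finite C \<and> (\<forall>v. (\<Sum>b\<in>C. (v \<bullet> b) *\<^sub>R b) = v)"
proof -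
  obtain B :: "'a set" where B: "finite B" "span B = UNIV"
    using finite_spanning_set by blast
  obtain C where C: "finite C" "span C = span B" "pairwise orthogonal C"
    using basis_orthogonal[OF B(1)] by blast
  define D where "D = (\<lambda>b. b /\<^sub>R norm b) ` (C - {0})"
  have fin: "finite D"
    using C(1) by (simp add: D_def)
  have unit: "d \<bullet> d = 1" if "d \<in> D" for d
    using that by (auto simp: D_def dot_square_norm power2_eq_square field_simps split: if_splits)
  have orth: "c \<bullet> d = 0" if cd: "c \<in> D" "d \<in> D" "c \<noteq> d" for c d
  proof -
    obtain x y where x: "x \<in> C" "c = x /\<^sub>R norm x" and y: "y \<in> C" "d = y /\<^sub>R norm y"
      using cd(1,2) unfolding D_def by blast
    with cd have "x \<noteq> y" by auto
    then have "x \<bullet> y = 0"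
      using C(3) x y by (auto simp: pairwise_def orthogonal_def)
    then show ?thesis by (simp add: x y)
  qed
  have "C \<subseteq> span D"
  proof
    fix b assume "b \<in> C"
    show "b \<in> span D"
    proof (cases "b = 0")
      case False
      then have "b /\<^sub>R norm b \<in> span D"
        using \<open>b \<in> C\<close> by (intro span_base) (auto simp: D_def)
      then have "norm b *\<^sub>R (b /\<^sub>R norm b) \<in> span D"
        by (rule span_scale)
      with False show ?thesis by simp
    qed (simp add: span_zero)
  qed
  then have "span D = UNIV"
    using C(2) B(2) span_minimal[OF _ subspace_span] by blast
  have "(\<Sum>b\<in>D. (v \<bullet> b) *\<^sub>R b) = v" for v
  proof -
    have "v \<in> span D" using \<open>span D = UNIV\<close> by simp
    then show ?thesis
    proof (induction rule: span_induct_alt)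
      case base
      show ?case by simp
    next
      case (step c x y)
      have "(\<Sum>b\<in>D. (x \<bullet> b) *\<^sub>R b) = (\<Sum>b\<in>D. if b = x then x else 0)"
        using step(1) unit orth by (intro sum.cong) auto
      also have "\<dots> = x"
        using fin step(1) by simp
      finally have "(\<Sum>b\<in>D. (x \<bullet> b) *\<^sub>R b) = x" .
      then show ?case
        using step(2)
        by (simp add: inner_add_left scaleR_add_left sum.distrib flip: scaleR_scaleR scaleR_sum_right)
    qed
  qed
  with fin show ?thesis by blast
qed

text \<open>
  A finite set chosen by the expansion property of orthonormal bases alone; expanding in it plays the
  role of the coordinates in \<^class>\<open>euclidean_space\<close>.
\<close>

definition onb :: "'a::fin_dim_inner set" where
  "onb = (SOME C. finite C \<and> (\<forall>v. (\<Sum>b\<in>C. (v \<bullet> b) *\<^sub>R b) = v))"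

lemma finite_onb: "finite (onb :: 'a::fin_dim_inner set)"
  and onb_expansion: "(\<Sum>b\<in>onb. (v \<bullet> b) *\<^sub>R b) = (v :: 'a)"
  using someI_ex[OF orthonormal_expansion_exists[where 'a='a]]
  unfolding onb_def[symmetric] by blast+

lemma linear_onb_expansion:
  fixes L :: "'a::fin_dim_inner \<Rightarrow> 'b::real_vector"
  assumes "linear L"
  shows "L v = (\<Sum>b\<in>onb. (v \<bullet> b) *\<^sub>R L b)"
  by (subst (1) onb_expansion[of v, symmetric])
    (simp add: linear_sum[OF assms] linear_scale[OF assms])

lemma linear_imp_bounded_linear:
  fixes L :: "'a::fin_dim_inner \<Rightarrow> 'b::real_normed_vector"
  assumes "linear L"
  shows "bounded_linear L"
proof -
  have "bounded_linear (\<lambda>v. \<Sum>b\<in>onb. (v \<bullet> b) *\<^sub>R L b)"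
    by (intro bounded_linear_sum bounded_linear_compose[OF bounded_linear_scaleR_left]
        bounded_linear_inner_left)
  then show ?thesis
    using linear_onb_expansion[OF assms] by (metis (no_types, lifting) ext)
qed

text \<open>
  A ball is contained in the set of combinations with bounded coefficients, which is a finite sum of
  compact segments.
\<close>

lemma compact_cball_fin_dim: "compact (cball a r :: 'a::fin_dim_inner set)"
proof -
  define R where "R = norm a + r"
  have *: "compact {\<Sum>b\<in>C. f b *\<^sub>R b | f. \<forall>b\<in>C. \<bar>f b\<bar> \<le> R * norm b}"
    if "finite C" for C :: "'a set"
    using that
  proof (induction C)
    case empty
    then show ?case by simp
  next
    case (insert c C)
    let ?S = "{\<Sum>b\<in>C. f b *\<^sub>R b | f. \<forall>b\<in>C. \<bar>f b\<bar> \<le> R * norm b}"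
    have cpt: "compact ((\<lambda>t. t *\<^sub>R c) ` {- R * norm c .. R * norm c})"
      by (intro compact_continuous_image continuous_intros) auto
    have "{\<Sum>b\<in>insert c C. f b *\<^sub>R b | f. \<forall>b\<in>insert c C. \<bar>f b\<bar> \<le> R * norm b} =
        {x + y | x y. x \<in> (\<lambda>t. t *\<^sub>R c) ` {- R * norm c .. R * norm c} \<and> y \<in> ?S}" (is "?L = ?R")
    proof (intro set_eqI iffI)
      fix z assume "z \<in> ?L"
      then obtain f where f: "z = (\<Sum>b\<in>insert c C. f b *\<^sub>R b)" "\<forall>b\<in>insert c C. \<bar>f b\<bar> \<le> R * norm b"
        by blast
      moreover have "f c *\<^sub>R c \<in> (\<lambda>t. t *\<^sub>R c) ` {- R * norm c .. R * norm c}"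
        using f(2) by (intro imageI) auto
      ultimately show "z \<in> ?R"
        using insert.hyps by auto
    next
      fix z assume "z \<in> ?R"
      then obtain t f where z: "z = t *\<^sub>R c + (\<Sum>b\<in>C. f b *\<^sub>R b)" "\<bar>t\<bar> \<le> R * norm c"
          "\<forall>b\<in>C. \<bar>f b\<bar> \<le> R * norm b"
        by (auto simp: abs_le_iff)
      have "z = (\<Sum>b\<in>insert c C. (f(c := t)) b *\<^sub>R b)"
        using insert.hyps z(1) by (auto intro!: sum.cong)
      moreover have "\<forall>b\<in>insert c C. \<bar>(f(c := t)) b\<bar> \<le> R * norm b"
        using z by auto
      ultimately show "z \<in> ?L" by blast
    qed
    then show ?case
      using compact_sums[OF cpt insert.IH] by simp
  qed
  have "cball a r \<subseteq> {\<Sum>b\<in>onb. f b *\<^sub>R b | f. \<forall>b\<in>onb. \<bar>f b\<bar> \<le> R * norm b}"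
  proof
    fix v assume "v \<in> cball a r"
    then have "norm v \<le> R"
      unfolding R_def using norm_triangle_ineq2[of v a] by (simp add: dist_norm norm_minus_commute)
    then have "\<forall>b\<in>onb. \<bar>v \<bullet> b\<bar> \<le> R * norm b"
      using Cauchy_Schwarz_ineq2[of v] by (meson mult_right_mono norm_ge_zero order_trans)
    then show "v \<in> {\<Sum>b\<in>onb. f b *\<^sub>R b | f. \<forall>b\<in>onb. \<bar>f b\<bar> \<le> R * norm b}"
      using onb_expansion[of v] by (intro CollectI exI[of _ "\<lambda>b. v \<bullet> b"]) simp
  qed
  then show ?thesis
    using compact_Int_closed[OF *[OF finite_onb] closed_cball[of a r]] by (simp add: Int_absorb1)
qed

text \<open>
  The base consists of the balls of rational radius around the rational combinations of \<^const>\<open>onb\<close>.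
\<close>

lemma second_countable_fin_dim:
  "\<exists>\<B>::'a::fin_dim_inner set set. countable \<B> \<and> (\<forall>B\<in>\<B>. open B) \<and>
     (\<forall>S a. open S \<longrightarrow> a \<in> S \<longrightarrow> (\<exists>B\<in>\<B>. a \<in> B \<and> B \<subseteq> S))"
proof -
  define D where "D = {\<Sum>b\<in>onb. q b *\<^sub>R b | q. q \<in> (onb::'a set) \<rightarrow>\<^sub>E \<rat>}"
  have cD: "countable D"
  proof -
    have "countable ((onb::'a set) \<rightarrow>\<^sub>E (\<rat>::real set))"
      by (rule countable_PiE[OF finite_onb]) (rule countable_rat)
    moreover have "D = (\<lambda>q. \<Sum>b\<in>onb. q b *\<^sub>R b) ` ((onb::'a set) \<rightarrow>\<^sub>E \<rat>)"
      by (auto simp: D_def)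
    ultimately show ?thesis by simp
  qed
  have dense: "\<exists>d\<in>D. dist d a < e" if "e > 0" for a :: 'a and e
  proof -
    \<comment> \<open>the summand 1 keeps \<open>K\<close> positive in the zero space\<close>
    define K where "K = (\<Sum>b\<in>(onb::'a set). norm b) + 1"
    have K: "K > 0"
      unfolding K_def by (simp add: sum_nonneg add_nonneg_pos)
    have "\<exists>q\<in>\<rat>. \<bar>q - a \<bullet> b\<bar> < e / K" for b
    proof -
      have "a \<bullet> b - e / K < a \<bullet> b + e / K"
        using that K by simp
      then obtain q where "q \<in> \<rat>" "a \<bullet> b - e / K < q" "q < a \<bullet> b + e / K"
        using Rats_dense_in_real by blast
      then show ?thesis by (intro bexI[of _ q]) (auto simp: abs_less_iff)
    qed
    then obtain q where q: "\<And>b. q b \<in> \<rat>" "\<And>b. \<bar>q b - a \<bullet> b\<bar> < e / K"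
      by metis
    let ?d = "\<Sum>b\<in>onb. q b *\<^sub>R b"
    have "?d = (\<Sum>b\<in>onb. restrict q onb b *\<^sub>R b)"
      by (intro sum.cong) auto
    then have "?d \<in> D"
      using q(1) unfolding D_def by (intro CollectI exI[of _ "restrict q onb"]) auto
    moreover have "dist ?d a < e"
    proof -
      have "?d - a = (\<Sum>b\<in>onb. (q b - a \<bullet> b) *\<^sub>R b)"
        by (subst (1) onb_expansion[of a, symmetric]) (simp add: scaleR_diff_left sum_subtractf)
      then have "norm (?d - a) \<le> (\<Sum>b\<in>onb. norm ((q b - a \<bullet> b) *\<^sub>R b))"
        by (simp only: norm_sum)
      also have "\<dots> \<le> (\<Sum>b\<in>(onb::'a set). e / K * norm b)"
        unfolding norm_scaleR real_norm_def
        by (rule sum_mono, rule mult_right_mono[OF less_imp_le[OF q(2)] norm_ge_zero])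
      also have "\<dots> = e / K * (K - 1)"
        by (simp add: K_def sum_distrib_left)
      also have "\<dots> < e"
        using K that by (simp add: field_simps)
      finally show ?thesis by (simp add: dist_norm)
    qed
    ultimately show ?thesis by blast
  qed
  define \<B> where "\<B> = (\<lambda>(d, r). ball d r) ` (D \<times> \<rat>)"
  have "countable \<B>"
    unfolding \<B>_def using cD countable_rat by auto
  moreover have "\<forall>B\<in>\<B>. open B"
    by (auto simp: \<B>_def)
  moreover have "\<exists>B\<in>\<B>. a \<in> B \<and> B \<subseteq> S" if S: "open S" "a \<in> S" for S and a :: 'a
  proof -
    obtain e where e: "e > 0" "ball a e \<subseteq> S"
      using S open_contains_ball by blast
    obtain r where r: "r \<in> \<rat>" "0 < r" "r < e / 2"
      using Rats_dense_in_real[of 0 "e / 2"] e by auto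
    obtain d where d: "d \<in> D" "dist d a < r"
      using dense r by blast
    have "ball d r \<subseteq> ball a e"
    proof
      fix z assume "z \<in> ball d r"
      then have "dist a z < r + r"
        using dist_triangle[of a z d] d(2) by (simp add: dist_commute)
      then show "z \<in> ball a e" using r by simp
    qed
    then show ?thesis
      using d r e by (intro bexI[of _ "ball d r"]) (auto simp: \<B>_def)
  qed
  ultimately show ?thesis by blast
qed

section \<open>Calculus of smooth maps\<close>

lemma Ck_on_cong:
  assumes "open W" "\<And>x. x \<in> W \<Longrightarrow> f x = g x" "Ck_on k W f"
  shows "Ck_on k W g"
  using assms(2,3)
proof (induction k arbitrary: f g)
  case 0
  then show ?case by (simp cong: continuous_on_cong)
next
  case (Suc k)
  have "g differentiable at x" if "x \<in> W" for x
    using Suc.prems that assms(1) has_derivative_transform_within_open[of f _ x UNIV W g]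
    by (force simp: differentiable_def)
  moreover have "Ck_on k W (\<lambda>x. frechet_derivative g (at x) v)" for v
  proof (rule Suc.IH)
    show "Ck_on k W (\<lambda>x. frechet_derivative f (at x) v)" using Suc.prems by simp
    show "frechet_derivative f (at x) v = frechet_derivative g (at x) v" if "x \<in> W" for x
      using frechet_derivative_transform_within_open[of f x W g] that Suc.prems assms(1) by simp
  qed
  ultimately show ?case by simp
qed

lemma Ck_on_SucI:
  assumes "open W" "\<And>x. x \<in> W \<Longrightarrow> (f has_derivative f' x) (at x)"
    and "\<And>v. Ck_on k W (\<lambda>x. f' x v)"
  shows "Ck_on (Suc k) W f"
proof -
  have "f' x v = frechet_derivative f (at x) v" if "x \<in> W" for x v
    using frechet_derivative_at[OF assms(2)[OF that]] by simp
  then have "Ck_on k W (\<lambda>x. frechet_derivative f (at x) v)" for v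
    by (rule Ck_on_cong[OF assms(1) _ assms(3)])
  then show ?thesis
    using assms(2) by (auto simp: differentiable_def)
qed

lemma Ck_on_Suc_imp: "Ck_on (Suc k) W f \<Longrightarrow> Ck_on k W f"
proof (induction k arbitrary: f)
  case 0
  then show ?case
    by (auto intro!: differentiable_imp_continuous_within continuous_at_imp_continuous_on)
next
  case (Suc k)
  then show ?case by auto
qed

lemma Ck_on_subset: "Ck_on k W f \<Longrightarrow> W' \<subseteq> W \<Longrightarrow> Ck_on k W' f"
  by (induction k arbitrary: f) (auto intro: continuous_on_subset)

lemma Ck_on_local:
  assumes "\<And>x. x \<in> W \<Longrightarrow> \<exists>N. open N \<and> x \<in> N \<and> Ck_on k N f"
  shows "Ck_on k W f"
  using assms
proof (induction k arbitrary: f)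
  case 0
  have "isCont f x" if x: "x \<in> W" for x
  proof -
    obtain N where "open N" "x \<in> N" "continuous_on N f"
      using 0[OF x] by auto
    then show ?thesis by (simp add: continuous_on_eq_continuous_at)
  qed
  then show ?case
    by (simp add: continuous_at_imp_continuous_on)
next
  case (Suc k)
  have "f differentiable at x" if x: "x \<in> W" for x
    using Suc.prems[OF x] by auto
  moreover have "Ck_on k W (\<lambda>x. frechet_derivative f (at x) v)" for v
  proof (rule Suc.IH)
    fix x assume x: "x \<in> W"
    show "\<exists>N. open N \<and> x \<in> N \<and> Ck_on k N (\<lambda>x. frechet_derivative f (at x) v)"
      using Suc.prems[OF x] by auto
  qed
  ultimately show ?case by simp
qed

lemma Ck_on_differentiable: "Ck_on (Suc k) W f \<Longrightarrow> x \<in> W \<Longrightarrow>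
    (f has_derivative frechet_derivative f (at x)) (at x)"
  by (rule frechet_derivative_works[THEN iffD1]) simp

lemma Ck_on_linear:
  assumes "bounded_linear L" "open W" "Ck_on k W f"
  shows "Ck_on k W (\<lambda>x. L (f x))"
  using assms(3)
proof (induction k arbitrary: f)
  case 0
  then show ?case
    using bounded_linear.continuous_on[OF assms(1)] by simp
next
  case (Suc k)
  show ?case
  proof (rule Ck_on_SucI[OF assms(2)])
    show "((\<lambda>x. L (f x)) has_derivative (\<lambda>v. L (frechet_derivative f (at x) v))) (at x)" if "x \<in> W" for x
      by (rule bounded_linear.has_derivative[OF assms(1) Ck_on_differentiable[OF Suc.prems that]])
    show "Ck_on k W (\<lambda>x. L (frechet_derivative f (at x) v))" for v
      using Suc.prems by (intro Suc.IH) simp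
  qed
qed

lemma Ck_on_const: "open W \<Longrightarrow> Ck_on k W (\<lambda>_. c)"
  by (induction k arbitrary: c) auto

lemma Ck_on_ident: "open W \<Longrightarrow> Ck_on k W (\<lambda>x. x)"
  by (cases k) (auto intro: Ck_on_const)

lemma Ck_on_add:
  assumes "open W" "Ck_on k W f" "Ck_on k W g"
  shows "Ck_on k W (\<lambda>x. f x + g x)"
  using assms(2,3)
proof (induction k arbitrary: f g)
  case 0
  then show ?case by (simp add: continuous_on_add)
next
  case (Suc k)
  show ?case
  proof (rule Ck_on_SucI[OF assms(1)])
    show "((\<lambda>x. f x + g x) has_derivative
        (\<lambda>v. frechet_derivative f (at x) v + frechet_derivative g (at x) v)) (at x)" if "x \<in> W" for x
      by (intro has_derivative_add Ck_on_differentiable[OF Suc.prems(1) that]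
          Ck_on_differentiable[OF Suc.prems(2) that])
    show "Ck_on k W (\<lambda>x. frechet_derivative f (at x) v + frechet_derivative g (at x) v)" for v
      using Suc.prems by (intro Suc.IH) simp_all
  qed
qed

lemma Ck_on_sum:
  assumes "open W" "finite I" "\<And>i. i \<in> I \<Longrightarrow> Ck_on k W (f i)"
  shows "Ck_on k W (\<lambda>x. \<Sum>i\<in>I. f i x)"
  using assms(2,3)
proof (induction I)
  case empty
  show ?case using Ck_on_const[OF assms(1)] by simp
next
  case (insert i I)
  then show ?case using Ck_on_add[OF assms(1), of k "f i" "\<lambda>x. \<Sum>i\<in>I. f i x"] by simp
qed

lemma Ck_on_bilinear:
  assumes "bounded_bilinear bop" "open W" "Ck_on k W f" "Ck_on k W g"
  shows "Ck_on k W (\<lambda>x. bop (f x) (g x))"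
  using assms(3,4)
proof (induction k arbitrary: f g)
  case 0
  then show ?case by (simp add: bounded_bilinear.continuous_on[OF assms(1)])
next
  case (Suc k)
  show ?case
  proof (rule Ck_on_SucI[OF assms(2)])
    show "((\<lambda>x. bop (f x) (g x)) has_derivative
        (\<lambda>v. bop (f x) (frechet_derivative g (at x) v) + bop (frechet_derivative f (at x) v) (g x)))
        (at x)" if "x \<in> W" for x
      by (intro bounded_bilinear.FDERIV[OF assms(1)] Ck_on_differentiable[OF Suc.prems(1) that]
          Ck_on_differentiable[OF Suc.prems(2) that])
    show "Ck_on k W
       (\<lambda>x. bop (f x) (frechet_derivative g (at x) v) + bop (frechet_derivative f (at x) v) (g x))" for v
    proof (rule Ck_on_add[OF assms(2)])
      show "Ck_on k W (\<lambda>x. bop (f x) (frechet_derivative g (at x) v))"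
        using Suc.prems(2) by (intro Suc.IH[OF Ck_on_Suc_imp[OF Suc.prems(1)]]) simp
      show "Ck_on k W (\<lambda>x. bop (frechet_derivative f (at x) v) (g x))"
        using Suc.prems(1) by (intro Suc.IH[OF _ Ck_on_Suc_imp[OF Suc.prems(2)]]) simp
    qed
  qed
qed

text \<open>
  The derivative \<open>Dg(f x)(Df x v)\<close> of a composition pairs two variable quantities, so the induction
  hypothesis applies only after \<open>Df x v\<close> is expanded in a finite basis.
\<close>

lemma Ck_on_compose:
  fixes f :: "'a::real_normed_vector \<Rightarrow> 'b::fin_dim_inner"
  assumes "open W" "open V" "f ` W \<subseteq> V" "Ck_on k W f" "Ck_on k V g"
  shows "Ck_on k W (\<lambda>x. g (f x))"
  using assms(4,5)
proof (induction k arbitrary: g)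
  case 0
  then show ?case
    using continuous_on_compose2[OF _ _ assms(3)] by simp
next
  case (Suc k)
  let ?f = "\<lambda>x. frechet_derivative f (at x)" and ?g = "\<lambda>y. frechet_derivative g (at y)"
  show ?case
  proof (rule Ck_on_SucI[OF assms(1)])
    show "((\<lambda>x. g (f x)) has_derivative (\<lambda>v. \<Sum>b\<in>onb. (?f x v \<bullet> b) *\<^sub>R ?g (f x) b)) (at x)"
      if "x \<in> W" for x
    proof -
      have g: "(g has_derivative ?g (f x)) (at (f x))"
        using Ck_on_differentiable[OF Suc.prems(2)] that assms(3) by blast
      have "((\<lambda>x. g (f x)) has_derivative (\<lambda>v. ?g (f x) (?f x v))) (at x)"
        using diff_chain_at[OF Ck_on_differentiable[OF Suc.prems(1) that] g] by (simp add: o_def)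
      moreover have "(\<lambda>v. ?g (f x) (?f x v)) = (\<lambda>v. \<Sum>b\<in>onb. (?f x v \<bullet> b) *\<^sub>R ?g (f x) b)"
        by (rule ext, rule linear_onb_expansion[OF has_derivative_linear[OF g]])
      ultimately show ?thesis by simp
    qed
    show "Ck_on k W (\<lambda>x. \<Sum>b\<in>onb. (?f x v \<bullet> b) *\<^sub>R ?g (f x) b)" for v
    proof (intro Ck_on_sum[OF assms(1) finite_onb] Ck_on_bilinear[OF bounded_bilinear_scaleR assms(1)]
        Ck_on_linear[OF bounded_linear_inner_left assms(1)])
      show "Ck_on k W (\<lambda>x. ?f x v)" using Suc.prems by simp
      show "Ck_on k W (\<lambda>x. ?g (f x) b)" for b
        using Suc.prems(2) by (intro Suc.IH[OF Ck_on_Suc_imp[OF Suc.prems(1)]]) simp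
    qed
  qed
qed


lemma Cinf_on_cong:
  "Cinf_on W f \<Longrightarrow> open W \<Longrightarrow> (\<And>x. x \<in> W \<Longrightarrow> f x = g x) \<Longrightarrow> Cinf_on W g"
  unfolding Cinf_on_def by (intro allI, rule Ck_on_cong[of W f g]) auto

lemma Cinf_on_subset: "Cinf_on W f \<Longrightarrow> W' \<subseteq> W \<Longrightarrow> Cinf_on W' f"
  unfolding Cinf_on_def by (intro allI, rule Ck_on_subset[of _ W f W']) auto

lemma Cinf_on_local:
  "(\<And>x. x \<in> W \<Longrightarrow> \<exists>N. open N \<and> x \<in> N \<and> Cinf_on N f) \<Longrightarrow> Cinf_on W f"
  unfolding Cinf_on_def by (intro allI, rule Ck_on_local) meson

lemma Cinf_on_continuous: "Cinf_on W f \<Longrightarrow> continuous_on W f"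
  unfolding Cinf_on_def using Ck_on.simps(1)[of W f] by blast

lemma Cinf_on_has_derivative:
  "Cinf_on W f \<Longrightarrow> x \<in> W \<Longrightarrow> (f has_derivative frechet_derivative f (at x)) (at x)"
  unfolding Cinf_on_def by (rule Ck_on_differentiable[of 0]) auto

lemma Cinf_on_differentiable: "Cinf_on W f \<Longrightarrow> x \<in> W \<Longrightarrow> f differentiable (at x)"
  using Cinf_on_has_derivative differentiableI by blast

lemma Cinf_on_derivative: "Cinf_on W f \<Longrightarrow> Cinf_on W (\<lambda>x. frechet_derivative f (at x) v)"
  unfolding Cinf_on_def using Ck_on.simps(2)[of _ W f] by blast

lemma Cinf_on_const: "open W \<Longrightarrow> Cinf_on W (\<lambda>_. c)"
  and Cinf_on_ident: "open W \<Longrightarrow> Cinf_on W (\<lambda>x. x)"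
  unfolding Cinf_on_def by (simp_all add: Ck_on_const Ck_on_ident)

lemma Cinf_on_linear: "bounded_linear L \<Longrightarrow> open W \<Longrightarrow> Cinf_on W f \<Longrightarrow> Cinf_on W (\<lambda>x. L (f x))"
  unfolding Cinf_on_def by (simp add: Ck_on_linear)

lemma bounded_linear_imp_Cinf_on: "bounded_linear L \<Longrightarrow> open W \<Longrightarrow> Cinf_on W L"
  by (rule Cinf_on_linear[OF _ _ Cinf_on_ident])

lemma Cinf_on_add: "open W \<Longrightarrow> Cinf_on W f \<Longrightarrow> Cinf_on W g \<Longrightarrow> Cinf_on W (\<lambda>x. f x + g x)"
  unfolding Cinf_on_def by (simp add: Ck_on_add)

lemma Cinf_on_sum:
  "open W \<Longrightarrow> finite I \<Longrightarrow> (\<And>i. i \<in> I \<Longrightarrow> Cinf_on W (f i)) \<Longrightarrow> Cinf_on W (\<lambda>x. \<Sum>i\<in>I. f i x)"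
  unfolding Cinf_on_def by (simp add: Ck_on_sum)

lemma Cinf_on_minus: "open W \<Longrightarrow> Cinf_on W f \<Longrightarrow> Cinf_on W (\<lambda>x. - f x)"
  by (rule Cinf_on_linear[OF bounded_linear_minus[OF bounded_linear_ident]])

lemma Cinf_on_diff: "open W \<Longrightarrow> Cinf_on W f \<Longrightarrow> Cinf_on W g \<Longrightarrow> Cinf_on W (\<lambda>x. f x - g x)"
  using Cinf_on_add[OF _ _ Cinf_on_minus, of W f g] by simp

lemma Cinf_on_bilinear:
  "bounded_bilinear bop \<Longrightarrow> open W \<Longrightarrow> Cinf_on W f \<Longrightarrow> Cinf_on W g \<Longrightarrow>
    Cinf_on W (\<lambda>x. bop (f x) (g x))"
  unfolding Cinf_on_def by (simp add: Ck_on_bilinear)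

lemmas Cinf_on_scaleR = Cinf_on_bilinear[OF bounded_bilinear_scaleR]
  and Cinf_on_inner = Cinf_on_bilinear[OF bounded_bilinear_inner]
  and Cinf_on_mult = Cinf_on_bilinear[OF bounded_bilinear_mult[where 'a=real]]

lemma Cinf_on_compose:
  fixes f :: "'a::real_normed_vector \<Rightarrow> 'b::fin_dim_inner"
  shows "Cinf_on W f \<Longrightarrow> Cinf_on V g \<Longrightarrow> f ` W \<subseteq> V \<Longrightarrow> open W \<Longrightarrow> open V \<Longrightarrow>
    Cinf_on W (\<lambda>x. g (f x))"
  unfolding Cinf_on_def by (simp add: Ck_on_compose)

lemma Cinf_on_Pair:
  assumes "open W" "Cinf_on W f" "Cinf_on W g"
  shows "Cinf_on W (\<lambda>x. (f x, g x))"
proof -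
  have "bounded_linear (\<lambda>a. (a, 0))" "bounded_linear (\<lambda>a. (0, a))"
    by (intro bounded_linear_Pair bounded_linear_ident bounded_linear_zero)+
  then have "Cinf_on W (\<lambda>x. (f x, 0) + (0, g x))"
    by (intro Cinf_on_add[OF assms(1)] Cinf_on_linear[OF _ assms(1,2)] Cinf_on_linear[OF _ assms(1,3)])
  then show ?thesis by simp
qed

lemma bounded_linear_axis: "bounded_linear (axis i :: 'v::real_normed_vector \<Rightarrow> 'v^'p::finite)"
proof (rule bounded_linear_intro[where K=1])
  show "norm (axis i x :: 'v^'p) \<le> norm x * 1" for x
  proof -
    have "norm (axis i x :: 'v^'p) \<le> (\<Sum>j\<in>UNIV. norm ((axis i x :: 'v^'p) $ j))"
      unfolding norm_vec_def by (rule L2_set_le_sum) simp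
    also have "\<dots> = (\<Sum>j\<in>UNIV. if j = i then norm x else 0)"
      by (intro sum.cong) (auto simp: axis_def)
    finally show ?thesis by simp
  qed
qed (auto simp: axis_def vec_eq_iff)

lemma vec_lambda_eq_sum_axis: "(\<chi> \<alpha>. f \<alpha>) = (\<Sum>\<alpha>\<in>UNIV. axis \<alpha> (f \<alpha> :: 'v::real_normed_vector))"
  by (simp add: vec_eq_iff axis_def)

lemma Cinf_on_vec_lambda:
  assumes "open W" "\<And>\<alpha>. Cinf_on W (f \<alpha>)"
  shows "Cinf_on W (\<lambda>x. \<chi> \<alpha>::'p::finite. f \<alpha> x)"
  unfolding vec_lambda_eq_sum_axis
  by (intro Cinf_on_sum assms finite Cinf_on_linear[OF bounded_linear_axis])

text \<open>
  This map, the first prolongation of \<open>\<tau>\<close>, is how a change of coordinates \<open>\<tau>\<close> acts on jets.  It is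
  smooth because \<open>D\<tau>(a)(v)\<close> can be expanded in a fixed basis, with coefficients linear in \<open>v\<close>.
\<close>

lemma Cinf_on_prolongation:
  fixes \<tau> :: "'n::fin_dim_inner \<Rightarrow> 'k::fin_dim_inner"
  assumes "open W" "Cinf_on W \<tau>"
  shows "Cinf_on (W \<times> (UNIV :: ('n^'p::finite) set))
    (\<lambda>(a, X). (\<tau> a, \<chi> \<alpha>. frechet_derivative \<tau> (at a) (X $ \<alpha>)))"
proof -
  let ?W = "W \<times> (UNIV :: ('n^'p) set)"
  have op: "open ?W" using assms(1) by (intro open_Times) auto
  have fst: "Cinf_on ?W (\<lambda>z. g (fst z))" if "Cinf_on W g" for g :: "'n \<Rightarrow> 'k"
    by (rule Cinf_on_compose[OF bounded_linear_imp_Cinf_on[OF bounded_linear_fst op] that])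
      (use op assms(1) in auto)
  have coord: "Cinf_on ?W (\<lambda>z. snd z $ \<alpha> \<bullet> b)" for \<alpha> b
    by (intro bounded_linear_imp_Cinf_on[OF _ op]
        bounded_linear_compose[OF bounded_linear_inner_left[of b]]
        bounded_linear_compose[OF bounded_linear_vec_nth[of \<alpha>] bounded_linear_snd])
  have "Cinf_on ?W (\<lambda>z. (\<tau> (fst z),
      \<chi> \<alpha>. \<Sum>b\<in>onb. (snd z $ \<alpha> \<bullet> b) *\<^sub>R frechet_derivative \<tau> (at (fst z)) b))"
    by (rule Cinf_on_Pair[OF op fst[OF assms(2)]], rule Cinf_on_vec_lambda[OF op],
        rule Cinf_on_sum[OF op finite_onb],
        rule Cinf_on_scaleR[OF op coord fst[OF Cinf_on_derivative[OF assms(2)]]])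
  then show ?thesis
    by (rule Cinf_on_cong[OF _ op])
      (auto simp: vec_eq_iff linear_onb_expansion[OF has_derivative_linear[OF Cinf_on_has_derivative[OF assms(2)]], symmetric])
qed

lemma Cinf_on_exp: "Cinf_on UNIV (exp :: real \<Rightarrow> real)"
proof -
  have "Ck_on k UNIV (\<lambda>t::real. c * exp t)" for k c
  proof (induction k arbitrary: c)
    case 0
    show ?case by (simp add: continuous_intros)
  next
    case (Suc k)
    show ?case
    proof (rule Ck_on_SucI[OF open_UNIV])
      show "((\<lambda>t. c * exp t) has_derivative (\<lambda>v. (c * v) * exp t)) (at t)" for t :: real
        by (auto intro!: derivative_eq_intros simp: algebra_simps)
    qed (rule Suc)
  qed
  from this[of _ 1] show ?thesis by (simp add: Cinf_on_def)
qed

text \<open>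
  For \<open>n = 0\<close> the classical smooth function with all derivatives zero at the origin.  The powers of
  \<open>1/t\<close> make the family closed under differentiation up to linear combinations.
\<close>

definition flat :: "nat \<Rightarrow> real \<Rightarrow> real" where
  "flat n t = (if t > 0 then (1/t)^n * exp (- (1/t)) else 0)"

lemma flat_has_derivative:
  "(flat n has_real_derivative (flat (n+2) t - n * flat (n+1) t)) (at t)"
proof -
  consider "t > 0" | "t < 0" | "t = 0" by linarith
  then show ?thesis
  proof cases
    case 1
    have "((\<lambda>t. (1/t)^n * exp (- (1/t))) has_real_derivative
        (1/t)^(n+2) * exp (- (1/t)) - n * ((1/t)^(n+1) * exp (- (1/t)))) (at t)"
    proof -
      have ds: "((\<lambda>t. 1/t) has_real_derivative - ((1/t)^2)) (at t)"
        using 1 by (auto intro!: derivative_eq_intros simp: power2_eq_square)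
      have "real n * (- (r^2) * r^(n - Suc 0)) * e + e * - (- (r^2)) * r^n = r^(n+2) * e - n * (r^(n+1) * e)"
        for r e :: real
        by (cases n) (simp_all add: algebra_simps power2_eq_square)
      then show ?thesis
        by (rule DERIV_cong[OF DERIV_mult[OF DERIV_power[OF ds, of n] DERIV_fun_exp[OF DERIV_minus[OF ds]]]])
    qed
    then show ?thesis
      using has_field_derivative_transform_within_open[of _ _ t "{0<..}" "flat n"] 1
      by (auto simp: flat_def)
  next
    case 2
    have "(flat n has_real_derivative 0) (at t)"
      by (rule has_field_derivative_transform_within_open[where S="{..<0}", OF DERIV_const[of 0]])
        (use 2 in \<open>auto simp: flat_def\<close>)
    then show ?thesis using 2 by (simp add: flat_def)
  next
    case 3
    \<comment> \<open>the difference quotient is \<open>(1/h)\<^sup>n\<^sup>+\<^sup>1 / exp (1/h)\<close>, and the exponential dominates as \<open>1/h\<close> tends to infinity\<close>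
    have "((\<lambda>h. (1/h)^(n+1) / exp (1/h)) \<longlongrightarrow> 0) (at_right (0::real))"
      using filterlim_compose[OF tendsto_power_div_exp_0[of "n+1"] filterlim_inverse_at_top_right]
      by (simp add: inverse_eq_divide)
    then have "((\<lambda>h. flat n h / h) \<longlongrightarrow> 0) (at_right 0)"
      by (rule tendsto_cong[THEN iffD1, rotated])
        (auto simp: flat_def exp_minus field_simps eventually_at_right_less eventually_at_filter)
    moreover have "((\<lambda>h. flat n h / h) \<longlongrightarrow> 0) (at_left 0)"
      by (rule tendsto_cong[THEN iffD1, OF _ tendsto_const])
        (auto simp: flat_def eventually_at_filter)
    ultimately have "((\<lambda>h. flat n h / h) \<longlongrightarrow> 0) (at 0)"
      by (rule filterlim_split_at[rotated])
    then show ?thesis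
      unfolding 3 by (simp add: DERIV_def flat_def)
  qed
qed

lemma Cinf_on_flat: "Cinf_on UNIV (flat n)"
proof -
  have "Ck_on k UNIV (flat n)" for k
  proof (induction k arbitrary: n)
    case 0
    show ?case
      using DERIV_isCont[OF flat_has_derivative] by (auto intro: continuous_at_imp_continuous_on)
  next
    case (Suc k)
    show ?case
    proof (rule Ck_on_SucI[OF open_UNIV])
      show "(flat n has_derivative (\<lambda>v. (flat (n+2) t + (- real n) *\<^sub>R flat (n+1) t) * v)) (at t)" for t
        using flat_has_derivative[of n t] by (simp add: has_field_derivative_def)
      show "Ck_on k UNIV (\<lambda>t. (flat (n+2) t + (- real n) *\<^sub>R flat (n+1) t) * v)" for v
        by (intro Ck_on_linear[OF bounded_linear_mult_left] Ck_on_add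
            Ck_on_linear[OF bounded_linear_scaleR_right] Suc open_UNIV)
    qed
  qed
  then show ?thesis by (simp add: Cinf_on_def)
qed

section \<open>Charts of a manifold and smooth maps\<close>

text \<open>
  \<open>h\<close> is a smooth function of the coordinates \<open>x\<close> on \<open>S\<close>.  Stating this by a factorization avoids the
  inverse of \<open>x\<close>, whose values outside the image of a chart are arbitrary.
\<close>

definition smooth_in :: "'a set \<Rightarrow> ('a \<Rightarrow> 'n::fin_dim_inner) \<Rightarrow> ('a \<Rightarrow> 'k::fin_dim_inner) \<Rightarrow> bool" where
  "smooth_in S x h \<longleftrightarrow> (\<exists>\<tau>. Cinf_on (x ` S) \<tau> \<and> (\<forall>p\<in>S. h p = \<tau> (x p)))"

lemma smooth_in_iff:
  assumes "inj_on x U" "S \<subseteq> U" "open (x ` S)"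
  shows "Cinf_on (x ` S) (h \<circ> inv_into U x) \<longleftrightarrow> smooth_in S x h"
proof
  have inv: "inv_into U x (x p) = p" if "p \<in> S" for p
    using assms(1,2) that by (simp add: inv_into_f_f subset_iff)
  show "smooth_in S x h" if "Cinf_on (x ` S) (h \<circ> inv_into U x)"
    using that inv unfolding smooth_in_def by (intro exI[of _ "h \<circ> inv_into U x"]) simp
  show "Cinf_on (x ` S) (h \<circ> inv_into U x)" if sm: "smooth_in S x h"
  proof -
    obtain \<tau> where \<tau>: "Cinf_on (x ` S) \<tau>" "\<forall>p\<in>S. h p = \<tau> (x p)"
      using sm unfolding smooth_in_def by blast
    have "\<tau> a = (h \<circ> inv_into U x) a" if "a \<in> x ` S" for a
      using that \<tau>(2) inv by auto
    then show ?thesis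
      by (rule Cinf_on_cong[OF \<tau>(1) assms(3)])
  qed
qed

lemma smooth_in_subset: "smooth_in S x h \<Longrightarrow> S' \<subseteq> S \<Longrightarrow> smooth_in S' x h"
  unfolding smooth_in_def by (meson Cinf_on_subset image_mono subsetD)

lemma smooth_in_cong: "smooth_in S x h \<Longrightarrow> (\<And>p. p \<in> S \<Longrightarrow> h p = g p) \<Longrightarrow> smooth_in S x g"
  unfolding smooth_in_def by metis

lemma smooth_in_self: "open (x ` S) \<Longrightarrow> smooth_in S x x"
  unfolding smooth_in_def using Cinf_on_ident by blast

lemma smooth_in_compose:
  assumes "smooth_in S x g" "Cinf_on T \<tau>" "g ` S \<subseteq> T" "open (x ` S)" "open T"
  shows "smooth_in S x (\<lambda>p. \<tau> (g p))"
proof -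
  obtain \<sigma> where \<sigma>: "Cinf_on (x ` S) \<sigma>" "\<forall>p\<in>S. g p = \<sigma> (x p)"
    using assms(1) by (auto simp: smooth_in_def)
  then have "\<sigma> ` x ` S \<subseteq> T" using assms(3) by force
  from Cinf_on_compose[OF \<sigma>(1) assms(2) this assms(4,5)] \<sigma>(2) show ?thesis
    unfolding smooth_in_def by (metis (no_types, lifting))
qed

lemma smooth_in_linear:
  fixes L :: "'k::fin_dim_inner \<Rightarrow> 'l::fin_dim_inner"
  assumes "bounded_linear L" "smooth_in S x g" "open (x ` S)"
  shows "smooth_in S x (\<lambda>p. L (g p))"
  by (rule smooth_in_compose[OF assms(2) bounded_linear_imp_Cinf_on[OF assms(1) open_UNIV]])
    (use assms in auto)

lemma smooth_in_trans:
  assumes "smooth_in S x y" "smooth_in S y h" "open (x ` S)" "open (y ` S)"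
  shows "smooth_in S x h"
proof -
  obtain \<sigma> where \<sigma>: "Cinf_on (y ` S) \<sigma>" "\<forall>p\<in>S. h p = \<sigma> (y p)"
    using assms(2) by (auto simp: smooth_in_def)
  show ?thesis
    by (rule smooth_in_cong[OF smooth_in_compose[OF assms(1) \<sigma>(1) order_refl assms(3,4)]])
      (use \<sigma>(2) in auto)
qed

lemma smooth_in_local:
  assumes "inj_on x S" "\<And>p. p \<in> S \<Longrightarrow> \<exists>T\<subseteq>S. p \<in> T \<and> open (x ` T) \<and> smooth_in T x h"
  shows "smooth_in S x h"
proof -
  have "Cinf_on (x ` S) (h \<circ> inv_into S x)"
  proof (rule Cinf_on_local)
    fix a assume "a \<in> x ` S"
    then obtain p T where "p \<in> S" "a = x p" "T \<subseteq> S" "p \<in> T" "open (x ` T)" "smooth_in T x h"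
      using assms(2) by blast
    then show "\<exists>N. open N \<and> a \<in> N \<and> Cinf_on N (h \<circ> inv_into S x)"
      using smooth_in_iff[OF assms(1)] by blast
  qed
  moreover have "\<forall>p\<in>S. h p = (h \<circ> inv_into S x) (x p)"
    using assms(1) by simp
  ultimately show ?thesis unfolding smooth_in_def by blast
qed

lemma compatible_iff:
  "inj_on x U \<Longrightarrow> compatible (U, x) (V, y) \<longleftrightarrow> open (x ` (U \<inter> V)) \<and> smooth_in (U \<inter> V) x y"
  using smooth_in_iff[of x U "U \<inter> V" y] by (auto simp: compatible_def)

text \<open>
  Coordinates on an open subset of a manifold, with values in a space that may differ from the
  model space of the atlas: a bundle chart takes values in the product of two spaces which is not
  the model space of the total manifold.
\<close>

definition chart_of :: "('a, 'm::fin_dim_inner) atlas \<Rightarrow> 'a set \<Rightarrow> ('a \<Rightarrow> 'n::fin_dim_inner) \<Rightarrow> bool" where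
  "chart_of A U x \<longleftrightarrow> U \<subseteq> points A \<and> inj_on x U \<and> open (x ` U) \<and>
     (\<forall>c\<in>A. compatible c (U, x) \<and> compatible (U, x) c)"

lemma chart_of_inj: "chart_of A U x \<Longrightarrow> inj_on x U"
  and chart_of_points: "chart_of A U x \<Longrightarrow> U \<subseteq> points A"
  and chart_of_open_image: "chart_of A U x \<Longrightarrow> open (x ` U)"
  by (auto simp: chart_of_def)

lemma charts_eq: "smooth_atlas A \<Longrightarrow> charts A = {(U, x). chart_of A U x}"
proof -
  have "compatible (U, x) (U, x)" if "inj_on x U" "open (x ` U)" for U and x :: "'a \<Rightarrow> 'b"
    using that by (simp add: compatible_iff smooth_in_self)
  then show "smooth_atlas A \<Longrightarrow> charts A = {(U, x). chart_of A U x}"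
    unfolding charts_def chart_of_def smooth_atlas_def by auto
qed

lemma smooth_atlas_chart: "smooth_atlas A \<Longrightarrow> (U, x) \<in> A \<Longrightarrow> chart_of A U x"
  unfolding chart_of_def smooth_atlas_def points_def by auto

lemma chart_at:
  assumes "smooth_atlas A" "p \<in> points A"
  obtains U x where "(U, x) \<in> A" "chart_of A U x" "p \<in> U"
  using assms smooth_atlas_chart[OF assms(1)] unfolding points_def by blast

text \<open>
  A set that is open in one chart is the preimage of an open set under the transition map from the
  other, which is continuous.
\<close>

lemma compatible_open:
  fixes x :: "'a \<Rightarrow> 'm::fin_dim_inner" and y :: "'a \<Rightarrow> 'n::fin_dim_inner"
  assumes "inj_on x U" "inj_on y V" "compatible (V, y) (U, x)" "W \<subseteq> U" "open (x ` W)"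
  shows "open (y ` (W \<inter> V))"
proof -
  have *: "open (y ` (V \<inter> U))" "smooth_in (V \<inter> U) y x"
    using assms(3) compatible_iff[OF assms(2)] by auto
  then obtain \<tau> where \<tau>: "Cinf_on (y ` (V \<inter> U)) \<tau>" "\<forall>p\<in>V \<inter> U. x p = \<tau> (y p)"
    by (auto simp: smooth_in_def)
  have "y ` (W \<inter> V) = y ` (V \<inter> U) \<inter> \<tau> -` (x ` W)"
  proof (intro set_eqI iffI)
    fix b assume "b \<in> y ` (V \<inter> U) \<inter> \<tau> -` (x ` W)"
    then obtain p q where "p \<in> V" "p \<in> U" "b = y p" "\<tau> b = x q" "q \<in> W" by auto
    moreover from this have "p = q"
      using \<tau>(2) assms(1,4) by (metis IntI inj_onD subsetD)
    ultimately show "b \<in> y ` (W \<inter> V)" by blast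
  next
    fix b assume "b \<in> y ` (W \<inter> V)"
    then obtain p where "p \<in> W" "p \<in> V" "b = y p" by blast
    moreover from this have "\<tau> b = x p" "p \<in> U" using \<tau>(2) assms(4) by auto
    ultimately show "b \<in> y ` (V \<inter> U) \<inter> \<tau> -` (x ` W)" by auto
  qed
  then show ?thesis
    using continuous_open_preimage[OF Cinf_on_continuous[OF \<tau>(1)] *(1) assms(5)] by simp
qed

lemma openin_mtopology:
  assumes "smooth_atlas A"
  shows "openin (mtopology A) W \<longleftrightarrow> W \<subseteq> points A \<and> (\<forall>(U, x)\<in>A. open (x ` (W \<inter> U)))"
proof -
  have "istopology (\<lambda>W. W \<subseteq> points A \<and> (\<forall>(U, x)\<in>A. open (x ` (W \<inter> U))))"
    unfolding istopology_def
  proof (intro conjI allI impI, goal_cases)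
    case (2 S T)
    have "x ` (S \<inter> T \<inter> U) = x ` (S \<inter> U) \<inter> x ` (T \<inter> U)" if "(U, x) \<in> A" for U x
    proof -
      have "inj_on x U" using that assms by (auto simp: smooth_atlas_def)
      then have "x ` ((S \<inter> U) \<inter> (T \<inter> U)) = x ` (S \<inter> U) \<inter> x ` (T \<inter> U)"
        by (rule inj_on_image_Int) auto
      moreover have "S \<inter> U \<inter> (T \<inter> U) = S \<inter> T \<inter> U" by blast
      ultimately show ?thesis by simp
    qed
    with 2 show ?case by (auto intro!: open_Int)
  next
    case (4 K)
    have "x ` (\<Union> K \<inter> U) = (\<Union>S\<in>K. x ` (S \<inter> U))" for U and x :: "'a \<Rightarrow> 'b"
      by blast
    with 4 show ?case by (auto intro!: open_UN)
  qed auto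
  then show ?thesis unfolding mtopology_def by (simp add: topology_inverse')
qed

lemma topspace_mtopology: "smooth_atlas A \<Longrightarrow> topspace (mtopology A) = points A"
proof -
  assume A: "smooth_atlas A"
  have "points A \<inter> U = U" if "(U, x) \<in> A" for U x
    using that by (auto simp: points_def)
  then have "openin (mtopology A) (points A)"
    using A openin_mtopology[OF A] by (auto simp: smooth_atlas_def)
  then show ?thesis
    using openin_mtopology[OF A] openin_subset openin_topspace by (metis subset_antisym)
qed

lemma openin_iff_open_image:
  assumes "smooth_atlas A" "chart_of A U x" "W \<subseteq> U"
  shows "openin (mtopology A) W \<longleftrightarrow> open (x ` W)"
proof
  assume W: "openin (mtopology A) W"
  have "open (x ` (W \<inter> V \<inter> U))" if "(V, y) \<in> A" for V y
    by (rule compatible_open[of y V x U])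
      (use that W assms in \<open>auto simp: chart_of_def openin_mtopology smooth_atlas_def\<close>)
  moreover have "x ` W = (\<Union>(V, y)\<in>A. x ` (W \<inter> V \<inter> U))"
    using assms chart_of_points[OF assms(2)] by (fastforce simp: points_def)
  ultimately show "open (x ` W)"
    by (auto intro!: open_UN)
next
  assume W: "open (x ` W)"
  have "open (y ` (W \<inter> V))" if "(V, y) \<in> A" for V y
    by (rule compatible_open[of x U y V])
      (use that W assms in \<open>auto simp: chart_of_def openin_mtopology smooth_atlas_def\<close>)
  then show "openin (mtopology A) W"
    using assms chart_of_points[OF assms(2)] by (auto simp: openin_mtopology)
qed

lemma chart_of_openin: "smooth_atlas A \<Longrightarrow> chart_of A U x \<Longrightarrow> openin (mtopology A) U"
  using openin_iff_open_image chart_of_open_image by blast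

lemma chart_of_restrict:
  assumes "smooth_atlas A" "chart_of A U x" "W \<subseteq> U" "openin (mtopology A) W"
  shows "chart_of A W x"
proof -
  have inj: "inj_on x W" using chart_of_inj[OF assms(2)] assms(3) by (rule inj_on_subset)
  have "compatible (V, y) (W, x) \<and> compatible (W, x) (V, y)" if "(V, y) \<in> A" for V y
  proof -
    have y: "inj_on y V" and V: "chart_of A V y"
      using that assms(1) by (auto simp: smooth_atlas_def smooth_atlas_chart)
    have op: "openin (mtopology A) (V \<inter> W)"
      using chart_of_openin[OF assms(1) V] assms(4) by auto
    have "smooth_in (V \<inter> U) y x" "smooth_in (U \<inter> V) x y"
      using that assms(2) y chart_of_inj[OF assms(2)] by (auto simp: chart_of_def compatible_iff)
    then have "smooth_in (V \<inter> W) y x" "smooth_in (W \<inter> V) x y"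
      using assms(3) by (auto elim: smooth_in_subset)
    moreover have "open (y ` (V \<inter> W))" "open (x ` (W \<inter> V))"
      using openin_iff_open_image[OF assms(1) V, of "V \<inter> W"] assms(3) op
        openin_iff_open_image[OF assms(1,2), of "W \<inter> V"] by (auto simp: Int_commute)
    ultimately show ?thesis
      by (simp add: compatible_iff[OF y] compatible_iff[OF inj])
  qed
  then show ?thesis
    using assms openin_iff_open_image[OF assms(1,2,3)] inj chart_of_points[OF assms(2)]
    by (auto simp: chart_of_def)
qed

lemma chart_of_Int:
  assumes "smooth_atlas A" "chart_of A U x" "openin (mtopology A) W"
  shows "chart_of A (U \<inter> W) x"
  using chart_of_restrict[OF assms(1,2), of "U \<inter> W"] chart_of_openin[OF assms(1,2)] assms(3) by auto

text \<open>Near each point, the transition map passes through a chart of the atlas.\<close>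

lemma chart_of_transition:
  assumes A: "smooth_atlas A" and x: "chart_of A U x" and y: "chart_of A V y"
  shows "smooth_in (U \<inter> V) x y"
proof (rule smooth_in_local)
  show "inj_on x (U \<inter> V)" using chart_of_inj[OF x] by (rule inj_on_subset) simp
  fix p assume p: "p \<in> U \<inter> V"
  then obtain Z z where Z: "(Z, z) \<in> A" "chart_of A Z z" "p \<in> Z"
    using chart_at[OF A] chart_of_points[OF x] by (metis IntD1 subsetD)
  let ?T = "U \<inter> V \<inter> Z"
  have op: "openin (mtopology A) ?T"
    using chart_of_openin[OF A x] chart_of_openin[OF A y] chart_of_openin[OF A Z(2)] by auto
  have ox: "open (x ` ?T)" and oz: "open (z ` ?T)"
    using openin_iff_open_image[OF A x, of ?T] openin_iff_open_image[OF A Z(2), of ?T] op by auto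
  have "smooth_in (U \<inter> Z) x z" "smooth_in (Z \<inter> V) z y"
    using x y Z chart_of_inj by (auto simp: chart_of_def compatible_iff)
  then have "smooth_in ?T x z" "smooth_in ?T z y"
    by (auto elim: smooth_in_subset)
  from smooth_in_trans[OF this ox oz] ox p Z(3)
  show "\<exists>T\<subseteq>U \<inter> V. p \<in> T \<and> open (x ` T) \<and> smooth_in T x y"
    by (intro exI[of _ ?T]) auto
qed

lemma chart_of_compatible:
  assumes "smooth_atlas A" "chart_of A U x" "chart_of A V y"
  shows "compatible (U, x) (V, y)"
proof -
  have "openin (mtopology A) (U \<inter> V)"
    using chart_of_openin[OF assms(1,2)] chart_of_openin[OF assms(1,3)] by (rule openin_Int)
  then have "open (x ` (U \<inter> V))"
    using openin_iff_open_image[OF assms(1,2), of "U \<inter> V"] by simp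
  then show ?thesis
    using chart_of_transition[OF assms] by (simp add: compatible_iff[OF chart_of_inj[OF assms(2)]])
qed

lemma chart_of_linear:
  assumes "chart_of A U x" "bounded_linear L" "bounded_linear L'" "\<And>a. L' (L a) = a" "\<And>b. L (L' b) = b"
  shows "chart_of A U (\<lambda>p. L (x p))"
proof -
  have img: "(\<lambda>p. L (x p)) ` S = L' -` (x ` S)" for S
    using assms(4,5) by (auto simp: image_iff) metis
  have opn: "open ((\<lambda>p. L (x p)) ` S)" if "open (x ` S)" for S
    unfolding img using that continuous_on_open_vimage[of UNIV L']
      linear_continuous_on[OF assms(3)] by auto
  have inj: "inj_on (\<lambda>p. L (x p)) U"
    using chart_of_inj[OF assms(1)] by (auto simp: inj_on_def) (metis assms(4))
  have "compatible (V, y) (U, \<lambda>p. L (x p)) \<and> compatible (U, \<lambda>p. L (x p)) (V, y)"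
    if "(V, y) \<in> A" for V y
  proof
    have c: "compatible (V, y) (U, x)" "compatible (U, x) (V, y)"
      using that assms(1) by (auto simp: chart_of_def)
    then show "compatible (V, y) (U, \<lambda>p. L (x p))"
      using Cinf_on_linear[OF assms(2)] by (auto simp: compatible_def o_def)
    have *: "open (x ` (U \<inter> V))" "smooth_in (U \<inter> V) x y"
      using c(2) chart_of_inj[OF assms(1)] by (auto simp: compatible_iff)
    have "smooth_in (U \<inter> V) (\<lambda>p. L (x p)) (\<lambda>p. L' (L (x p)))"
      by (intro smooth_in_linear[OF assms(3)] smooth_in_self opn *)
    then have "smooth_in (U \<inter> V) (\<lambda>p. L (x p)) y"
      using smooth_in_trans[OF _ *(2) opn[OF *(1)] *(1)] assms(4) by simp
    then show "compatible (U, \<lambda>p. L (x p)) (V, y)"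
      using inj opn * by (auto simp: compatible_iff)
  qed
  then show ?thesis
    using assms(1) inj opn by (auto simp: chart_of_def)
qed

lemma chart_of_cong:
  assumes A: "smooth_atlas A" and "chart_of A U x" and eq: "\<And>p. p \<in> U \<Longrightarrow> x p = y p"
  shows "chart_of A U y"
proof -
  have img: "y ` S = x ` S" if "S \<subseteq> U" for S
    using that eq by (auto simp: image_iff subset_iff)
  have inj: "inj_on x U" by (rule chart_of_inj[OF assms(2)])
  then have inj': "inj_on y U" using inj_on_cong[of U x y] eq by simp
  have "compatible (V, z) (U, y) \<and> compatible (U, y) (V, z)" if "(V, z) \<in> A" for V z
  proof
    have c: "compatible (V, z) (U, x)" "compatible (U, x) (V, z)"
      using that assms(2) by (auto simp: chart_of_def)
    have z: "inj_on z V"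
      using that A by (auto simp: smooth_atlas_def)
    have "smooth_in (U \<inter> V) x z" "open (x ` (U \<inter> V))"
      using c(2) inj by (auto simp: compatible_iff)
    moreover from this have "smooth_in (U \<inter> V) y z"
      unfolding smooth_in_def img[OF Int_lower1] using eq by auto
    ultimately show "compatible (U, y) (V, z)"
      using inj' img[of "U \<inter> V"] by (simp add: compatible_iff)
    have o: "open (z ` (V \<inter> U))" and C: "Cinf_on (z ` (V \<inter> U)) (x \<circ> inv_into V z)"
      using c(1) by (auto simp: compatible_def)
    have "(x \<circ> inv_into V z) a = (y \<circ> inv_into V z) a" if a: "a \<in> z ` (V \<inter> U)" for a
    proof -
      obtain q where "q \<in> V" "q \<in> U" "a = z q" using a by blast
      then show ?thesis using z eq by simp
    qed
    then show "compatible (V, z) (U, y)"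
      using Cinf_on_cong[OF C o] o by (simp add: compatible_def)
  qed
  then show ?thesis
    using assms(2) inj' img[of U] by (auto simp: chart_of_def)
qed

lemma smooth_map_iff:
  assumes "smooth_atlas A" "smooth_atlas B"
  shows "smooth_map A B f \<longleftrightarrow> continuous_map (mtopology A) (mtopology B) f \<and>
    (\<forall>(U, x)\<in>A. \<forall>(V, y)\<in>B. smooth_in (U \<inter> f -` V) x (y \<circ> f))"
proof -
  have "Cinf_on (x ` (U \<inter> f -` V)) (y \<circ> f \<circ> inv_into U x) \<longleftrightarrow> smooth_in (U \<inter> f -` V) x (y \<circ> f)"
    if f: "continuous_map (mtopology A) (mtopology B) f" and x: "(U, x) \<in> A" and y: "(V, y) \<in> B" for U x V y
  proof (rule smooth_in_iff)
    have X: "chart_of A U x" and Y: "chart_of B V y"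
      using x y assms by (auto intro: smooth_atlas_chart)
    show "inj_on x U" using X by (rule chart_of_inj)
    have "openin (mtopology A) (U \<inter> {p \<in> topspace (mtopology A). f p \<in> V})"
      using chart_of_openin[OF assms(1) X] chart_of_openin[OF assms(2) Y]
      by (intro openin_Int openin_continuous_map_preimage[OF f]) auto
    moreover have "U \<inter> {p \<in> topspace (mtopology A). f p \<in> V} = U \<inter> f -` V"
      using chart_of_points[OF X] by (auto simp: topspace_mtopology[OF assms(1)])
    ultimately show "open (x ` (U \<inter> f -` V))"
      using openin_iff_open_image[OF assms(1) X, of "U \<inter> f -` V"] by auto
  qed auto
  then show ?thesis
    unfolding smooth_map_def
    by (intro conj_cong refl ball_cong) (clarsimp, blast)
qed

lemma smooth_map_openin:
  assumes "smooth_atlas A" "smooth_map A B f" "openin (mtopology A) U" "openin (mtopology B) V"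
  shows "openin (mtopology A) (U \<inter> f -` V)"
proof -
  have "openin (mtopology A) (U \<inter> {p \<in> topspace (mtopology A). f p \<in> V})"
    using assms by (intro openin_Int openin_continuous_map_preimage) (auto simp: smooth_map_def)
  moreover have "U \<inter> {p \<in> topspace (mtopology A). f p \<in> V} = U \<inter> f -` V"
    using openin_subset[OF assms(3)] by auto
  ultimately show ?thesis by simp
qed

lemma smooth_map_points:
  assumes "smooth_atlas A" "smooth_atlas B" "smooth_map A B f" "p \<in> points A"
  shows "f p \<in> points B"
  using assms continuous_map_image_subset_topspace[of "mtopology A" "mtopology B" f]
  by (auto simp: smooth_map_def topspace_mtopology)

lemma smooth_map_in_charts:
  assumes A: "smooth_atlas A" and B: "smooth_atlas B" and f: "smooth_map A B f"
    and x: "chart_of A U x" and y: "chart_of B V y"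
  shows "smooth_in (U \<inter> f -` V) x (y \<circ> f)"
proof (rule smooth_in_local)
  show "inj_on x (U \<inter> f -` V)" using chart_of_inj[OF x] by (rule inj_on_subset) simp
  fix p assume p: "p \<in> U \<inter> f -` V"
  then obtain Z z where Z: "(Z, z) \<in> A" "chart_of A Z z" "p \<in> Z"
    using chart_at[OF A] chart_of_points[OF x] by (metis IntD1 subsetD)
  obtain Y w where Y: "(Y, w) \<in> B" "chart_of B Y w" "f p \<in> Y"
    using p chart_at[OF B] chart_of_points[OF y] by (metis IntD2 vimageD subsetD)
  let ?T = "U \<inter> Z \<inter> f -` (V \<inter> Y)"
  have op: "openin (mtopology A) ?T"
    using chart_of_openin[OF A x] chart_of_openin[OF A Z(2)] chart_of_openin[OF B y] chart_of_openin[OF B Y(2)]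
    by (intro smooth_map_openin[OF A f] openin_Int) auto
  have ox: "open (x ` ?T)" and oz: "open (z ` ?T)"
    using openin_iff_open_image[OF A x, of ?T] openin_iff_open_image[OF A Z(2), of ?T] op by auto
  have "smooth_in ?T x z"
    using chart_of_transition[OF A x Z(2)] by (rule smooth_in_subset) auto
  moreover have "smooth_in (Z \<inter> f -` Y) z (w \<circ> f)"
    using f Z(1) Y(1) by (auto simp: smooth_map_iff[OF A B])
  then have "smooth_in ?T z (w \<circ> f)"
    by (rule smooth_in_subset) auto
  ultimately have sw: "smooth_in ?T x (w \<circ> f)"
    using smooth_in_trans ox oz by blast
  obtain \<tau> where \<tau>: "Cinf_on (w ` (Y \<inter> V)) \<tau>" "\<forall>q\<in>Y \<inter> V. y q = \<tau> (w q)"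
    using chart_of_transition[OF B Y(2) y] by (auto simp: smooth_in_def)
  have ow: "open (w ` (Y \<inter> V))"
    using chart_of_open_image[OF chart_of_Int[OF B Y(2) chart_of_openin[OF B y]]] .
  have "smooth_in ?T x (\<lambda>p. \<tau> ((w \<circ> f) p))"
    by (rule smooth_in_compose[OF sw \<tau>(1) _ ox ow]) auto
  then have "smooth_in ?T x (y \<circ> f)"
    by (rule smooth_in_cong) (use \<tau>(2) in auto)
  then show "\<exists>T\<subseteq>U \<inter> f -` V. p \<in> T \<and> open (x ` T) \<and> smooth_in T x (y \<circ> f)"
    using ox p Z(3) Y(3) by (intro exI[of _ ?T]) auto
qed

lemma smooth_map_openin_image:
  assumes "smooth_atlas A" "smooth_atlas B" "smooth_map A B f" "chart_of A U x" "chart_of B V y"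
  shows "open (x ` (U \<inter> f -` V))"
  using openin_iff_open_image[OF assms(1,4), of "U \<inter> f -` V"]
    smooth_map_openin[OF assms(1,3) chart_of_openin[OF assms(1,4)] chart_of_openin[OF assms(2,5)]] by auto

text \<open>
  Smoothness may be tested near each point in any coordinates, also in spaces other than the model
  spaces.  Continuity comes for free, because it can be read off the coordinate expression.
\<close>

lemma smooth_mapI:
  fixes A :: "('a, 'm::fin_dim_inner) atlas" and B :: "('b, 'n::fin_dim_inner) atlas"
  assumes A: "smooth_atlas A" and B: "smooth_atlas B"
    and loc: "\<And>p. p \<in> points A \<Longrightarrow> \<exists>U (x::'a \<Rightarrow> 'k::fin_dim_inner) V (y::'b \<Rightarrow> 'l::fin_dim_inner).
      p \<in> U \<and> chart_of A U x \<and> chart_of B V y \<and> f ` U \<subseteq> V \<and> smooth_in U x (y \<circ> f)"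
  shows "smooth_map A B f"
proof -
  have cont: "continuous_map (mtopology A) (mtopology B) f"
    unfolding continuous_map_def topspace_mtopology[OF A] topspace_mtopology[OF B]
  proof (intro conjI allI impI)
    show "f \<in> points A \<rightarrow> points B"
    proof
      fix p assume "p \<in> points A"
      then obtain U V and x :: "'a \<Rightarrow> 'k" and y :: "'b \<Rightarrow> 'l"
        where "p \<in> U" "chart_of B V y" "f ` U \<subseteq> V" using loc by metis
      then show "f p \<in> points B" using chart_of_points[of B V y] by auto
    qed
    fix W assume W: "openin (mtopology B) W"
    show "openin (mtopology A) {p \<in> points A. f p \<in> W}"
    proof (subst openin_subopen, intro ballI)
      fix p assume p: "p \<in> {p \<in> points A. f p \<in> W}"
      then obtain U V and x :: "'a \<Rightarrow> 'k" and y :: "'b \<Rightarrow> 'l"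
        where *: "p \<in> U" "chart_of A U x" "chart_of B V y" "f ` U \<subseteq> V" "smooth_in U x (y \<circ> f)"
        using loc[of p] by blast
      obtain \<tau> where \<tau>: "Cinf_on (x ` U) \<tau>" "\<forall>p\<in>U. (y \<circ> f) p = \<tau> (x p)"
        using *(5) by (auto simp: smooth_in_def)
      let ?T = "{q \<in> U. f q \<in> W}"
      have "x ` ?T = x ` U \<inter> \<tau> -` (y ` (V \<inter> W))"
      proof (intro set_eqI iffI)
        fix a assume "a \<in> x ` U \<inter> \<tau> -` (y ` (V \<inter> W))"
        then obtain q r where q: "q \<in> U" "a = x q" "\<tau> a = y r" "r \<in> V" "r \<in> W" by auto
        then have "y (f q) = y r" using \<tau>(2) by auto
        then have "f q = r"
          using q *(4) chart_of_inj[OF *(3)] by (metis image_subset_iff inj_onD)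
        with q show "a \<in> x ` ?T" by blast
      next
        fix a assume "a \<in> x ` ?T"
        then obtain q where q: "q \<in> U" "f q \<in> W" "a = x q" by blast
        then have "\<tau> a = y (f q)" "f q \<in> V \<inter> W"
          using \<tau>(2) *(4) by auto
        then show "a \<in> x ` U \<inter> \<tau> -` (y ` (V \<inter> W))"
          using q by auto
      qed
      moreover have "open (y ` (V \<inter> W))"
        using chart_of_open_image[OF chart_of_Int[OF B *(3) W]] .
      ultimately have "open (x ` ?T)"
        using continuous_open_preimage[OF Cinf_on_continuous[OF \<tau>(1)] chart_of_open_image[OF *(2)]]
        by simp
      then have "openin (mtopology A) ?T"
        using openin_iff_open_image[OF A *(2), of ?T] by auto
      then show "\<exists>T. openin (mtopology A) T \<and> p \<in> T \<and> T \<subseteq> {p \<in> points A. f p \<in> W}"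
        using p *(1) chart_of_points[OF *(2)] by (intro exI[of _ ?T]) auto
    qed
  qed
  have "smooth_in (U \<inter> f -` V) x (y \<circ> f)" if "(U, x) \<in> A" "(V, y) \<in> B" for U x V y
  proof (rule smooth_in_local)
    have X: "chart_of A U x" and Y: "chart_of B V y"
      using that A B by (auto intro: smooth_atlas_chart)
    show "inj_on x (U \<inter> f -` V)" using chart_of_inj[OF X] by (rule inj_on_subset) simp
    fix p assume p: "p \<in> U \<inter> f -` V"
    then obtain U' V' and x' :: "'a \<Rightarrow> 'k" and y' :: "'b \<Rightarrow> 'l"
      where *: "p \<in> U'" "chart_of A U' x'" "chart_of B V' y'" "f ` U' \<subseteq> V'" "smooth_in U' x' (y' \<circ> f)"
      using loc[of p] chart_of_points[OF X] by blast
    let ?T = "U \<inter> U' \<inter> f -` V"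
    have "openin (mtopology A) (U \<inter> U' \<inter> {p \<in> topspace (mtopology A). f p \<in> V})"
      using chart_of_openin[OF A X] chart_of_openin[OF A *(2)] chart_of_openin[OF B Y]
      by (intro openin_Int openin_continuous_map_preimage[OF cont]) auto
    moreover have "U \<inter> U' \<inter> {p \<in> topspace (mtopology A). f p \<in> V} = ?T"
      using chart_of_points[OF X] by (auto simp: topspace_mtopology[OF A])
    ultimately have op: "openin (mtopology A) ?T" by simp
    have ox: "open (x ` ?T)" and ox': "open (x' ` ?T)"
      using openin_iff_open_image[OF A X, of ?T] openin_iff_open_image[OF A *(2), of ?T] op by auto
    have "smooth_in ?T x x'"
      using chart_of_transition[OF A X *(2)] by (rule smooth_in_subset) auto
    moreover have "smooth_in ?T x' (y' \<circ> f)"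
      using *(5) by (rule smooth_in_subset) auto
    ultimately have sy: "smooth_in ?T x (y' \<circ> f)"
      using smooth_in_trans ox ox' by blast
    obtain \<tau> where \<tau>: "Cinf_on (y' ` (V' \<inter> V)) \<tau>" "\<forall>q\<in>V' \<inter> V. y q = \<tau> (y' q)"
      using chart_of_transition[OF B *(3) Y] by (auto simp: smooth_in_def)
    have oy: "open (y' ` (V' \<inter> V))"
      using chart_of_open_image[OF chart_of_Int[OF B *(3) chart_of_openin[OF B Y]]] .
    have "smooth_in ?T x (\<lambda>p. \<tau> ((y' \<circ> f) p))"
      by (rule smooth_in_compose[OF sy \<tau>(1) _ ox oy]) (use *(4) in auto)
    then have "smooth_in ?T x (y \<circ> f)"
      by (rule smooth_in_cong) (use \<tau>(2) *(4) in auto)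
    then show "\<exists>T\<subseteq>U \<inter> f -` V. p \<in> T \<and> open (x ` T) \<and> smooth_in T x (y \<circ> f)"
      using ox p *(1) by (intro exI[of _ ?T]) auto
  qed
  then show ?thesis
    using cont by (auto simp: smooth_map_iff[OF A B])
qed

lemma smooth_map_compose:
  fixes A :: "('a, 'm::fin_dim_inner) atlas" and B :: "('b, 'n::fin_dim_inner) atlas"
    and C :: "('c, 'k::fin_dim_inner) atlas"
  assumes A: "smooth_atlas A" and B: "smooth_atlas B" and C: "smooth_atlas C"
    and f: "smooth_map A B f" and g: "smooth_map B C g"
  shows "smooth_map A C (g \<circ> f)"
proof (rule smooth_mapI[OF A C])
  fix p assume p: "p \<in> points A"
  then have fp: "f p \<in> points B" by (rule smooth_map_points[OF A B f])
  obtain Z z where Z: "(Z, z) \<in> C" "chart_of C Z z" "g (f p) \<in> Z"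
    by (rule chart_at[OF C smooth_map_points[OF B C g fp]])
  note Z = Z(2,3)
  obtain V y where V: "(V, y) \<in> B" "chart_of B V y" "f p \<in> V"
    by (rule chart_at[OF B fp])
  note V = V(2,3)
  obtain U x where U: "(U, x) \<in> A" "chart_of A U x" "p \<in> U"
    by (rule chart_at[OF A p])
  note U = U(2,3)
  let ?V = "V \<inter> g -` Z"
  have opV: "openin (mtopology B) ?V"
    by (rule smooth_map_openin[OF B g chart_of_openin[OF B V(1)] chart_of_openin[OF C Z(1)]])
  have V': "chart_of B ?V y"
    by (rule chart_of_restrict[OF B V(1) _ opV]) simp
  let ?U = "U \<inter> f -` ?V"
  have opU: "openin (mtopology A) ?U"
    by (rule smooth_map_openin[OF A f chart_of_openin[OF A U(1)] opV])
  have U': "chart_of A ?U x"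
    by (rule chart_of_restrict[OF A U(1) _ opU]) simp
  obtain \<tau> where \<tau>: "Cinf_on (y ` ?V) \<tau>" "\<forall>q\<in>?V. (z \<circ> g) q = \<tau> (y q)"
    using smooth_map_in_charts[OF B C g V(1) Z(1)] by (auto simp: smooth_in_def)
  have "smooth_in ?U x (y \<circ> f)"
    by (rule smooth_map_in_charts[OF A B f U(1) V'])
  then have "smooth_in ?U x (\<lambda>p. \<tau> ((y \<circ> f) p))"
    by (rule smooth_in_compose[OF _ \<tau>(1)])
      (use chart_of_open_image[OF U'] chart_of_open_image[OF V'] in auto)
  then have "smooth_in ?U x (z \<circ> (g \<circ> f))"
    by (rule smooth_in_cong) (use \<tau>(2) in auto)
  then show "\<exists>U (x::'a \<Rightarrow> 'm) V (y::'c \<Rightarrow> 'k). p \<in> U \<and> chart_of A U x \<and> chart_of C V y \<and> (g \<circ> f) ` U \<subseteq> V \<and>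
      smooth_in U x (y \<circ> (g \<circ> f))"
    using U' U(2) V(2) Z by (intro exI[of _ ?U] exI[of _ x] exI[of _ Z] exI[of _ z] conjI) auto
qed

lemma smooth_atlasI:
  assumes "\<And>U x. (U, x) \<in> A \<Longrightarrow> inj_on x U \<and> open (x ` U)"
    and "\<And>U x V y. (U, x) \<in> A \<Longrightarrow> (V, y) \<in> A \<Longrightarrow> open (x ` (U \<inter> V)) \<and> smooth_in (U \<inter> V) x y"
  shows "smooth_atlas A"
  unfolding smooth_atlas_def
proof (intro conjI ballI)
  fix c d assume "c \<in> A" "d \<in> A"
  then show "compatible c d"
    using assms(1)[of "fst c" "snd c"] assms(2)[of "fst c" "snd c" "fst d" "snd d"]
      compatible_iff[of "snd c" "fst c" "fst d" "snd d"] by simp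
qed (use assms(1) in auto)

lemma smooth_atlas_std: "smooth_atlas (std_manifold :: ('m::fin_dim_inner, 'm) atlas)"
  by (rule smooth_atlasI) (auto simp: std_manifold_def intro: smooth_in_self)

lemma points_std: "points std_manifold = UNIV"
  by (auto simp: points_def std_manifold_def)

lemma chart_of_std: "chart_of (std_manifold :: ('m::fin_dim_inner, 'm) atlas) UNIV (\<lambda>x. x)"
  by (rule smooth_atlas_chart[OF smooth_atlas_std]) (simp add: std_manifold_def)

lemma smooth_map_to_stdI:
  fixes A :: "('a, 'm::fin_dim_inner) atlas" and f :: "'a \<Rightarrow> 'k::fin_dim_inner"
  assumes A: "smooth_atlas A"
    and "\<And>p. p \<in> points A \<Longrightarrow> \<exists>U (x::'a \<Rightarrow> 'l::fin_dim_inner). p \<in> U \<and> chart_of A U x \<and> smooth_in U x f"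
  shows "smooth_map A std_manifold f"
proof (rule smooth_mapI[OF A smooth_atlas_std])
  fix p assume "p \<in> points A"
  then obtain U and x :: "'a \<Rightarrow> 'l" where "p \<in> U" "chart_of A U x" "smooth_in U x f"
    using assms(2) by blast
  then show "\<exists>U (x::'a \<Rightarrow> 'l) V (y::'k \<Rightarrow> 'k). p \<in> U \<and> chart_of A U x \<and> chart_of std_manifold V y \<and> f ` U \<subseteq> V \<and>
      smooth_in U x (y \<circ> f)"
    using chart_of_std by (intro exI[of _ U] exI[of _ x] exI[of _ UNIV] exI[of _ "\<lambda>x. x"]) (simp add: o_def)
qed

lemma points_eq_Union: "points A = \<Union> (fst ` A)"
  by (auto simp: points_def)

section \<open>Separation and countability\<close>

text \<open>
  Points in the domain of one chart are separated in its image, so only the other pairs need an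
  argument.
\<close>

lemma Hausdorff_mtopologyI:
  fixes A :: "('a, 'm::fin_dim_inner) atlas"
  assumes A: "smooth_atlas A"
    and sep: "\<And>p q. p \<in> points A \<Longrightarrow> q \<in> points A \<Longrightarrow> p \<noteq> q \<Longrightarrow>
      (\<exists>U V. openin (mtopology A) U \<and> openin (mtopology A) V \<and> p \<in> U \<and> q \<in> V \<and> disjnt U V) \<or>
      (\<exists>U (x::'a \<Rightarrow> 'n::fin_dim_inner). chart_of A U x \<and> p \<in> U \<and> q \<in> U)"
  shows "Hausdorff_space (mtopology A)"
  unfolding Hausdorff_space_def topspace_mtopology[OF A]
proof (intro allI impI)
  fix p q assume pq: "p \<in> points A \<and> q \<in> points A \<and> p \<noteq> q"
  show "\<exists>U V. openin (mtopology A) U \<and> openin (mtopology A) V \<and> p \<in> U \<and> q \<in> V \<and> disjnt U V"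
  proof (cases "\<exists>U (x::'a \<Rightarrow> 'n). chart_of A U x \<and> p \<in> U \<and> q \<in> U")
    case True
    then obtain U and x :: "'a \<Rightarrow> 'n" where U: "chart_of A U x" "p \<in> U" "q \<in> U" by blast
    then have "x p \<noteq> x q"
      using pq chart_of_inj[OF U(1)] by (auto dest: inj_onD)
    then obtain S T where ST: "open S" "open T" "x p \<in> S" "x q \<in> T" "S \<inter> T = {}"
      using hausdorff[of "x p" "x q"] by metis
    have "openin (mtopology A) (U \<inter> x -` S)" if "open S" for S
    proof -
      have "x ` (U \<inter> x -` S) = x ` U \<inter> S" by auto
      then show ?thesis
        using openin_iff_open_image[OF A U(1), of "U \<inter> x -` S"] chart_of_open_image[OF U(1)] that
        by (simp add: open_Int)
    qed
    then show ?thesis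
      using ST U by (intro exI[of _ "U \<inter> x -` S"] exI[of _ "U \<inter> x -` T"]) (auto simp: disjnt_def)
  next
    case False
    then show ?thesis using sep[of p q] pq by blast
  qed
qed

lemma second_countable_mtopologyI:
  fixes C :: "('a, 'n::fin_dim_inner) atlas"
  assumes A: "smooth_atlas A" and C: "countable C" "\<And>U x. (U, x) \<in> C \<Longrightarrow> chart_of A U x"
    and cover: "points A \<subseteq> points C"
  shows "second_countable (mtopology A)"
proof -
  obtain \<B> :: "'n set set" where \<B>: "countable \<B>" "\<forall>B\<in>\<B>. open B"
      "\<And>S a. open S \<Longrightarrow> a \<in> S \<Longrightarrow> \<exists>B\<in>\<B>. a \<in> B \<and> B \<subseteq> S"
    using second_countable_fin_dim by metis
  define \<D> where "\<D> = (\<lambda>((U, x), S). U \<inter> x -` S) ` (C \<times> \<B>)"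
  have "countable \<D>"
    unfolding \<D>_def using C(1) \<B>(1) by auto
  moreover have "openin (mtopology A) W" if WD: "W \<in> \<D>" for W
  proof -
    obtain U x S where W: "W = U \<inter> x -` S" "(U, x) \<in> C" "S \<in> \<B>"
      using WD unfolding \<D>_def by auto
    have x: "chart_of A U x" using C(2) W(2) .
    have "x ` (U \<inter> x -` S) = x ` U \<inter> S" by auto
    then show ?thesis
      using openin_iff_open_image[OF A x, of W] chart_of_open_image[OF x] \<B>(2) W
      by (simp add: open_Int)
  qed
  moreover have "\<exists>V\<in>\<D>. p \<in> V \<and> V \<subseteq> W" if W: "openin (mtopology A) W" "p \<in> W" for W p
  proof -
    have "p \<in> points A"
      using W openin_subset topspace_mtopology[OF A] by blast
    then obtain U x where U: "(U, x) \<in> C" "p \<in> U"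
      using cover by (auto simp: points_def)
    then have x: "chart_of A U x" using C(2) by blast
    obtain S where S: "S \<in> \<B>" "x p \<in> S" "S \<subseteq> x ` (U \<inter> W)"
      using \<B>(3)[OF chart_of_open_image[OF chart_of_Int[OF A x W(1)]], of "x p"] U W by blast
    have "U \<inter> x -` S \<subseteq> W"
    proof
      fix q assume q: "q \<in> U \<inter> x -` S"
      then obtain r where r: "r \<in> U" "r \<in> W" "x q = x r" using S(3) by auto
      then have "q = r" using chart_of_inj[OF x] q by (auto dest: inj_onD)
      with r show "q \<in> W" by simp
    qed
    moreover have "U \<inter> x -` S \<in> \<D>"
      using U S(1) unfolding \<D>_def by force
    ultimately show ?thesis using U S(2) by (intro bexI[of _ "U \<inter> x -` S"]) auto
  qed
  ultimately show ?thesis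
    unfolding second_countable_def by (intro exI[of _ \<D>]) auto
qed

text \<open>
  A second countable space is Lindeloef.
\<close>

lemma countable_subatlas:
  fixes C :: "('a, 'n::fin_dim_inner) atlas"
  assumes A: "smooth_atlas A" "second_countable (mtopology A)"
    and C: "\<And>U x. (U, x) \<in> C \<Longrightarrow> chart_of A U x" "points C = points A"
  obtains D where "D \<subseteq> C" "countable D" "points D = points A"
proof -
  have "Lindelof_space (mtopology A)"
    using A(2) by (rule second_countable_imp_Lindelof_space)
  moreover have "openin (mtopology A) U" if "U \<in> fst ` C" for U
    using that chart_of_openin[OF A(1) C(1)] by auto
  moreover have "\<Union> (fst ` C) = topspace (mtopology A)"
    using C(2) by (simp add: topspace_mtopology[OF A(1)] points_eq_Union)
  ultimately obtain \<V> where \<V>: "countable \<V>" "\<V> \<subseteq> fst ` C" "\<Union> \<V> = points A"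
    unfolding Lindelof_space_def topspace_mtopology[OF A(1)] by metis
  then obtain D where "countable D" "D \<subseteq> C" "\<V> = fst ` D"
    unfolding countable_subset_image[symmetric] by (metis countable_subset_image)
  then show ?thesis
    using that[of D] \<V>(3) by (simp add: points_eq_Union)
qed

section \<open>Change of atlas, submanifolds and products\<close>

text \<open>
  This is the sense in which families of charts belong to the same atlas: a covering family of charts
  of \<open>A\<close> defines the same topology, and all coordinates on \<open>A\<close> are compatible with it.
\<close>

lemma atlas_of_charts:
  fixes A :: "('a, 'm::fin_dim_inner) atlas" and C :: "('a, 'n::fin_dim_inner) atlas"
  assumes A: "smooth_atlas A" and C: "\<And>U x. (U, x) \<in> C \<Longrightarrow> chart_of A U x" "points C = points A"
  shows "smooth_atlas C" "mtopology C = mtopology A"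
    and "chart_of A V (y :: 'a \<Rightarrow> 'l::fin_dim_inner) \<Longrightarrow> chart_of C V y"
proof -
  show sC: "smooth_atlas C"
    unfolding smooth_atlas_def
  proof (intro conjI ballI)
    fix c d assume "c \<in> C" "d \<in> C"
    then show "compatible c d"
      using chart_of_compatible[OF A, of "fst c" "snd c" "fst d" "snd d"] C(1) by simp
  qed (use C(1) in \<open>auto simp: chart_of_def\<close>)
  show "mtopology C = mtopology A"
    unfolding topology_eq
  proof (intro allI iffI)
    fix W assume W: "openin (mtopology C) W"
    have "openin (mtopology A) (W \<inter> U)" if "(U, x) \<in> C" for U x
      using openin_iff_open_image[OF A C(1)[OF that], of "W \<inter> U"] W that
      by (auto simp: openin_mtopology[OF sC])
    moreover have "W = (\<Union>(U, x)\<in>C. W \<inter> U)"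
      using W by (auto simp: openin_mtopology[OF sC] points_def)
    moreover have "openin (mtopology A) (\<Union>(U, x)\<in>C. W \<inter> U)"
      by (intro openin_Union) (use calculation(1) in auto)
    ultimately show "openin (mtopology A) W" by simp
  next
    fix W assume W: "openin (mtopology A) W"
    have "open (x ` (W \<inter> U))" if "(U, x) \<in> C" for U x
      using chart_of_open_image[OF chart_of_Int[OF A C(1)[OF that] W]] by (simp add: Int_commute)
    moreover have "W \<subseteq> points C"
      using W openin_subset topspace_mtopology[OF A] C(2) by blast
    ultimately show "openin (mtopology C) W"
      by (auto simp: openin_mtopology[OF sC])
  qed
  show "chart_of C V y" if y: "chart_of A V y"
  proof -
    have "compatible (U, x) (V, y) \<and> compatible (V, y) (U, x)" if "(U, x) \<in> C" for U x
      using chart_of_compatible[OF A C(1)[OF that] y] chart_of_compatible[OF A y C(1)[OF that]] by simp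
    then show ?thesis
      using y C(2) by (auto simp: chart_of_def)
  qed
qed

lemma manifold_of_charts:
  assumes "smooth_manifold A" "\<And>U x. (U, x) \<in> C \<Longrightarrow> chart_of A U x" "points C = points A"
  shows "smooth_manifold C"
  using assms(1) atlas_of_charts(1,2)[OF _ assms(2,3)] by (simp add: smooth_manifold_def)

lemma smooth_map_id:
  fixes A :: "('a, 'm::fin_dim_inner) atlas" and C :: "('a, 'n::fin_dim_inner) atlas"
  assumes A: "smooth_atlas A" and C: "smooth_atlas C" "\<And>U x. (U, x) \<in> C \<Longrightarrow> chart_of A U x"
      "points C = points A" and f: "\<And>p. p \<in> points A \<Longrightarrow> f p = p"
  shows "smooth_map A C f" "smooth_map C A f"
proof -
  have "\<exists>U (x::'a \<Rightarrow> 'n). p \<in> U \<and> chart_of A U x \<and> chart_of C U x \<and> f ` U \<subseteq> U \<and> smooth_in U x (x \<circ> f)"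
    if p: "p \<in> points A" for p
  proof -
    obtain U x where U: "(U, x) \<in> C" "chart_of C U x" "p \<in> U"
      using chart_at[OF C(1)] p C(3) by metis
    then have x: "chart_of A U x" using C(2) by blast
    have fU: "f q = q" if "q \<in> U" for q using f chart_of_points[OF x] that by blast
    have "smooth_in U x (x \<circ> f)"
      using smooth_in_cong[OF smooth_in_self[OF chart_of_open_image[OF x]], of "x \<circ> f"] fU by simp
    then show ?thesis using U x fU by (intro exI[of _ U] exI[of _ x]) auto
  qed
  note * = this
  show "smooth_map A C f"
  proof (rule smooth_mapI[OF A C(1)])
    fix p assume "p \<in> points A"
    from *[OF this] show "\<exists>U (x::'a \<Rightarrow> 'n) V (y::'a \<Rightarrow> 'n).
        p \<in> U \<and> chart_of A U x \<and> chart_of C V y \<and> f ` U \<subseteq> V \<and> smooth_in U x (y \<circ> f)"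
      by metis
  qed
  show "smooth_map C A f"
  proof (rule smooth_mapI[OF C(1) A])
    fix p assume "p \<in> points C"
    then have "p \<in> points A" using C(3) by simp
    from *[OF this] show "\<exists>U (x::'a \<Rightarrow> 'n) V (y::'a \<Rightarrow> 'n).
        p \<in> U \<and> chart_of C U x \<and> chart_of A V y \<and> f ` U \<subseteq> V \<and> smooth_in U x (y \<circ> f)"
      by metis
  qed
qed

lemma diffeomorphism_id:
  assumes A: "smooth_atlas A" and C: "smooth_atlas C" "\<And>U x. (U, x) \<in> C \<Longrightarrow> chart_of A U x"
      "points C = points A"
  shows "diffeomorphism A C id" "diffeomorphism C A id"
proof -
  have inv: "inv_into (points A) id p = p" if "p \<in> points A" for p
    using inv_into_f_f[of id "points A" p] that by simp
  show "diffeomorphism A C id" "diffeomorphism C A id"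
    unfolding diffeomorphism_def C(3)
    using smooth_map_id[OF A C, of id] smooth_map_id[OF A C inv] by auto
qed

text \<open>
  The local trivializations below are all of this kind: source and target are covered by one chart
  each, and the map between them is the identity in these coordinates.
\<close>

lemma diffeomorphismI_global_charts:
  fixes A :: "('a, 'm::fin_dim_inner) atlas" and C :: "('b, 'n::fin_dim_inner) atlas"
    and x :: "'a \<Rightarrow> 'k::fin_dim_inner"
  assumes A: "smooth_atlas A" and C: "smooth_atlas C"
    and x: "chart_of A (points A) x" and y: "chart_of C (points C) y"
    and f: "\<And>p. p \<in> points A \<Longrightarrow> f p \<in> points C \<and> y (f p) = x p"
    and img: "y ` points C \<subseteq> x ` points A"
  shows "diffeomorphism A C f"
proof -
  have bij: "bij_betw f (points A) (points C)"
    unfolding bij_betw_def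
  proof (intro conjI subset_antisym)
    show inj: "inj_on f (points A)"
      using f chart_of_inj[OF x] by (metis inj_on_def)
    show "points C \<subseteq> f ` points A"
    proof
      fix q assume q: "q \<in> points C"
      then obtain p where p: "p \<in> points A" "y q = x p" using img by blast
      then have "f p = q" using f[OF p(1)] q chart_of_inj[OF y] by (metis inj_onD)
      then show "q \<in> f ` points A" using p by blast
    qed
  qed (use f in auto)
  have "smooth_in (points A) x (y \<circ> f)"
    by (rule smooth_in_cong[OF smooth_in_self[OF chart_of_open_image[OF x]]]) (simp add: f)
  then have "smooth_map A C f"
    using f x y by (intro smooth_mapI[OF A C]) blast
  moreover
  let ?g = "inv_into (points A) f"
  have g: "?g q \<in> points A" "f (?g q) = q" if "q \<in> points C" for q
    using bij that by (auto simp: bij_betw_def intro: inv_into_into f_inv_into_f)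
  have "smooth_in (points C) y (x \<circ> ?g)"
    by (rule smooth_in_cong[OF smooth_in_self[OF chart_of_open_image[OF y]]]) (metis f g comp_apply)
  then have "smooth_map C A ?g"
    using g x y by (intro smooth_mapI[OF C A]) blast
  ultimately show ?thesis
    using bij by (simp add: diffeomorphism_def)
qed

text \<open>
  Bundle charts arise from product charts in this way, along a local trivialization.
\<close>

lemma chart_of_pullback:
  assumes A: "smooth_atlas A" and C: "smooth_atlas C" and f: "diffeomorphism A C f"
    and y: "chart_of C V y"
  shows "chart_of A (points A \<inter> f -` V) (y \<circ> f)" (is "chart_of A ?U _")
proof -
  let ?g = "inv_into (points A) f"
  have bij: "bij_betw f (points A) (points C)" and sf: "smooth_map A C f" and sg: "smooth_map C A ?g"
    using f by (auto simp: diffeomorphism_def)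
  have g: "?g q \<in> points A" "f (?g q) = q" if "q \<in> points C" for q
    using bij that by (auto simp: bij_betw_def intro: inv_into_into f_inv_into_f)
  have gf: "?g (f p) = p" if "p \<in> points A" for p
    using bij that by (auto simp: bij_betw_def)
  have V: "V \<subseteq> points C" by (rule chart_of_points[OF y])
  have opU: "openin (mtopology A) ?U"
    using smooth_map_openin[OF A sf openin_topspace chart_of_openin[OF C y]]
    by (simp add: topspace_mtopology[OF A])
  have inj: "inj_on (y \<circ> f) ?U"
    using chart_of_inj[OF y] bij unfolding bij_betw_def
    by (intro comp_inj_on) (auto intro: inj_on_subset)
  have img: "(y \<circ> f) ` (?U \<inter> W) = y ` (V \<inter> ?g -` W)" if "W \<subseteq> points A" for W
  proof (intro set_eqI iffI)
    fix a assume "a \<in> y ` (V \<inter> ?g -` W)"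
    then obtain q where "q \<in> V" "?g q \<in> W" "a = y q" by blast
    then show "a \<in> (y \<circ> f) ` (?U \<inter> W)"
      using g[of q] V by (intro image_eqI[of _ _ "?g q"]) auto
  next
    fix a assume "a \<in> (y \<circ> f) ` (?U \<inter> W)"
    then obtain p where "p \<in> points A" "f p \<in> V" "p \<in> W" "a = y (f p)" by auto
    then show "a \<in> y ` (V \<inter> ?g -` W)"
      using gf[of p] by (intro image_eqI[of _ _ "f p"]) auto
  qed
  have opi: "open ((y \<circ> f) ` (?U \<inter> W))" if W: "openin (mtopology A) W" for W
  proof -
    have "W \<subseteq> points A" using openin_subset[OF W] topspace_mtopology[OF A] by simp
    then show ?thesis
      unfolding img[OF \<open>W \<subseteq> points A\<close>]
      using smooth_map_openin[OF C sg chart_of_openin[OF C y] W]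
        openin_iff_open_image[OF C y, of "V \<inter> ?g -` W"] by auto
  qed
  have "compatible (Z, z) (?U, y \<circ> f) \<and> compatible (?U, y \<circ> f) (Z, z)" if "(Z, z) \<in> A" for Z z
  proof -
    have Z: "chart_of A Z z" using smooth_atlas_chart[OF A that] .
    have op: "openin (mtopology A) (Z \<inter> ?U)"
      using chart_of_openin[OF A Z] opU by auto
    then have "open (z ` (Z \<inter> ?U))"
      using openin_iff_open_image[OF A Z, of "Z \<inter> ?U"] by auto
    moreover have "smooth_in (Z \<inter> ?U) z (y \<circ> f)"
      by (rule smooth_in_subset[OF smooth_map_in_charts[OF A C sf Z y]]) auto
    moreover have "smooth_in (?U \<inter> Z) (y \<circ> f) z"
    proof -
      obtain \<tau> where \<tau>: "Cinf_on (y ` (V \<inter> ?g -` Z)) \<tau>" "\<forall>q\<in>V \<inter> ?g -` Z. (z \<circ> ?g) q = \<tau> (y q)"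
        using smooth_map_in_charts[OF C A sg y Z] by (auto simp: smooth_in_def)
      show ?thesis
        unfolding smooth_in_def img[OF chart_of_points[OF Z]]
      proof (intro exI[of _ \<tau>] conjI ballI \<tau>(1))
        fix p assume p: "p \<in> ?U \<inter> Z"
        then have "f p \<in> V \<inter> ?g -` Z" "?g (f p) = p" using gf[of p] by auto
        then show "z p = \<tau> ((y \<circ> f) p)" using \<tau>(2) by force
      qed
    qed
    ultimately show ?thesis
      using chart_of_inj[OF Z] inj opi[OF chart_of_openin[OF A Z]] by (simp add: compatible_iff)
  qed
  then show ?thesis
    using inj opi[OF opU] by (auto simp: chart_of_def)
qed

lemma
  assumes A: "smooth_atlas A" and W: "openin (mtopology A) W"
  shows smooth_atlas_open_submanifold: "smooth_atlas (open_submanifold A W)"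
    and points_open_submanifold: "points (open_submanifold A W) = W"
    and chart_of_open_submanifold: "chart_of (open_submanifold A W) U x \<longleftrightarrow> chart_of A U x \<and> U \<subseteq> W"
proof -
  have WA: "W \<subseteq> points A" using openin_subset[OF W] topspace_mtopology[OF A] by simp
  then show pts: "points (open_submanifold A W) = W"
    by (auto simp: points_def open_submanifold_def)
  have ch: "chart_of A V y" if vy: "(V, y) \<in> open_submanifold A W" for V y
  proof -
    obtain V' where "(V', y) \<in> A" "V = V' \<inter> W"
      using vy unfolding open_submanifold_def by auto
    then show ?thesis
      using chart_of_Int[OF A smooth_atlas_chart[OF A] W] by simp
  qed
  show "smooth_atlas (open_submanifold A W)"
    unfolding smooth_atlas_def
  proof (intro conjI ballI)
    fix c d assume "c \<in> open_submanifold A W" "d \<in> open_submanifold A W"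
    then show "compatible c d"
      using chart_of_compatible[OF A, of "fst c" "snd c" "fst d" "snd d"] ch by simp
  qed (use ch in \<open>auto simp: chart_of_def\<close>)
  show "chart_of (open_submanifold A W) U x \<longleftrightarrow> chart_of A U x \<and> U \<subseteq> W"
  proof
    assume x: "chart_of A U x \<and> U \<subseteq> W"
    then have "compatible (V, y) (U, x) \<and> compatible (U, x) (V, y)" if "(V, y) \<in> open_submanifold A W" for V y
      using chart_of_compatible[OF A ch[OF that], of U x] chart_of_compatible[OF A _ ch[OF that], of U x] by simp
    then show "chart_of (open_submanifold A W) U x"
      using x pts by (auto simp: chart_of_def)
  next
    assume x: "chart_of (open_submanifold A W) U x"
    have UW: "U \<subseteq> W" using chart_of_points[OF x] pts by simp
    have "compatible (V, y) (U, x) \<and> compatible (U, x) (V, y)" if V: "(V, y) \<in> A" for V y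
    proof -
      have "(V \<inter> W, y) \<in> open_submanifold A W"
        using V unfolding open_submanifold_def by force
      then have *: "compatible (V \<inter> W, y) (U, x)" "compatible (U, x) (V \<inter> W, y)"
        using x by (auto simp: chart_of_def)
      have y: "inj_on y V" using chart_of_inj[OF smooth_atlas_chart[OF A V]] .
      then have "inj_on y (V \<inter> W)" by (rule inj_on_subset) simp
      moreover have "V \<inter> W \<inter> U = V \<inter> U" "U \<inter> (V \<inter> W) = U \<inter> V" using UW by auto
      ultimately show ?thesis
        using * y chart_of_inj[OF x] by (simp add: compatible_iff)
    qed
    then show "chart_of A U x \<and> U \<subseteq> W"
      using x UW WA by (auto simp: chart_of_def)
  qed
qed

lemma smooth_in_map_prod:
  assumes f: "smooth_in S x f" and g: "smooth_in T y g" and "open (x ` S)" "open (y ` T)"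
  shows "smooth_in (S \<times> T) (map_prod x y) (map_prod f g)"
proof -
  obtain \<sigma> \<tau> where *: "Cinf_on (x ` S) \<sigma>" "\<forall>p\<in>S. f p = \<sigma> (x p)" "Cinf_on (y ` T) \<tau>" "\<forall>p\<in>T. g p = \<tau> (y p)"
    using f g by (auto simp: smooth_in_def)
  have im: "map_prod x y ` (S \<times> T) = x ` S \<times> y ` T" by (rule map_prod_image)
  have op: "open (x ` S \<times> y ` T)" using assms(3,4) by (rule open_Times)
  have "Cinf_on (x ` S \<times> y ` T) (\<lambda>z. (\<sigma> (fst z), \<tau> (snd z)))"
  proof (rule Cinf_on_Pair[OF op])
    show "Cinf_on (x ` S \<times> y ` T) (\<lambda>z. \<sigma> (fst z))"
      by (rule Cinf_on_compose[OF bounded_linear_imp_Cinf_on[OF bounded_linear_fst op] *(1)]) (use op assms in auto)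
    show "Cinf_on (x ` S \<times> y ` T) (\<lambda>z. \<tau> (snd z))"
      by (rule Cinf_on_compose[OF bounded_linear_imp_Cinf_on[OF bounded_linear_snd op] *(3)]) (use op assms in auto)
  qed
  then show ?thesis
    unfolding smooth_in_def im using *(2,4) by (intro exI conjI) auto
qed

lemma map_prod_compatible:
  fixes x :: "'a \<Rightarrow> 'm::fin_dim_inner" and x' :: "'a \<Rightarrow> 'n::fin_dim_inner"
    and y :: "'b \<Rightarrow> 'k::fin_dim_inner" and y' :: "'b \<Rightarrow> 'l::fin_dim_inner"
  assumes "inj_on x U" "inj_on y V" "compatible (U, x) (U', x')" "compatible (V, y) (V', y')"
  shows "compatible (U \<times> V, map_prod x y) (U' \<times> V', map_prod x' y')"
proof -
  have *: "open (x ` (U \<inter> U'))" "smooth_in (U \<inter> U') x x'" "open (y ` (V \<inter> V'))" "smooth_in (V \<inter> V') y y'"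
    using assms by (auto simp: compatible_iff)
  have "U \<times> V \<inter> U' \<times> V' = (U \<inter> U') \<times> (V \<inter> V')" by blast
  moreover have "inj_on (map_prod x y) (U \<times> V)" using assms(1,2) by (rule map_prod_inj_on)
  ultimately show ?thesis
    using smooth_in_map_prod[OF *(2,4,1,3)] open_Times[OF *(1,3)] by (simp add: compatible_iff map_prod_image)
qed

lemma points_prod_manifold: "points (prod_manifold A C) = points A \<times> points C"
  unfolding points_def prod_manifold_def by fastforce

lemma smooth_atlas_prod_manifold:
  assumes A: "smooth_atlas A" and C: "smooth_atlas C"
  shows "smooth_atlas (prod_manifold A C)"
  unfolding smooth_atlas_def
proof (intro conjI ballI)
  fix c d assume "c \<in> prod_manifold A C" "d \<in> prod_manifold A C"
  then show "compatible c d"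
    using assms unfolding prod_manifold_def by (auto simp: smooth_atlas_def intro!: map_prod_compatible)
next
  fix c assume "c \<in> prod_manifold A C"
  then show "case c of (U, x) \<Rightarrow> inj_on x U \<and> open (x ` U)"
    using assms unfolding prod_manifold_def
    by (auto simp: smooth_atlas_def map_prod_image intro!: map_prod_inj_on open_Times)
qed

lemma chart_of_prod_manifold:
  assumes x: "chart_of A U x" and y: "chart_of C V y"
    and A: "smooth_atlas A" and C: "smooth_atlas C"
  shows "chart_of (prod_manifold A C) (U \<times> V) (map_prod x y)"
proof -
  have "compatible c (U \<times> V, map_prod x y) \<and> compatible (U \<times> V, map_prod x y) c"
    if c0: "c \<in> prod_manifold A C" for c
  proof -
    obtain U' x' V' y' where c: "c = (U' \<times> V', map_prod x' y')" "(U', x') \<in> A" "(V', y') \<in> C"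
      using c0 unfolding prod_manifold_def by auto
    moreover have "inj_on x' U'" "inj_on y' V'"
      using c(2,3) A C by (auto simp: smooth_atlas_def)
    ultimately show ?thesis
      using x y by (auto simp: chart_of_def intro!: map_prod_compatible)
  qed
  then show ?thesis
    using x y by (auto simp: chart_of_def points_prod_manifold map_prod_image intro!: map_prod_inj_on open_Times)
qed

lemma smooth_manifold_atlas: "smooth_manifold A \<Longrightarrow> smooth_atlas A"
  by (simp add: smooth_manifold_def)

section \<open>Bump functions\<close>

lemma flat_pos: "t > 0 \<Longrightarrow> flat 0 t = exp (- (1 / t))"
  and flat_nonpos: "t \<le> 0 \<Longrightarrow> flat n t = 0"
  by (simp_all add: flat_def)

lemma flat_eq_imp_eq: "flat 0 s = flat 0 t \<Longrightarrow> t > 0 \<Longrightarrow> s = t"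
  by (cases "s > 0") (simp_all add: flat_pos flat_nonpos)

lemma Cinf_on_bump:
  "Cinf_on UNIV (\<lambda>b::'n::fin_dim_inner. flat 0 (r\<^sup>2 - (b - a) \<bullet> (b - a)))"
proof -
  have d: "Cinf_on UNIV (\<lambda>b. b - a)"
    by (intro Cinf_on_diff Cinf_on_ident Cinf_on_const open_UNIV)
  have "Cinf_on UNIV (\<lambda>b. r\<^sup>2 - (b - a) \<bullet> (b - a))"
    by (intro Cinf_on_diff[OF open_UNIV Cinf_on_const[OF open_UNIV]] Cinf_on_inner[OF open_UNIV d d])
  from Cinf_on_compose[OF this Cinf_on_flat] show ?thesis by simp
qed

lemma closedin_chart_cball:
  assumes A: "smooth_manifold A" and x: "chart_of A U x" and K: "cball a r \<subseteq> x ` U"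
  shows "closedin (mtopology A) (U \<inter> x -` cball a r)"
proof -
  note sA = smooth_manifold_atlas[OF A]
  have cont: "continuous_map (top_of_set (x ` U)) (mtopology A) (inv_into U x)"
    unfolding continuous_map_def
  proof (intro conjI allI impI)
    show "inv_into U x \<in> topspace (top_of_set (x ` U)) \<rightarrow> topspace (mtopology A)"
      using chart_of_points[OF x] by (auto simp: topspace_mtopology[OF sA] inv_into_into subset_iff)
    fix W assume W: "openin (mtopology A) W"
    have "{b \<in> topspace (top_of_set (x ` U)). inv_into U x b \<in> W} = x ` (U \<inter> W)"
      using chart_of_inj[OF x] by auto
    moreover have "open (x ` (U \<inter> W))"
      by (rule chart_of_open_image[OF chart_of_Int[OF sA x W]])
    ultimately show "openin (top_of_set (x ` U)) {b \<in> topspace (top_of_set (x ` U)). inv_into U x b \<in> W}"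
      by (simp add: open_openin_trans[OF chart_of_open_image[OF x]] openin_open_eq[OF chart_of_open_image[OF x]])
         blast
  qed
  have "compactin (top_of_set (x ` U)) (cball a r)"
    using K compact_cball_fin_dim by (simp add: compactin_subtopology)
  then have "compactin (mtopology A) (inv_into U x ` cball a r)"
    using cont by (rule image_compactin)
  moreover have "inv_into U x ` cball a r = U \<inter> x -` cball a r"
  proof (intro set_eqI iffI)
    fix q assume "q \<in> inv_into U x ` cball a r"
    then obtain b where b: "b \<in> cball a r" "q = inv_into U x b" by blast
    then have "b \<in> x ` U" using K by blast
    then show "q \<in> U \<inter> x -` cball a r"
      using b by (simp add: inv_into_into f_inv_into_f)
  next
    fix q assume "q \<in> U \<inter> x -` cball a r"
    then show "q \<in> inv_into U x ` cball a r"
      using chart_of_inj[OF x] by (intro image_eqI[of _ _ "x q"]) auto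
  qed
  ultimately show ?thesis
    using A compactin_imp_closedin[of "mtopology A" "U \<inter> x -` cball a r"] by (simp add: smooth_manifold_def)
qed

text \<open>
  Functions of the coordinates extend to the manifold after multiplication by a bump.  The support
  of the product is compact, hence closed by the Hausdorff property.
\<close>

lemma bump_extension:
  fixes A :: "('a, 'm::fin_dim_inner) atlas" and x :: "'a \<Rightarrow> 'n::fin_dim_inner"
  assumes A: "smooth_manifold A" and x: "chart_of A U x" and p: "p \<in> U"
  obtains r where "r > 0" and "\<And>g. Cinf_on UNIV g \<Longrightarrow> smooth_map A std_manifold
    (\<lambda>q. if q \<in> U then flat 0 (r\<^sup>2 - (x q - x p) \<bullet> (x q - x p)) * g (x q) else 0)"
proof -
  note sA = smooth_manifold_atlas[OF A]
  obtain r where r: "r > 0" "cball (x p) r \<subseteq> x ` U"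
    using chart_of_open_image[OF x] p open_contains_cball by blast
  show ?thesis
  proof (rule that[OF r(1)])
    fix g :: "'n \<Rightarrow> real" assume g: "Cinf_on UNIV g"
    define G where "G b = flat 0 (r\<^sup>2 - (b - x p) \<bullet> (b - x p)) * g b" for b
    let ?F = "\<lambda>q. if q \<in> U then flat 0 (r\<^sup>2 - (x q - x p) \<bullet> (x q - x p)) * g (x q) else 0"
    have G: "Cinf_on UNIV G"
      unfolding G_def by (rule Cinf_on_mult[OF open_UNIV Cinf_on_bump g])
    let ?K = "U \<inter> x -` cball (x p) r"
    have opK: "openin (mtopology A) (points A - ?K)"
      using closedin_chart_cball[OF A x r(2)] by (metis openin_diff openin_topspace topspace_mtopology[OF sA])
    have zero: "?F q = 0" if "q \<notin> ?K" for q
    proof (cases "q \<in> U")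
      case True
      then have "r < norm (x q - x p)"
        using that by (simp add: dist_norm norm_minus_commute)
      then have "r\<^sup>2 < (norm (x q - x p))\<^sup>2"
        using r(1) by (intro power_strict_mono) auto
      then have "r\<^sup>2 - (x q - x p) \<bullet> (x q - x p) \<le> 0"
        by (simp add: power2_norm_eq_inner)
      then show ?thesis by (simp add: flat_nonpos)
    qed simp
    show "smooth_map A std_manifold ?F"
    proof (rule smooth_map_to_stdI[OF sA])
      fix q assume q: "q \<in> points A"
      then obtain Z z where Z: "(Z, z) \<in> A" "chart_of A Z z" "q \<in> Z"
        by (rule chart_at[OF sA])
      show "\<exists>W (z::'a \<Rightarrow> 'm). q \<in> W \<and> chart_of A W z \<and> smooth_in W z ?F"
      proof (cases "q \<in> U")
        case True
        have W: "chart_of A (Z \<inter> U) z"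
          by (rule chart_of_Int[OF sA Z(2) chart_of_openin[OF sA x]])
        have "smooth_in (Z \<inter> U) z (\<lambda>q. G (x q))"
          by (rule smooth_in_compose[OF chart_of_transition[OF sA Z(2) x] G])
            (use chart_of_open_image[OF W] in auto)
        then have "smooth_in (Z \<inter> U) z ?F"
          by (rule smooth_in_cong) (simp add: G_def)
        then show ?thesis using W Z(3) True by (intro exI[of _ "Z \<inter> U"] exI[of _ z]) simp
      next
        case False
        let ?W = "Z \<inter> (points A - ?K)"
        have W: "chart_of A ?W z"
          by (rule chart_of_Int[OF sA Z(2) opK])
        have "smooth_in ?W z ?F"
          unfolding smooth_in_def using zero Cinf_on_const[OF chart_of_open_image[OF W], of 0]
          by (intro exI[of _ "\<lambda>_. 0"]) auto
        then show ?thesis using W Z(3) q False by (intro exI[of _ ?W] exI[of _ z]) simp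
      qed
    qed
  qed
qed

section \<open>Partial derivatives at the origin\<close>

lemma partial0_has_derivative:
  assumes "(g has_derivative D) (at 0)"
  shows "partial0 \<alpha> g = D (axis \<alpha> 1)"
proof -
  have l: "((\<lambda>t::real. t *\<^sub>R axis \<alpha> (1::real)) has_derivative (\<lambda>t. t *\<^sub>R axis \<alpha> 1)) (at 0)"
    by (rule bounded_linear_imp_has_derivative) (rule bounded_linear_scaleR_left)
  have "((\<lambda>t. g (t *\<^sub>R axis \<alpha> 1)) has_derivative (\<lambda>t. D (t *\<^sub>R axis \<alpha> 1))) (at 0)"
    using diff_chain_at[OF l, of g D] assms by (simp add: o_def)
  then have "((\<lambda>t. g (t *\<^sub>R axis \<alpha> 1)) has_vector_derivative D (axis \<alpha> 1)) (at 0)"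
    unfolding has_vector_derivative_def
    using linear_scale[OF has_derivative_linear[OF assms]] by simp
  then show ?thesis unfolding partial0_def by (rule vector_derivative_at)
qed

lemma partial0_cong:
  assumes "\<forall>\<^sub>F u in nhds 0. f u = g u"
  shows "partial0 \<alpha> f = partial0 \<alpha> g"
proof -
  have "filterlim (\<lambda>t::real. t *\<^sub>R axis \<alpha> (1::real)) (nhds 0) (nhds 0)"
  proof -
    have "isCont (\<lambda>t::real. t *\<^sub>R axis \<alpha> (1::real)) 0"
      by (intro continuous_intros)
    then show ?thesis
      using tendsto_at_iff_tendsto_nhds[of "\<lambda>t::real. t *\<^sub>R axis \<alpha> (1::real)" 0] by (simp add: isCont_def)
  qed
  then have "\<forall>\<^sub>F t in nhds (0::real). f (t *\<^sub>R axis \<alpha> 1) = g (t *\<^sub>R axis \<alpha> 1)"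
    by (rule eventually_compose_filterlim[OF assms])
  then show ?thesis
    unfolding partial0_def by (intro vector_derivative_cong_eq) auto
qed

lemma partial0_chain:
  assumes "\<phi> differentiable (at 0)" "(h has_derivative D) (at (\<phi> 0))"
  shows "partial0 \<alpha> (h \<circ> \<phi>) = D (partial0 \<alpha> \<phi>)"
proof -
  obtain E where E: "(\<phi> has_derivative E) (at 0)"
    using assms(1) by (auto simp: differentiable_def)
  show ?thesis
    using partial0_has_derivative[OF diff_chain_at[OF E assms(2)]] partial0_has_derivative[OF E] by simp
qed

lemma partial0_linear:
  assumes "\<phi> differentiable (at 0)" "bounded_linear L"
  shows "partial0 \<alpha> (\<lambda>u. L (\<phi> u)) = L (partial0 \<alpha> \<phi>)"
  using partial0_chain[OF assms(1) bounded_linear_imp_has_derivative[OF assms(2)]] by (simp add: o_def)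

lemma partial0_Pair:
  assumes "f differentiable (at 0)" "g differentiable (at 0)"
  shows "partial0 \<alpha> (\<lambda>u. (f u, g u)) = (partial0 \<alpha> f, partial0 \<alpha> g)"
proof -
  obtain D E where *: "(f has_derivative D) (at 0)" "(g has_derivative E) (at 0)"
    using assms by (auto simp: differentiable_def)
  show ?thesis
    using partial0_has_derivative[OF has_derivative_Pair[OF *]] partial0_has_derivative[OF *(1)]
      partial0_has_derivative[OF *(2)] by simp
qed

lemma partial0_add:
  assumes "f differentiable (at 0)" "g differentiable (at 0)"
  shows "partial0 \<alpha> (\<lambda>u. f u + g u) = partial0 \<alpha> f + partial0 \<alpha> g"
proof -
  obtain D E where *: "(f has_derivative D) (at 0)" "(g has_derivative E) (at 0)"
    using assms by (auto simp: differentiable_def)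
  show ?thesis
    using partial0_has_derivative[OF has_derivative_add[OF *]] partial0_has_derivative[OF *(1)]
      partial0_has_derivative[OF *(2)] by simp
qed

section \<open>Jets in coordinates\<close>

text \<open>
  Regularity that suffices for \<open>\<phi>\<close> to have coordinates as a jet, for maps that are well behaved only near
  the origin: \<open>\<phi>\<close> stays in a chart there and is differentiable in it at the origin.
\<close>

definition differentiable_germ :: "('a, 'm::fin_dim_inner) atlas \<Rightarrow> (real^'p::finite \<Rightarrow> 'a) \<Rightarrow> bool" where
  "differentiable_germ A \<phi> \<longleftrightarrow>
     (\<exists>(U, x)\<in>A. \<phi> 0 \<in> U \<and> (\<forall>\<^sub>F u in nhds 0. \<phi> u \<in> U) \<and> (x \<circ> \<phi>) differentiable (at 0))"

lemma differentiable_germ_transition: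
  fixes A :: "('a, 'm::fin_dim_inner) atlas" and \<phi> :: "real^'p::finite \<Rightarrow> 'a"
  assumes A: "smooth_atlas A" and x: "chart_of A U x" and y: "chart_of A V y"
    and \<phi>: "\<phi> 0 \<in> U" "\<phi> 0 \<in> V" "\<forall>\<^sub>F u in nhds 0. \<phi> u \<in> U" "(x \<circ> \<phi>) differentiable (at 0)"
  shows "\<forall>\<^sub>F u in nhds 0. \<phi> u \<in> V" "(y \<circ> \<phi>) differentiable (at 0)"
proof -
  have UV: "chart_of A (U \<inter> V) x"
    by (rule chart_of_Int[OF A x chart_of_openin[OF A y]])
  have "isCont (x \<circ> \<phi>) 0"
    by (rule differentiable_imp_continuous_within[OF \<phi>(4)])
  then have "((x \<circ> \<phi>) \<longlongrightarrow> (x \<circ> \<phi>) 0) (nhds 0)"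
    using tendsto_at_iff_tendsto_nhds[of "x \<circ> \<phi>" 0] by (simp add: isCont_def)
  then have "\<forall>\<^sub>F u in nhds 0. (x \<circ> \<phi>) u \<in> x ` (U \<inter> V)"
    by (rule topological_tendstoD[OF _ chart_of_open_image[OF UV]]) (use \<phi> in auto)
  then have ev: "\<forall>\<^sub>F u in nhds 0. \<phi> u \<in> U \<inter> V"
    using \<phi>(3)
  proof eventually_elim
    case (elim u)
    then obtain q where "q \<in> U \<inter> V" "x (\<phi> u) = x q" by auto
    with elim show ?case using chart_of_inj[OF x] by (auto dest: inj_onD)
  qed
  then show "\<forall>\<^sub>F u in nhds 0. \<phi> u \<in> V" by (rule eventually_mono) simp
  obtain \<tau> where \<tau>: "Cinf_on (x ` (U \<inter> V)) \<tau>" "\<forall>q\<in>U \<inter> V. y q = \<tau> (x q)"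
    using chart_of_transition[OF A x y] by (auto simp: smooth_in_def)
  have "\<tau> differentiable (at ((x \<circ> \<phi>) 0))"
    using Cinf_on_differentiable[OF \<tau>(1)] \<phi> by auto
  then have d: "(\<tau> \<circ> (x \<circ> \<phi>)) differentiable (at 0)"
    by (rule differentiable_chain_at[OF \<phi>(4)])
  have e: "\<forall>\<^sub>F u in at 0. (\<tau> \<circ> (x \<circ> \<phi>)) u = (y \<circ> \<phi>) u"
    using eventually_nhds_x_imp_x ev unfolding eventually_at_filter
    by (auto elim!: eventually_mono simp: \<tau>(2))
  obtain D where "((\<tau> \<circ> (x \<circ> \<phi>)) has_derivative D) (at 0)"
    using d by (auto simp: differentiable_def)
  then have "((y \<circ> \<phi>) has_derivative D) (at 0)"
    by (rule has_derivative_transform_eventually[OF _ e]) (use \<tau>(2) \<phi> in auto)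
  then show "(y \<circ> \<phi>) differentiable (at 0)"
    by (auto simp: differentiable_def)
qed

lemma differentiable_germD:
  assumes A: "smooth_atlas A" and \<phi>: "differentiable_germ A \<phi>" and y: "chart_of A V y" "\<phi> 0 \<in> V"
  shows "\<forall>\<^sub>F u in nhds 0. \<phi> u \<in> V" "(y \<circ> \<phi>) differentiable (at 0)"
proof -
  obtain U x where U: "(U, x) \<in> A" "\<phi> 0 \<in> U" "\<forall>\<^sub>F u in nhds 0. \<phi> u \<in> U" "(x \<circ> \<phi>) differentiable (at 0)"
    using \<phi> by (auto simp: differentiable_germ_def)
  show "\<forall>\<^sub>F u in nhds 0. \<phi> u \<in> V" "(y \<circ> \<phi>) differentiable (at 0)"
    using differentiable_germ_transition[OF A smooth_atlas_chart[OF A U(1)] y(1) U(2) y(2) U(3,4)] .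
qed

lemma differentiable_germI:
  assumes A: "smooth_atlas A" and x: "chart_of A U x" "\<phi> 0 \<in> U" "\<forall>\<^sub>F u in nhds 0. \<phi> u \<in> U"
      "(x \<circ> \<phi>) differentiable (at 0)"
  shows "differentiable_germ A \<phi>"
proof -
  have "\<phi> 0 \<in> points A" using chart_of_points[OF x(1)] x(2) by blast
  then obtain V y where V: "(V, y) \<in> A" "chart_of A V y" "\<phi> 0 \<in> V"
    by (rule chart_at[OF A])
  then show ?thesis
    using differentiable_germ_transition[OF A x(1) V(2) x(2) V(3) x(3,4)]
    unfolding differentiable_germ_def by blast
qed

lemma differentiable_germ_points: "differentiable_germ A \<phi> \<Longrightarrow> \<phi> 0 \<in> points A"
  by (auto simp: differentiable_germ_def points_def)

lemma smooth_map_from_std: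
  fixes A :: "('a, 'm::fin_dim_inner) atlas" and \<phi> :: "'k::fin_dim_inner \<Rightarrow> 'a"
  assumes A: "smooth_atlas A" and \<phi>: "smooth_map std_manifold A \<phi>" and x: "chart_of A U x"
  shows "open (\<phi> -` U)" "Cinf_on (\<phi> -` U) (x \<circ> \<phi>)"
proof -
  show op: "open (\<phi> -` U)"
    using smooth_map_openin_image[OF smooth_atlas_std A \<phi> chart_of_std x] by simp
  obtain \<tau> where "Cinf_on (\<phi> -` U) \<tau>" "\<forall>u\<in>\<phi> -` U. (x \<circ> \<phi>) u = \<tau> u"
    using smooth_map_in_charts[OF smooth_atlas_std A \<phi> chart_of_std x] by (auto simp: smooth_in_def)
  then show "Cinf_on (\<phi> -` U) (x \<circ> \<phi>)"
    using Cinf_on_cong[OF _ op, of \<tau> "x \<circ> \<phi>"] by auto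
qed

lemma smooth_map_imp_germ:
  assumes A: "smooth_atlas A" and \<phi>: "smooth_map std_manifold A \<phi>"
  shows "differentiable_germ A \<phi>"
proof -
  have "\<phi> 0 \<in> points A"
    by (rule smooth_map_points[OF smooth_atlas_std A \<phi>]) (simp add: points_std)
  then obtain U x where U: "(U, x) \<in> A" "chart_of A U x" "\<phi> 0 \<in> U"
    by (rule chart_at[OF A])
  note * = smooth_map_from_std[OF A \<phi> U(2)]
  have "\<forall>\<^sub>F u in nhds 0. \<phi> u \<in> U"
    using eventually_nhds_in_open[OF *(1), of 0] U(3) by simp
  moreover have "(x \<circ> \<phi>) differentiable (at 0)"
    using Cinf_on_differentiable[OF *(2), of 0] U(3) by simp
  ultimately show ?thesis
    using differentiable_germI[of A U x \<phi>] A U by blast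
qed

text \<open>
  Derivatives at the origin transform by a linear map that depends only on the base point.  Both the
  smooth structure of the jets and the primary operations rest on this.
\<close>

lemma partial0_coordinates:
  assumes A: "smooth_atlas A" and \<phi>: "differentiable_germ A \<phi>" and x: "chart_of A U x" "\<phi> 0 \<in> U"
    and \<tau>: "Cinf_on (x ` U) \<tau>" "\<And>q. q \<in> U \<Longrightarrow> h q = \<tau> (x q)"
  shows "partial0 \<alpha> (h \<circ> \<phi>) = frechet_derivative \<tau> (at (x (\<phi> 0))) (partial0 \<alpha> (x \<circ> \<phi>))"
proof -
  note g = differentiable_germD[OF A \<phi> x]
  have "\<forall>\<^sub>F u in nhds 0. (h \<circ> \<phi>) u = (\<tau> \<circ> (x \<circ> \<phi>)) u"
    using g(1) by (rule eventually_mono) (simp add: \<tau>(2))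
  then have "partial0 \<alpha> (h \<circ> \<phi>) = partial0 \<alpha> (\<tau> \<circ> (x \<circ> \<phi>))" by (rule partial0_cong)
  also have "\<dots> = frechet_derivative \<tau> (at ((x \<circ> \<phi>) 0)) (partial0 \<alpha> (x \<circ> \<phi>))"
    by (rule partial0_chain[OF g(2) Cinf_on_has_derivative[OF \<tau>(1)]]) (use x(2) in auto)
  finally show ?thesis by simp
qed

text \<open>
  Smooth functions on the whole manifold determine the coordinates of a jet.  A bump around \<open>\<phi> 0\<close>
  attains the value that it has there at no other point, so it detects the base point.  The bump times
  \<open>(x - x (\<phi> 0)) \<bullet> v\<close> detects the derivative in the direction \<open>v\<close>: the second factor vanishes at the base
  point, so the derivative of the bump does not contribute.
\<close>

lemma jet_equiv_iff:
  fixes A :: "('a, 'm::fin_dim_inner) atlas" and x :: "'a \<Rightarrow> 'n::fin_dim_inner"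
    and \<phi> \<xi> :: "real^'p::finite \<Rightarrow> 'a"
  assumes A: "smooth_manifold A" and x: "chart_of A U x" "\<phi> 0 \<in> U"
    and \<phi>: "differentiable_germ A \<phi>" and \<xi>: "differentiable_germ A \<xi>"
  shows "jet_equiv A \<phi> \<xi> \<longleftrightarrow> \<phi> 0 = \<xi> 0 \<and> (\<forall>\<alpha>. partial0 \<alpha> (x \<circ> \<phi>) = partial0 \<alpha> (x \<circ> \<xi>))"
proof
  note sA = smooth_manifold_atlas[OF A]
  assume eq: "\<phi> 0 = \<xi> 0 \<and> (\<forall>\<alpha>. partial0 \<alpha> (x \<circ> \<phi>) = partial0 \<alpha> (x \<circ> \<xi>))"
  show "jet_equiv A \<phi> \<xi>"
    unfolding jet_equiv_def
  proof (intro allI impI conjI)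
    fix f :: "'a \<Rightarrow> real" and \<alpha>
    assume f: "smooth_map A std_manifold f"
    show "f (\<phi> 0) = f (\<xi> 0)" using eq by simp
    obtain \<tau> where "Cinf_on (x ` U) \<tau>" "\<forall>q\<in>U. f q = \<tau> (x q)"
      using smooth_map_in_charts[OF sA smooth_atlas_std f x(1) chart_of_std] by (auto simp: smooth_in_def)
    then show "partial0 \<alpha> (f \<circ> \<phi>) = partial0 \<alpha> (f \<circ> \<xi>)"
      using partial0_coordinates[OF sA \<phi> x, of \<tau> f] partial0_coordinates[OF sA \<xi> x(1), of \<tau> f] eq x(2) by simp
  qed
next
  note sA = smooth_manifold_atlas[OF A]
  assume eq: "jet_equiv A \<phi> \<xi>"
  let ?a = "x (\<phi> 0)"
  obtain r where r: "r > 0" and F: "\<And>g. Cinf_on UNIV g \<Longrightarrow> smooth_map A std_manifold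
      (\<lambda>q. if q \<in> U then flat 0 (r\<^sup>2 - (x q - ?a) \<bullet> (x q - ?a)) * g (x q) else 0)"
    using bump_extension[OF A x] by blast
  have r2: "r\<^sup>2 > 0" using r by simp
  have J: "f (\<phi> 0) = f (\<xi> 0)" if "smooth_map A std_manifold f" for f :: "'a \<Rightarrow> real"
    using eq that unfolding jet_equiv_def by blast
  have "\<xi> 0 \<in> U \<and> flat 0 (r\<^sup>2 - (x (\<xi> 0) - ?a) \<bullet> (x (\<xi> 0) - ?a)) = flat 0 (r\<^sup>2)"
  proof -
    have "flat 0 (r\<^sup>2) > 0" using r2 by (simp add: flat_pos)
    moreover have "(if \<xi> 0 \<in> U then flat 0 (r\<^sup>2 - (x (\<xi> 0) - ?a) \<bullet> (x (\<xi> 0) - ?a)) else 0) = flat 0 (r\<^sup>2)"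
      using J[OF F[OF Cinf_on_const[OF open_UNIV, of 1]]] x(2) by simp
    ultimately show ?thesis by (auto split: if_splits)
  qed
  then have \<xi>U: "\<xi> 0 \<in> U" and "r\<^sup>2 - (x (\<xi> 0) - ?a) \<bullet> (x (\<xi> 0) - ?a) = r\<^sup>2"
    using flat_eq_imp_eq r2 by blast+
  then have "x (\<xi> 0) = ?a" by simp
  then have eq0: "\<phi> 0 = \<xi> 0"
    using \<xi>U x chart_of_inj[OF x(1)] by (metis inj_onD)
  have "partial0 \<alpha> (x \<circ> \<phi>) \<bullet> v = partial0 \<alpha> (x \<circ> \<xi>) \<bullet> v" for \<alpha> v
  proof -
    have g: "Cinf_on UNIV (\<lambda>b. (b - ?a) \<bullet> v)"
      by (intro Cinf_on_inner Cinf_on_diff Cinf_on_ident Cinf_on_const open_UNIV)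
    define G where "G b = flat 0 (r\<^sup>2 - (b - ?a) \<bullet> (b - ?a)) * ((b - ?a) \<bullet> v)" for b
    let ?F = "\<lambda>q. if q \<in> U then flat 0 (r\<^sup>2 - (x q - ?a) \<bullet> (x q - ?a)) * ((x q - ?a) \<bullet> v) else 0"
    have GC: "Cinf_on (x ` U) G"
      unfolding G_def
      by (rule Cinf_on_subset[OF Cinf_on_mult[OF open_UNIV Cinf_on_bump g] subset_UNIV])
    have dG: "frechet_derivative G (at ?a) w = flat 0 (r\<^sup>2) * (w \<bullet> v)" for w
    proof -
      let ?h = "\<lambda>b. flat 0 (r\<^sup>2 - (b - ?a) \<bullet> (b - ?a))"
      have h: "(?h has_derivative frechet_derivative ?h (at ?a)) (at ?a)"
        by (rule Cinf_on_has_derivative[OF Cinf_on_bump UNIV_I])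
      have "((\<lambda>b. (b - ?a) \<bullet> v) has_derivative (\<lambda>w. w \<bullet> v)) (at ?a)"
        by (auto intro!: derivative_eq_intros)
      from has_derivative_mult[OF h this]
      have "(G has_derivative (\<lambda>w. flat 0 (r\<^sup>2) * (w \<bullet> v))) (at ?a)"
        by (simp add: G_def[abs_def])
      then show ?thesis using frechet_derivative_at by metis
    qed
    have "partial0 \<alpha> (?F \<circ> \<phi>) = partial0 \<alpha> (?F \<circ> \<xi>)"
      using eq[unfolded jet_equiv_def, THEN spec, THEN mp, OF F[OF g]] by blast
    moreover have "partial0 \<alpha> (?F \<circ> \<phi>) = flat 0 (r\<^sup>2) * (partial0 \<alpha> (x \<circ> \<phi>) \<bullet> v)"
      by (subst partial0_coordinates[OF sA \<phi> x GC]) (simp_all add: G_def dG)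
    moreover have "partial0 \<alpha> (?F \<circ> \<xi>) = flat 0 (r\<^sup>2) * (partial0 \<alpha> (x \<circ> \<xi>) \<bullet> v)"
      by (subst partial0_coordinates[OF sA \<xi> x(1) \<xi>U GC]) (simp_all add: G_def dG flip: eq0)
    ultimately show ?thesis using r2 by (simp add: flat_pos)
  qed
  then show "\<phi> 0 = \<xi> 0 \<and> (\<forall>\<alpha>. partial0 \<alpha> (x \<circ> \<phi>) = partial0 \<alpha> (x \<circ> \<xi>))"
    using eq0 by (metis vector_eq_rdot)
qed

section \<open>The manifold of jets\<close>

text \<open>
  The curve \<open>u \<mapsto> a + X u\<close> is damped so as to stay inside \<open>S\<close>; the damping factor has value 1 at the
  origin, where \<open>X u\<close> vanishes, and so does not change the first derivative there.
\<close>

lemma smooth_curve_with_derivative: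
  fixes S :: "'n::fin_dim_inner set" and X :: "'n^'p::finite"
  assumes "open S" "a \<in> S"
  obtains \<gamma> :: "real^'p \<Rightarrow> 'n" where "Cinf_on UNIV \<gamma>" "\<gamma> 0 = a" "\<And>u. \<gamma> u \<in> S"
    "\<And>\<alpha>. partial0 \<alpha> \<gamma> = X $ \<alpha>"
proof -
  obtain r where r: "r > 0" "ball a r \<subseteq> S"
    using assms open_contains_ball by blast
  define w where "w u = (\<Sum>\<alpha>\<in>UNIV. (u $ \<alpha>) *\<^sub>R (X $ \<alpha>))" for u :: "real^'p"
  define e where "e u = exp (- (w u \<bullet> w u) * inverse (r\<^sup>2))" for u
  have w: "bounded_linear w"
    unfolding w_def
    by (intro bounded_linear_sum bounded_linear_compose[OF bounded_linear_scaleR_left] bounded_linear_vec_nth)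
  have wC: "Cinf_on UNIV w" by (rule bounded_linear_imp_Cinf_on[OF w open_UNIV])
  have "Cinf_on UNIV (\<lambda>u. - (w u \<bullet> w u) * inverse (r\<^sup>2))"
    by (intro Cinf_on_mult Cinf_on_minus Cinf_on_inner wC Cinf_on_const open_UNIV)
  from Cinf_on_compose[OF this Cinf_on_exp] have eC: "Cinf_on UNIV e"
    by (simp add: e_def[abs_def])
  have w0: "w 0 = 0" by (simp add: w_def)
  then have e0: "e 0 = 1" by (simp add: e_def)
  let ?\<gamma> = "\<lambda>u. a + e u *\<^sub>R w u"
  show ?thesis
  proof (rule that)
    show "Cinf_on UNIV ?\<gamma>"
      by (intro Cinf_on_add Cinf_on_const Cinf_on_scaleR eC wC open_UNIV)
    show "?\<gamma> 0 = a" by (simp add: w0)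
    show "?\<gamma> u \<in> S" for u
    proof -
      define s where "s = norm (w u) / r"
      have s: "norm (w u) = s * r" "s \<ge> 0" using r by (simp_all add: s_def)
      \<comment> \<open>the norm is \<open>r\<close> times \<open>s exp (-s\<^sup>2) < 1\<close>\<close>
      have "s < 1 + s\<^sup>2"
        using zero_le_power2[of "s - 1/2"] by (simp add: power2_eq_square algebra_simps)
      also have "\<dots> \<le> exp (s\<^sup>2)" by (rule exp_ge_add_one_self)
      finally have "exp (- s\<^sup>2) * s < exp (- s\<^sup>2) * exp (s\<^sup>2)" by simp
      then have "exp (- s\<^sup>2) * s < 1" by (simp flip: exp_add)
      moreover have "e u = exp (- s\<^sup>2)"
        using r by (simp add: e_def s_def power2_norm_eq_inner[symmetric] power_divide field_simps)
      ultimately have "norm (e u *\<^sub>R w u) < r"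
        using r s by (simp add: mult.assoc[symmetric])
      then show ?thesis using r(2) by (auto simp: dist_norm)
    qed
    show "partial0 \<alpha> ?\<gamma> = X $ \<alpha>" for \<alpha>
    proof -
      have "((\<lambda>u. a + e u *\<^sub>R w u) has_derivative
          (\<lambda>v. 0 + (e 0 *\<^sub>R w v + frechet_derivative e (at 0) v *\<^sub>R w 0))) (at 0)"
        by (intro has_derivative_add has_derivative_const has_derivative_scaleR
            Cinf_on_has_derivative[OF eC UNIV_I] bounded_linear_imp_has_derivative[OF w])
      then have "partial0 \<alpha> ?\<gamma> = w (axis \<alpha> 1)"
        by (subst partial0_has_derivative) (auto simp: w0 e0)
      also have "\<dots> = (\<Sum>\<beta>\<in>UNIV. if \<beta> = \<alpha> then X $ \<beta> else 0)"
        unfolding w_def by (intro sum.cong) (auto simp: axis_def)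
      finally show ?thesis by simp
    qed
  qed
qed

lemma smooth_curve_in_chart:
  fixes A :: "('a, 'm::fin_dim_inner) atlas" and \<gamma> :: "'k::fin_dim_inner \<Rightarrow> 'n::fin_dim_inner"
  assumes A: "smooth_atlas A" and x: "chart_of A U x" and \<gamma>: "Cinf_on UNIV \<gamma>" "\<And>u. \<gamma> u \<in> x ` U"
  shows "smooth_map std_manifold A (inv_into U x \<circ> \<gamma>)"
proof (rule smooth_mapI[OF smooth_atlas_std A])
  have "smooth_in UNIV (\<lambda>u. u) (x \<circ> (inv_into U x \<circ> \<gamma>))"
    unfolding smooth_in_def using \<gamma> by (intro exI[of _ \<gamma>]) (auto simp: f_inv_into_f)
  moreover have "range (inv_into U x \<circ> \<gamma>) \<subseteq> U"
    using \<gamma>(2) by (auto simp: inv_into_into)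
  ultimately show "\<exists>W (z::'k \<Rightarrow> 'k) V (y::'a \<Rightarrow> 'n). u \<in> W \<and> chart_of std_manifold W z \<and> chart_of A V y \<and>
      (inv_into U x \<circ> \<gamma>) ` W \<subseteq> V \<and> smooth_in W z (y \<circ> (inv_into U x \<circ> \<gamma>))" for u
    using x chart_of_std by (intro exI[of _ UNIV] exI[of _ "\<lambda>u. u"] exI[of _ U] exI[of _ x]) auto
qed

lemma smooth_curve_with_jet:
  fixes A :: "('a, 'm::fin_dim_inner) atlas" and x :: "'a \<Rightarrow> 'n::fin_dim_inner" and X :: "'n^'p::finite"
  assumes A: "smooth_atlas A" and x: "chart_of A U x" and p: "p \<in> U"
  obtains \<xi> :: "real^'p \<Rightarrow> 'a" where "smooth_map std_manifold A \<xi>" "\<xi> 0 = p" "\<And>\<alpha>. partial0 \<alpha> (x \<circ> \<xi>) = X $ \<alpha>"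
proof -
  obtain \<gamma> :: "real^'p \<Rightarrow> 'n" where \<gamma>: "Cinf_on UNIV \<gamma>" "\<gamma> 0 = x p" "\<And>u. \<gamma> u \<in> x ` U" "\<And>\<alpha>. partial0 \<alpha> \<gamma> = X $ \<alpha>"
    using smooth_curve_with_derivative[OF chart_of_open_image[OF x], of "x p" X] p by blast
  have "x \<circ> (inv_into U x \<circ> \<gamma>) = \<gamma>"
    using \<gamma>(3) by (auto simp: f_inv_into_f)
  then show ?thesis
    using that[OF smooth_curve_in_chart[OF A x \<gamma>(1,3)]] \<gamma> chart_of_inj[OF x] p by simp
qed

lemma jet_cong: "jet_equiv A \<phi> \<xi> \<Longrightarrow> jet A \<phi> = jet A \<xi>"
proof -
  assume "jet_equiv A \<phi> \<xi>"
  then have "jet_equiv A \<phi> \<zeta> \<longleftrightarrow> jet_equiv A \<xi> \<zeta>" for \<zeta>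
    unfolding jet_equiv_def by metis
  then show ?thesis unfolding jet_def by simp
qed

lemma jet_equiv_refl: "jet_equiv A \<phi> \<phi>"
  by (simp add: jet_equiv_def)

lemma jet_rep_of_smooth:
  assumes "smooth_map std_manifold A \<phi>"
  shows "smooth_map std_manifold A (jet_rep (jet A \<phi>))" "jet_equiv A \<phi> (jet_rep (jet A \<phi>))"
proof -
  have "\<phi> \<in> jet A \<phi>" using assms by (simp add: jet_def jet_equiv_refl)
  then have "jet_rep (jet A \<phi>) \<in> jet A \<phi>" unfolding jet_rep_def by (rule someI[where P="\<lambda>\<xi>. \<xi> \<in> jet A \<phi>"])
  then show "smooth_map std_manifold A (jet_rep (jet A \<phi>))" "jet_equiv A \<phi> (jet_rep (jet A \<phi>))"
    by (auto simp: jet_def)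
qed

text \<open>
  A map that is smooth only near the origin, such as \<open>pr\<^sub>2 \<circ> \<psi> \<circ> \<Phi>\<close> with a local trivialization \<open>\<psi>\<close>, is
  not itself a member of its jet.  The globally smooth curve with the same coordinates is one.
\<close>

lemma germ_realized:
  assumes A: "smooth_manifold A" and \<phi>: "differentiable_germ A \<phi>"
  obtains \<xi> where "smooth_map std_manifold A \<xi>" "jet_equiv A \<phi> \<xi>"
proof -
  note sA = smooth_manifold_atlas[OF A]
  obtain U x where U: "(U, x) \<in> A" "chart_of A U x" "\<phi> 0 \<in> U"
    using differentiable_germ_points[OF \<phi>] by (rule chart_at[OF sA])
  obtain \<xi> where \<xi>: "smooth_map std_manifold A \<xi>" "\<xi> 0 = \<phi> 0"
      "\<And>\<alpha>. partial0 \<alpha> (x \<circ> \<xi>) = (\<chi> \<alpha>. partial0 \<alpha> (x \<circ> \<phi>)) $ \<alpha>"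
    using smooth_curve_with_jet[OF sA U(2,3), of "\<chi> \<alpha>. partial0 \<alpha> (x \<circ> \<phi>)"] by blast
  have "jet_equiv A \<phi> \<xi>"
    using jet_equiv_iff[OF A U(2,3) \<phi> smooth_map_imp_germ[OF sA \<xi>(1)]] \<xi> by simp
  with \<xi>(1) show ?thesis by (rule that)
qed

lemma
  assumes A: "smooth_manifold A" and \<phi>: "differentiable_germ A \<phi>"
  shows jet_rep_germ_0: "jet_rep (jet A \<phi>) 0 = \<phi> 0"
    and jet_in_jets_over: "jet A \<phi> \<in> jets_over A U \<longleftrightarrow> \<phi> 0 \<in> U"
    and jet_coord_jet: "chart_of A V x \<Longrightarrow> \<phi> 0 \<in> V \<Longrightarrow>
      jet_coord x (jet A \<phi>) = (x (\<phi> 0), \<chi> \<alpha>. partial0 \<alpha> (x \<circ> \<phi>))"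
proof -
  note sA = smooth_manifold_atlas[OF A]
  obtain \<xi> where \<xi>: "smooth_map std_manifold A \<xi>" "jet_equiv A \<phi> \<xi>"
    using A \<phi> by (rule germ_realized)
  note eq = jet_cong[OF \<xi>(2)]
  have sm: "smooth_map std_manifold A (jet_rep (jet A \<phi>))"
    unfolding eq by (rule jet_rep_of_smooth[OF \<xi>(1)])
  have e: "jet_equiv A \<phi> (jet_rep (jet A \<phi>))"
    using jet_rep_of_smooth(2)[OF \<xi>(1)] \<xi>(2) unfolding eq by (auto simp: jet_equiv_def)
  note g = smooth_map_imp_germ[OF sA sm]
  obtain Z z where Z: "(Z, z) \<in> A" "chart_of A Z z" "\<phi> 0 \<in> Z"
    using differentiable_germ_points[OF \<phi>] by (rule chart_at[OF sA])
  show r0: "jet_rep (jet A \<phi>) 0 = \<phi> 0"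
    using jet_equiv_iff[OF A Z(2,3) \<phi> g] e by simp
  have x0: "\<phi> 0 = \<xi> 0"
    using jet_equiv_iff[OF A Z(2,3) \<phi> smooth_map_imp_germ[OF sA \<xi>(1)]] \<xi>(2) by simp
  show "jet A \<phi> \<in> jets_over A U \<longleftrightarrow> \<phi> 0 \<in> U"
  proof
    assume "\<phi> 0 \<in> U"
    then show "jet A \<phi> \<in> jets_over A U" using \<xi>(1) x0 eq by (auto simp: jets_over_def)
  next
    assume "jet A \<phi> \<in> jets_over A U"
    then obtain \<zeta> where \<zeta>: "smooth_map std_manifold A \<zeta>" "\<zeta> 0 \<in> U" "jet A \<phi> = jet A \<zeta>"
      by (auto simp: jets_over_def)
    have "\<zeta> 0 \<in> points A"
      using differentiable_germ_points[OF smooth_map_imp_germ[OF sA \<zeta>(1)]] .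
    then obtain Y y where Y: "(Y, y) \<in> A" "chart_of A Y y" "\<zeta> 0 \<in> Y" by (rule chart_at[OF sA])
    have "\<zeta> 0 = jet_rep (jet A \<zeta>) 0"
      using jet_equiv_iff[OF A Y(2,3) smooth_map_imp_germ[OF sA \<zeta>(1)]
          smooth_map_imp_germ[OF sA jet_rep_of_smooth(1)[OF \<zeta>(1)]]]
        jet_rep_of_smooth(2)[OF \<zeta>(1)] by simp
    then show "\<phi> 0 \<in> U" using \<zeta> r0 by simp
  qed
  show "jet_coord x (jet A \<phi>) = (x (\<phi> 0), \<chi> \<alpha>. partial0 \<alpha> (x \<circ> \<phi>))" if "chart_of A V x" "\<phi> 0 \<in> V"
    using jet_equiv_iff[OF A that \<phi> g] e by (simp add: jet_coord_def)
qed

lemma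
  assumes A: "smooth_manifold A" and j: "j \<in> jets_over A U"
  shows smooth_jet_rep: "smooth_map std_manifold A (jet_rep j)"
    and jet_rep_0: "jet_rep j 0 \<in> U"
    and jet_jet_rep: "jet A (jet_rep j) = j"
    and jet_rep_points: "jet_rep j 0 \<in> points A"
    and germ_jet_rep: "differentiable_germ A (jet_rep j)"
proof -
  note sA = smooth_manifold_atlas[OF A]
  obtain \<phi> where \<phi>: "smooth_map std_manifold A \<phi>" "\<phi> 0 \<in> U" "j = jet A \<phi>"
    using j by (auto simp: jets_over_def)
  show "smooth_map std_manifold A (jet_rep j)"
    unfolding \<phi>(3) by (rule jet_rep_of_smooth[OF \<phi>(1)])
  then show g: "differentiable_germ A (jet_rep j)"
    by (rule smooth_map_imp_germ[OF sA])
  then show "jet_rep j 0 \<in> points A" by (rule differentiable_germ_points)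
  show "jet_rep j 0 \<in> U"
    using jet_rep_germ_0[OF A smooth_map_imp_germ[OF sA \<phi>(1)]] \<phi> by simp
  show "jet A (jet_rep j) = j"
    using jet_cong[OF jet_rep_of_smooth(2)[OF \<phi>(1)]] \<phi>(3) by simp
qed

lemma jets_over_iff:
  assumes A: "smooth_manifold A"
  shows "j \<in> jets_over A U \<longleftrightarrow> j \<in> jets_over A (points A) \<and> jet_rep j 0 \<in> U"
proof
  assume j: "j \<in> jets_over A U"
  then show "j \<in> jets_over A (points A) \<and> jet_rep j 0 \<in> U"
    using jet_in_jets_over[OF A germ_jet_rep[OF A j], of "points A"] jet_jet_rep[OF A j]
      jet_rep_0[OF A j] jet_rep_points[OF A j] by simp
next
  assume j: "j \<in> jets_over A (points A) \<and> jet_rep j 0 \<in> U"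
  then show "j \<in> jets_over A U"
    using jet_in_jets_over[OF A germ_jet_rep[OF A], of j "points A" U] jet_jet_rep[OF A, of j "points A"] by simp
qed

lemma jets_over_Int: "smooth_manifold A \<Longrightarrow> jets_over A (U \<inter> V) = jets_over A U \<inter> jets_over A V"
  using jets_over_iff[of A _ "U \<inter> V"] jets_over_iff[of A _ U] jets_over_iff[of A _ V] by auto

lemma jet_coord_inj:
  fixes A :: "('a, 'm::fin_dim_inner) atlas"
  assumes A: "smooth_manifold A" and x: "chart_of A U x"
  shows "inj_on (jet_coord x) (jets_over A U :: (real^'p::finite \<Rightarrow> 'a) set set)"
proof (rule inj_onI)
  fix j k :: "(real^'p \<Rightarrow> 'a) set" assume j: "j \<in> jets_over A U" and k: "k \<in> jets_over A U" and eq: "jet_coord x j = jet_coord x k"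
  note U = jet_rep_0[OF A j] jet_rep_0[OF A k]
  have "x (jet_rep j 0) = x (jet_rep k 0)" and p: "\<And>\<alpha>. partial0 \<alpha> (x \<circ> jet_rep j) = partial0 \<alpha> (x \<circ> jet_rep k)"
    using eq by (auto simp: jet_coord_def vec_eq_iff)
  then have "jet_rep j 0 = jet_rep k 0"
    using U chart_of_inj[OF x] by (auto dest: inj_onD)
  then have "jet_equiv A (jet_rep j) (jet_rep k)"
    using jet_equiv_iff[OF A x U(1) germ_jet_rep[OF A j] germ_jet_rep[OF A k]] p by simp
  then show "j = k"
    using jet_cong jet_jet_rep[OF A j] jet_jet_rep[OF A k] by metis
qed

lemma jet_coord_image:
  fixes A :: "('a, 'm::fin_dim_inner) atlas" and x :: "'a \<Rightarrow> 'n::fin_dim_inner"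
  assumes A: "smooth_manifold A" and x: "chart_of A U x"
  shows "jet_coord x ` jets_over A U = x ` U \<times> (UNIV :: ('n^'p::finite) set)"
proof (intro set_eqI iffI)
  fix z assume "z \<in> jet_coord x ` jets_over A U"
  then obtain j where "j \<in> jets_over A U" "z = jet_coord x j" by blast
  then show "z \<in> x ` U \<times> UNIV"
    using jet_rep_0[OF A] by (auto simp: jet_coord_def)
next
  note sA = smooth_manifold_atlas[OF A]
  fix z :: "'n \<times> ('n^'p)" assume "z \<in> x ` U \<times> UNIV"
  then obtain p X where p: "p \<in> U" "z = (x p, X)" by auto
  obtain \<xi> where \<xi>: "smooth_map std_manifold A \<xi>" "\<xi> 0 = p" "\<And>\<alpha>. partial0 \<alpha> (x \<circ> \<xi>) = X $ \<alpha>"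
    using smooth_curve_with_jet[OF sA x p(1), of X] by blast
  note g = smooth_map_imp_germ[OF sA \<xi>(1)]
  have "jet_coord x (jet A \<xi>) = z"
    using jet_coord_jet[OF A g x] \<xi> p by (simp add: vec_eq_iff)
  moreover have "jet A \<xi> \<in> jets_over A U"
    using jet_in_jets_over[OF A g] \<xi> p by simp
  ultimately show "z \<in> jet_coord x ` jets_over A U" by blast
qed

text \<open>
  By the chain rule, the change of coordinates on jets is the first prolongation of that on the
  manifold.
\<close>

lemma jet_coord_transition:
  fixes A :: "('a, 'm::fin_dim_inner) atlas" and x :: "'a \<Rightarrow> 'n::fin_dim_inner" and y :: "'a \<Rightarrow> 'k::fin_dim_inner"
  assumes A: "smooth_manifold A" and x: "chart_of A U x" and y: "chart_of A V y"
  shows "open (jet_coord x ` (jets_over A U \<inter> jets_over A V) :: ('n \<times> ('n^'p::finite)) set)"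
    and "smooth_in (jets_over A U \<inter> jets_over A V) (jet_coord x :: (real^'p \<Rightarrow> 'a) set \<Rightarrow> _) (jet_coord y)"
proof -
  note sA = smooth_manifold_atlas[OF A]
  have UV: "chart_of A (U \<inter> V) x"
    by (rule chart_of_Int[OF sA x chart_of_openin[OF sA y]])
  note J = jets_over_Int[OF A, of U V, symmetric] 
  note im = jet_coord_image[OF A UV]
  show "open (jet_coord x ` (jets_over A U \<inter> jets_over A V) :: ('n \<times> ('n^'p)) set)"
    unfolding J im by (intro open_Times chart_of_open_image[OF UV] open_UNIV)
  obtain \<tau> where \<tau>: "Cinf_on (x ` (U \<inter> V)) \<tau>" "\<forall>q\<in>U \<inter> V. y q = \<tau> (x q)"
    using chart_of_transition[OF sA x y] by (auto simp: smooth_in_def)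
  let ?T = "\<lambda>(a, X::'n^'p). (\<tau> a, \<chi> \<alpha>. frechet_derivative \<tau> (at a) (X $ \<alpha>))"
  have "jet_coord y j = ?T (jet_coord x j)" if j: "j \<in> jets_over A (U \<inter> V)" for j :: "(real^'p \<Rightarrow> 'a) set"
  proof -
    have p: "jet_rep j 0 \<in> U \<inter> V" by (rule jet_rep_0[OF A j])
    show ?thesis
      using \<tau>(2) p partial0_coordinates[OF sA germ_jet_rep[OF A j] UV p \<tau>(1), of y]
      by (simp add: jet_coord_def)
  qed
  then show "smooth_in (jets_over A U \<inter> jets_over A V) (jet_coord x :: (real^'p \<Rightarrow> 'a) set \<Rightarrow> _) (jet_coord y)"
    unfolding J smooth_in_def im
    using Cinf_on_prolongation[OF chart_of_open_image[OF UV] \<tau>(1)] by blast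
qed

lemma points_jet_manifold:
  fixes A :: "('a, 'm::fin_dim_inner) atlas"
  assumes A: "smooth_manifold A"
  shows "points (jet_manifold A) = (jets_over A (points A) :: (real^'p::finite \<Rightarrow> 'a) set set)"
proof -
  note sA = smooth_manifold_atlas[OF A]
  have "j \<in> jets_over A (points A) \<longleftrightarrow> (\<exists>(U, x)\<in>charts A. j \<in> jets_over A U)" for j :: "(real^'p \<Rightarrow> 'a) set"
  proof
    assume j: "j \<in> jets_over A (points A)"
    obtain U x where U: "(U, x) \<in> A" "chart_of A U x" "jet_rep j 0 \<in> U"
      using jet_rep_points[OF A j] by (rule chart_at[OF sA])
    then have "j \<in> jets_over A U" using j jets_over_iff[OF A] by blast
    then show "\<exists>(U, x)\<in>charts A. j \<in> jets_over A U"
      using U by (auto simp: charts_eq[OF sA])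
  next
    assume "\<exists>(U, x)\<in>charts A. j \<in> jets_over A U"
    then show "j \<in> jets_over A (points A)"
      using jets_over_iff[OF A] by blast
  qed
  then show ?thesis
    unfolding jet_manifold_def by (intro set_eqI) (simp add: points_eq_Union[of "_ ` _"] split_beta image_image)
qed

lemma jet_manifold_memberE:
  assumes "smooth_manifold A" "c \<in> jet_manifold A"
  obtains U x where "c = (jets_over A U, jet_coord x)" "chart_of A U x"
  using assms charts_eq[OF smooth_manifold_atlas[OF assms(1)]] unfolding jet_manifold_def by auto

lemma smooth_atlas_jet_manifold:
  fixes A :: "('a, 'm::fin_dim_inner) atlas"
  assumes A: "smooth_manifold A"
  shows "smooth_atlas (jet_manifold A :: ((real^'p::finite \<Rightarrow> 'a) set, _) atlas)"
proof (rule smooth_atlasI)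
  fix J X assume "(J, X) \<in> (jet_manifold A :: ((real^'p \<Rightarrow> 'a) set, _) atlas)"
  then obtain U x where U: "J = jets_over A U" "X = jet_coord x" "chart_of A U x"
    using jet_manifold_memberE[OF A] by (metis prod.inject)
  then show "inj_on X J \<and> open (X ` J)"
    using jet_coord_inj[OF A U(3)] jet_coord_transition(1)[OF A U(3,3)] by simp
  fix K Y assume "(K, Y) \<in> (jet_manifold A :: ((real^'p \<Rightarrow> 'a) set, _) atlas)"
  then obtain V y where V: "K = jets_over A V" "Y = jet_coord y" "chart_of A V y"
    using jet_manifold_memberE[OF A] by (metis prod.inject)
  show "open (X ` (J \<inter> K)) \<and> smooth_in (J \<inter> K) X Y"
    using jet_coord_transition[OF A U(3) V(3)] U V by simp
qed

lemma chart_of_jet_manifold: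
  fixes A :: "('a, 'm::fin_dim_inner) atlas"
  assumes A: "smooth_manifold A" and x: "chart_of A U x"
  shows "chart_of (jet_manifold A) (jets_over A U :: (real^'p::finite \<Rightarrow> 'a) set set) (jet_coord x)"
proof -
  have inj: "inj_on (jet_coord x) (jets_over A U :: (real^'p \<Rightarrow> 'a) set set)"
    by (rule jet_coord_inj[OF A x])
  have "compatible c (jets_over A U, jet_coord x) \<and> compatible (jets_over A U, jet_coord x) c"
    if c: "c \<in> (jet_manifold A :: ((real^'p \<Rightarrow> 'a) set, _) atlas)" for c
  proof -
    obtain V y where V: "c = (jets_over A V, jet_coord y)" "chart_of A V y"
      using A c by (rule jet_manifold_memberE)
    show ?thesis
      unfolding V(1) compatible_iff[OF inj] compatible_iff[OF jet_coord_inj[OF A V(2)]]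
      using jet_coord_transition[OF A x V(2)] jet_coord_transition[OF A V(2) x] by blast
  qed
  moreover have "jets_over A U \<subseteq> points (jet_manifold A :: ((real^'p \<Rightarrow> 'a) set, _) atlas)"
    unfolding points_jet_manifold[OF A] using jets_over_iff[OF A] by blast
  ultimately show ?thesis
    using inj jet_coord_transition(1)[OF A x x] by (auto simp: chart_of_def)
qed

lemma openin_jets_over:
  fixes A :: "('a, 'm::fin_dim_inner) atlas"
  assumes A: "smooth_manifold A" and W: "openin (mtopology A) W"
  shows "openin (mtopology (jet_manifold A)) (jets_over A W :: (real^'p::finite \<Rightarrow> 'a) set set)"
proof (subst openin_subopen, intro ballI)
  note sA = smooth_manifold_atlas[OF A]
  fix j :: "(real^'p \<Rightarrow> 'a) set" assume j: "j \<in> jets_over A W"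
  obtain U x where U: "(U, x) \<in> A" "chart_of A U x" "jet_rep j 0 \<in> U"
    using jet_rep_points[OF A j] by (rule chart_at[OF sA])
  have "openin (mtopology (jet_manifold A)) (jets_over A (U \<inter> W) :: (real^'p \<Rightarrow> 'a) set set)"
    by (rule chart_of_openin[OF smooth_atlas_jet_manifold[OF A]
          chart_of_jet_manifold[OF A chart_of_Int[OF sA U(2) W]]])
  moreover have "j \<in> jets_over A (U \<inter> W)"
    using j U(3) jets_over_iff[OF A] by blast
  ultimately show "\<exists>T. openin (mtopology (jet_manifold A)) T \<and> j \<in> T \<and> T \<subseteq> jets_over A W"
    using jets_over_Int[OF A, of U W] by blast
qed

text \<open>
  Jets at different points are separated by neighbourhoods of these points, and jets at the same point
  lie in one chart.
\<close>

lemma smooth_manifold_jet_manifold: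
  fixes A :: "('a, 'm::fin_dim_inner) atlas"
  assumes A: "smooth_manifold A"
  shows "smooth_manifold (jet_manifold A :: ((real^'p::finite \<Rightarrow> 'a) set, _) atlas)"
proof -
  note sA = smooth_manifold_atlas[OF A]
  let ?J = "jet_manifold A :: ((real^'p \<Rightarrow> 'a) set, _) atlas"
  note sJ = smooth_atlas_jet_manifold[OF A]
  have "Hausdorff_space (mtopology ?J)"
  proof (rule Hausdorff_mtopologyI[OF sJ])
    fix j k assume "j \<in> points ?J" "k \<in> points ?J"
    then have j: "j \<in> jets_over A (points A)" and k: "k \<in> jets_over A (points A)"
      unfolding points_jet_manifold[OF A] by auto
    show "(\<exists>U V. openin (mtopology ?J) U \<and> openin (mtopology ?J) V \<and> j \<in> U \<and> k \<in> V \<and> disjnt U V) \<or>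
      (\<exists>U (x :: (real^'p \<Rightarrow> 'a) set \<Rightarrow> 'm \<times> ('m^'p)). chart_of ?J U x \<and> j \<in> U \<and> k \<in> U)"
    proof (cases "jet_rep j 0 = jet_rep k 0")
      case True
      obtain U x where U: "(U, x) \<in> A" "chart_of A U x" "jet_rep j 0 \<in> U"
        using jet_rep_points[OF A j] by (rule chart_at[OF sA])
      have "j \<in> jets_over A U" "k \<in> jets_over A U"
        using U True j k jets_over_iff[OF A, of j U] jets_over_iff[OF A, of k U] by auto
      then show ?thesis using chart_of_jet_manifold[OF A U(2)] by blast
    next
      case False
      then obtain U V where UV: "openin (mtopology A) U" "openin (mtopology A) V"
          "jet_rep j 0 \<in> U" "jet_rep k 0 \<in> V" "disjnt U V"
        using A jet_rep_points[OF A j] jet_rep_points[OF A k]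
        unfolding smooth_manifold_def Hausdorff_space_def topspace_mtopology[OF sA] by metis
      have "disjnt (jets_over A U) (jets_over A V :: (real^'p \<Rightarrow> 'a) set set)"
        using UV(5) jet_rep_0[OF A] unfolding disjnt_iff by metis
      then show ?thesis
        using openin_jets_over[OF A UV(1)] openin_jets_over[OF A UV(2)] j k UV(3,4) jets_over_iff[OF A] by blast
    qed
  qed
  moreover have "second_countable (mtopology ?J)"
  proof -
    obtain D where D: "D \<subseteq> A" "countable D" "points D = points A"
      using A countable_subatlas[OF sA _ smooth_atlas_chart[OF sA] refl] unfolding smooth_manifold_def by blast
    let ?D = "(\<lambda>(U, x). (jets_over A U :: (real^'p \<Rightarrow> 'a) set set, jet_coord x)) ` D"
    show ?thesis
    proof (rule second_countable_mtopologyI[OF sJ])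
      show "countable ?D" using D(2) by simp
      show "chart_of ?J V y" if "(V, y) \<in> ?D" for V y
        using that D(1) chart_of_jet_manifold[OF A smooth_atlas_chart[OF sA]] by auto
      show "points ?J \<subseteq> points ?D"
      proof
        fix j assume "j \<in> points ?J"
        then have j: "j \<in> jets_over A (points A)" by (simp add: points_jet_manifold[OF A])
        then have "jet_rep j 0 \<in> points D"
          using jet_rep_points[OF A j] D(3) by simp
        then obtain U x where U: "(U, x) \<in> D" "jet_rep j 0 \<in> U"
          unfolding points_def by blast
        then have "j \<in> jets_over A U" using j jets_over_iff[OF A] by blast
        then show "j \<in> points ?D" using U(1) by (force simp: points_def)
      qed
    qed
  qed
  ultimately show ?thesis using sJ by (simp add: smooth_manifold_def)
qed

section \<open>Vector spaces\<close>

text \<open>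
  Transport of structure along a bijection \<open>T\<close> to a vector space.
\<close>

lemma vector_space_onI:
  fixes T :: "'a \<Rightarrow> 'v::real_vector"
  assumes bij: "bij_betw T S UNIV"
    and add: "\<And>v w. v \<in> S \<Longrightarrow> w \<in> S \<Longrightarrow> add v w \<in> S \<and> T (add v w) = T v + T w"
    and scl: "\<And>r v. v \<in> S \<Longrightarrow> scl r v \<in> S \<and> T (scl r v) = r *\<^sub>R T v"
  shows "vector_space_on S add scl"
proof -
  have inj: "v = w" if "T v = T w" "v \<in> S" "w \<in> S" for v w
    using bij that by (auto simp: bij_betw_def dest: inj_onD)
  have surj: "\<exists>v\<in>S. T v = z" for z
    using bij by (auto simp: bij_betw_def image_iff) (metis UNIV_I imageE)
  obtain z where z: "z \<in> S" "T z = 0" using surj by blast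
  have neg: "\<exists>w\<in>S. add v w = z" if v: "v \<in> S" for v
  proof -
    obtain w where "w \<in> S" "T w = - T v" using surj by blast
    then show ?thesis using v z add[of v w] by (intro bexI[of _ w] inj) auto
  qed
  have zero: "\<exists>z\<in>S. \<forall>v\<in>S. add z v = v \<and> (\<exists>w\<in>S. add v w = z)"
  proof (rule bexI[OF _ z(1)], intro ballI conjI)
    fix v assume v: "v \<in> S"
    then show "add z v = v" using add[OF z(1), of v] z(2) by (intro inj) auto
    show "\<exists>w\<in>S. add v w = z" by (rule neg[OF v])
  qed
  show ?thesis
    unfolding vector_space_on_def
    by (intro conjI allI ballI zero inj) (simp_all add: add scl algebra_simps)
qed

lemma smooth_manifold_std: "smooth_manifold (std_manifold :: ('v::fin_dim_inner, 'v) atlas)"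
proof -
  have "second_countable (mtopology (std_manifold :: ('v, 'v) atlas))"
    by (rule second_countable_mtopologyI[OF smooth_atlas_std, of std_manifold])
      (auto simp: std_manifold_def intro: smooth_atlas_chart[OF smooth_atlas_std, unfolded std_manifold_def])
  moreover have "Hausdorff_space (mtopology (std_manifold :: ('v, 'v) atlas))"
    by (rule Hausdorff_mtopologyI[OF smooth_atlas_std]) (use chart_of_std in blast)
  ultimately show ?thesis
    by (simp add: smooth_manifold_def smooth_atlas_std)
qed

lemma smooth_vspace_std: "smooth_vspace (std_vspace :: ('v::fin_dim_inner, 'v) vspace)"
proof -
  have "linear_coords std_vspace (\<lambda>v::'v. v)"
    unfolding linear_coords_def std_vspace_def
    using chart_of_std by (simp add: points_std charts_eq[OF smooth_atlas_std])
  moreover have "vector_space_on (UNIV :: 'v set) (+) (*\<^sub>R)"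
    by (rule vector_space_onI[of "\<lambda>v. v"]) (auto simp: bij_betw_def)
  ultimately show ?thesis
    unfolding smooth_vspace_def using smooth_manifold_std
    by (auto simp: std_vspace_def points_std)
qed

lemma linear_coordsD:
  assumes "smooth_vspace V" "linear_coords V y"
  shows "chart_of (vman V) (points (vman V)) y" "y ` points (vman V) = UNIV"
    and "\<And>v w. v \<in> points (vman V) \<Longrightarrow> w \<in> points (vman V) \<Longrightarrow> y (vadd V v w) = y v + y w"
    and "\<And>r v. v \<in> points (vman V) \<Longrightarrow> y (vscale V r v) = r *\<^sub>R y v"
  using assms charts_eq[OF smooth_manifold_atlas, of "vman V"]
  by (auto simp: linear_coords_def smooth_vspace_def)

lemma smooth_vspaceD:
  assumes "smooth_vspace V"
  shows "smooth_manifold (vman V)"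
    and "\<And>v w. v \<in> points (vman V) \<Longrightarrow> w \<in> points (vman V) \<Longrightarrow> vadd V v w \<in> points (vman V)"
    and "\<And>r v. v \<in> points (vman V) \<Longrightarrow> vscale V r v \<in> points (vman V)"
  using assms by (auto simp: smooth_vspace_def vector_space_on_def)

text \<open>
  The operations are pointwise on representatives and \<open>y\<close> is linear, so evaluation and
  differentiation at the origin commute with them.
\<close>

lemma jet_vspace_coords:
  fixes V :: "('f, 'k::fin_dim_inner) vspace" and j j' :: "(real^'p::finite \<Rightarrow> 'f) set"
  assumes V: "smooth_vspace V" and y: "linear_coords V y"
    and j: "j \<in> points (jet_manifold (vman V))"
  shows "j' \<in> points (jet_manifold (vman V)) \<Longrightarrow>
      vadd (jet_vspace V) j j' \<in> points (jet_manifold (vman V)) \<and>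
      jet_coord y (vadd (jet_vspace V) j j') = jet_coord y j + jet_coord y j'"
    and "vscale (jet_vspace V) r j \<in> points (jet_manifold (vman V)) \<and>
      jet_coord y (vscale (jet_vspace V) r j) = r *\<^sub>R jet_coord y j"
proof -
  let ?F = "vman V"
  note A = smooth_vspaceD(1)[OF V]
  note sA = smooth_manifold_atlas[OF A]
  note P = points_jet_manifold[OF A]
  note yV = linear_coordsD[OF V y]
  have pts: "jet_rep k u \<in> points ?F" if "k \<in> jets_over ?F (points ?F)" for k and u :: "real^'p"
    using smooth_map_points[OF smooth_atlas_std sA smooth_jet_rep[OF A that], of u] by (simp add: points_std)
  have dif: "(y \<circ> jet_rep k) differentiable (at 0)" if "k \<in> jets_over ?F (points ?F)" for k :: "(real^'p \<Rightarrow> 'f) set"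
    by (rule differentiable_germD(2)[OF sA germ_jet_rep[OF A that] yV(1) jet_rep_points[OF A that]])
  have j: "j \<in> jets_over ?F (points ?F)" using j by (simp add: P)
  have jet: "jet ?F \<phi> \<in> points (jet_manifold ?F) \<and> jet_coord y (jet ?F \<phi>) = (y (\<phi> 0), \<chi> \<alpha>. partial0 \<alpha> (y \<circ> \<phi>))"
    if "\<And>u. \<phi> u \<in> points ?F" "(y \<circ> \<phi>) differentiable (at 0)" for \<phi> :: "real^'p \<Rightarrow> 'f"
  proof -
    have "differentiable_germ ?F \<phi>"
      by (rule differentiable_germI[where U="points ?F" and x=y]) (use sA yV(1) that in auto)
    then show ?thesis
      using jet_in_jets_over[OF A, of \<phi> "points ?F"] jet_coord_jet[OF A, of \<phi> "points ?F" y] yV(1) that(1) by (simp add: P)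
  qed
  show "vadd (jet_vspace V) j j' \<in> points (jet_manifold ?F) \<and>
      jet_coord y (vadd (jet_vspace V) j j') = jet_coord y j + jet_coord y j'"
    if "j' \<in> points (jet_manifold ?F)"
  proof -
    have j': "j' \<in> jets_over ?F (points ?F)" using that by (simp add: P)
    let ?\<phi> = "\<lambda>u. vadd V (jet_rep j u) (jet_rep j' u)"
    have e: "y \<circ> ?\<phi> = (\<lambda>u. (y \<circ> jet_rep j) u + (y \<circ> jet_rep j') u)"
      using yV(3) pts j j' by auto
    have "(y \<circ> ?\<phi>) differentiable (at 0)"
      unfolding e using dif[OF j] dif[OF j'] by (rule differentiable_add)
    from jet[OF _ this] show ?thesis
      using smooth_vspaceD(2)[OF V pts[OF j] pts[OF j']] e partial0_add[OF dif[OF j] dif[OF j']]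
        yV(3)[OF pts[OF j] pts[OF j']]
      by (simp add: jet_vspace_def jet_coord_def vec_eq_iff)
  qed
  show "vscale (jet_vspace V) r j \<in> points (jet_manifold ?F) \<and>
      jet_coord y (vscale (jet_vspace V) r j) = r *\<^sub>R jet_coord y j"
  proof -
    let ?\<phi> = "\<lambda>u. vscale V r (jet_rep j u)"
    have e: "y \<circ> ?\<phi> = (\<lambda>u. r *\<^sub>R (y \<circ> jet_rep j) u)"
      using yV(4) pts j by auto
    have "(y \<circ> ?\<phi>) differentiable (at 0)"
      unfolding e using dif[OF j] by (intro differentiable_scaleR differentiable_const)
    from jet[OF _ this] show ?thesis
      using smooth_vspaceD(3)[OF V pts[OF j]] e partial0_linear[OF dif[OF j] bounded_linear_scaleR_right[of r]]
        yV(4)[OF pts[OF j]]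
      by (simp add: jet_vspace_def jet_coord_def vec_eq_iff)
  qed
qed

lemma bij_jet_coord_linear:
  fixes V :: "('f, 'k::fin_dim_inner) vspace"
  assumes V: "smooth_vspace V" and y: "linear_coords V y"
  shows "bij_betw (jet_coord y) (points (jet_manifold (vman V)) :: (real^'p::finite \<Rightarrow> 'f) set set) UNIV"
  using jet_coord_inj[OF smooth_vspaceD(1)[OF V] linear_coordsD(1)[OF V y]]
    jet_coord_image[OF smooth_vspaceD(1)[OF V] linear_coordsD(1)[OF V y]]
  by (simp add: bij_betw_def points_jet_manifold[OF smooth_vspaceD(1)[OF V]] linear_coordsD(2)[OF V y])

lemma
  fixes V :: "('f, 'k::fin_dim_inner) vspace"
  assumes V: "smooth_vspace V"
  shows smooth_vspace_jet: "smooth_vspace (jet_vspace V :: ((real^'p::finite \<Rightarrow> 'f) set, _) vspace)"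
    and linear_coords_jet: "linear_coords V y \<Longrightarrow>
      linear_coords (jet_vspace V) (jet_coord y :: (real^'p \<Rightarrow> 'f) set \<Rightarrow> _)"
proof -
  note A = smooth_vspaceD(1)[OF V]
  have man: "vman (jet_vspace V) = (jet_manifold (vman V) :: ((real^'p \<Rightarrow> 'f) set, _) atlas)"
    by (simp add: jet_vspace_def)
  show lin: "linear_coords (jet_vspace V) (jet_coord y :: (real^'p \<Rightarrow> 'f) set \<Rightarrow> _)" if y: "linear_coords V y" for y
    unfolding linear_coords_def man
    using chart_of_jet_manifold[OF A linear_coordsD(1)[OF V y]] bij_jet_coord_linear[OF V y]
      jet_vspace_coords[OF V y]
    by (auto simp: charts_eq[OF smooth_atlas_jet_manifold[OF A]] points_jet_manifold[OF A] bij_betw_def)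
  obtain y where y: "linear_coords V y"
    using V by (auto simp: smooth_vspace_def)
  have "vector_space_on (points (jet_manifold (vman V)) :: (real^'p \<Rightarrow> 'f) set set)
      (vadd (jet_vspace V)) (vscale (jet_vspace V))"
    by (rule vector_space_onI[OF bij_jet_coord_linear[OF V y]]) (use jet_vspace_coords[OF V y] in auto)
  then show "smooth_vspace (jet_vspace V :: ((real^'p \<Rightarrow> 'f) set, _) vspace)"
    unfolding smooth_vspace_def man using smooth_manifold_jet_manifold[OF A] lin[OF y] by blast
qed

section \<open>Bundle charts\<close>

text \<open>
  The coordinates \<open>(x\<^sub>i \<circ> \<pi>, y\<^sub>j \<circ> pr\<^sub>2 \<circ> \<psi>)\<close> of the total manifold over the domain of \<open>x\<close>.
\<close>

definition bundle_coord :: "('a, 't, 'c, 'm, 'f, 'k) vbundle \<Rightarrow> ('c \<Rightarrow> 'm) \<Rightarrow> ('a \<Rightarrow> 'c \<times> 'f) \<Rightarrow> ('f \<Rightarrow> 'k) \<Rightarrow> 'a \<Rightarrow> 'm \<times> 'k" where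
  "bundle_coord B x \<psi> y e = (x (proj B e), y (snd (\<psi> e)))"

locale smooth_bundle =
  fixes B :: "('a, 't::fin_dim_inner, 'c, 'm::fin_dim_inner, 'f, 'k::fin_dim_inner) vbundle"
  assumes bundle_axioms: "smooth_vector_bundle B"
begin

abbreviation "E \<equiv> total_man B"
abbreviation "M \<equiv> base_man B"
abbreviation "F \<equiv> vman (fibre B)"

lemma manifold_E: "smooth_manifold E" and manifold_M: "smooth_manifold M" and vspace_F: "smooth_vspace (fibre B)"
  and smooth_proj: "smooth_map E M (proj B)"
  using bundle_axioms by (auto simp: smooth_vector_bundle_def)

lemmas atlas_E = smooth_manifold_atlas[OF manifold_E]
  and atlas_M = smooth_manifold_atlas[OF manifold_M]
  and manifold_F = smooth_vspaceD(1)[OF vspace_F]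
lemmas atlas_F = smooth_manifold_atlas[OF manifold_F]

lemma proj_points: "e \<in> points E \<Longrightarrow> proj B e \<in> points M"
  by (rule smooth_map_points[OF atlas_E atlas_M smooth_proj])

lemma openin_over: "openin (mtopology M) U \<Longrightarrow> openin (mtopology E) (over B U)"
proof -
  assume U: "openin (mtopology M) U"
  have "over B U = points E \<inter> proj B -` U" by (auto simp: over_def)
  then show ?thesis
    using smooth_map_openin[OF atlas_E smooth_proj openin_topspace U] by (simp add: topspace_mtopology[OF atlas_E])
qed

lemma badd_in_fibre:
  assumes "e \<in> points E" "e' \<in> points E" "proj B e = proj B e'"
  shows "badd B e e' \<in> points E" "proj B (badd B e e') = proj B e"
proof -
  have "vector_space_on (over B {proj B e}) (badd B) (bscale B)"
    using bundle_axioms proj_points[OF assms(1)] by (auto simp: smooth_vector_bundle_def)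
  moreover have "e \<in> over B {proj B e}" "e' \<in> over B {proj B e}"
    using assms by (auto simp: over_def)
  ultimately have "badd B e e' \<in> over B {proj B e}"
    unfolding vector_space_on_def by blast
  then show "badd B e e' \<in> points E" "proj B (badd B e e') = proj B e"
    by (auto simp: over_def)
qed

lemma bscale_in_fibre:
  assumes "e \<in> points E"
  shows "bscale B r e \<in> points E" "proj B (bscale B r e) = proj B e"
proof -
  have "vector_space_on (over B {proj B e}) (badd B) (bscale B)"
    using bundle_axioms proj_points[OF assms(1)] by (auto simp: smooth_vector_bundle_def)
  moreover have "e \<in> over B {proj B e}"
    using assms by (auto simp: over_def)
  ultimately have "bscale B r e \<in> over B {proj B e}"
    unfolding vector_space_on_def by blast
  then show "bscale B r e \<in> points E" "proj B (bscale B r e) = proj B e"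
    by (auto simp: over_def)
qed

lemma points_trivial:
  assumes "openin (mtopology M) U"
  shows "points (prod_manifold (open_submanifold M U) F) = U \<times> points F"
    and "smooth_atlas (prod_manifold (open_submanifold M U) F)"
    and "points (open_submanifold E (over B U)) = over B U"
    and "smooth_atlas (open_submanifold E (over B U))"
  using points_open_submanifold[OF atlas_M assms] points_open_submanifold[OF atlas_E openin_over[OF assms]]
    smooth_atlas_open_submanifold[OF atlas_M assms] smooth_atlas_open_submanifold[OF atlas_E openin_over[OF assms]]
    smooth_atlas_prod_manifold[OF _ atlas_F]
  by (simp_all add: points_prod_manifold)

lemma trivializationD:
  assumes \<psi>: "local_trivialization B U \<psi>"
  shows "openin (mtopology M) U"
    and "\<And>e. e \<in> over B U \<Longrightarrow> \<psi> e = (proj B e, snd (\<psi> e))"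
    and "\<And>e. e \<in> over B U \<Longrightarrow> snd (\<psi> e) \<in> points F"
    and "bij_betw \<psi> (over B U) (U \<times> points F)"
proof -
  show U: "openin (mtopology M) U"
    using \<psi> by (simp add: local_trivialization_def)
  show "\<psi> e = (proj B e, snd (\<psi> e))" if "e \<in> over B U" for e
    using \<psi> that by (auto simp: local_trivialization_def prod_eq_iff)
  show bij: "bij_betw \<psi> (over B U) (U \<times> points F)"
    using \<psi> points_trivial[OF U] by (simp add: local_trivialization_def diffeomorphism_def)
  show "snd (\<psi> e) \<in> points F" if "e \<in> over B U" for e
    using bij_betwE[OF bij] that by (auto simp: mem_Times_iff)
qed

lemma trivialization_linear:
  assumes \<psi>: "local_trivialization B U \<psi>" and y: "linear_coords (fibre B) y"
    and e: "e \<in> over B U" "e' \<in> over B U" "proj B e = proj B e'"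
  shows "badd B (bscale B r e) (bscale B s e') \<in> over B U"
    and "proj B (badd B (bscale B r e) (bscale B s e')) = proj B e"
    and "y (snd (\<psi> (badd B (bscale B r e) (bscale B s e')))) = r *\<^sub>R y (snd (\<psi> e)) + s *\<^sub>R y (snd (\<psi> e'))"
proof -
  have p: "e \<in> points E" "e' \<in> points E" using e by (auto simp: over_def)
  have "proj B (bscale B r e) = proj B (bscale B s e')"
    using bscale_in_fibre(2)[OF p(1)] bscale_in_fibre(2)[OF p(2)] e(3) by simp
  note b = bscale_in_fibre(1)[OF p(1), of r] bscale_in_fibre(1)[OF p(2), of s] this
  note a = badd_in_fibre[OF b]
  show "proj B (badd B (bscale B r e) (bscale B s e')) = proj B e"
    using a(2) bscale_in_fibre(2)[OF p(1)] by simp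
  then show "badd B (bscale B r e) (bscale B s e') \<in> over B U"
    using a(1) e(1) by (simp add: over_def)
  have o: "bscale B r e \<in> over B U" "bscale B s e' \<in> over B U"
    using bscale_in_fibre[OF p(1)] bscale_in_fibre[OF p(2)] e by (auto simp: over_def)
  have "snd (\<psi> (badd B (bscale B r e) (bscale B s e'))) =
      vadd (fibre B) (vscale (fibre B) r (snd (\<psi> e))) (vscale (fibre B) s (snd (\<psi> e')))"
    using \<psi> o b(3) e unfolding local_trivialization_def by simp
  then show "y (snd (\<psi> (badd B (bscale B r e) (bscale B s e')))) = r *\<^sub>R y (snd (\<psi> e)) + s *\<^sub>R y (snd (\<psi> e'))"
    using linear_coordsD(3,4)[OF vspace_F y] smooth_vspaceD(3)[OF vspace_F] trivializationD(3)[OF \<psi>] e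
    by simp
qed

text \<open>
  The product chart \<open>(x, y)\<close> is pulled back along \<open>\<psi>\<close>.  Since \<open>U'\<close> may be larger than \<open>U\<close>, this yields bundle
  charts over the domain of a chart of the base from a trivialization over another open set.
\<close>

lemma chart_of_bundle_coord:
  assumes x: "chart_of M U x" and \<psi>: "local_trivialization B U' \<psi>" and UU: "U \<subseteq> U'" and y: "linear_coords (fibre B) y"
  shows "chart_of E (over B U) (bundle_coord B x \<psi> y)"
    and "bundle_coord B x \<psi> y ` over B U = x ` U \<times> UNIV"
proof -
  note U' = trivializationD(1)[OF \<psi>]
  let ?S = "open_submanifold E (over B U')" and ?P = "prod_manifold (open_submanifold M U') F"
  note P = points_trivial[OF U']
  have "chart_of (open_submanifold M U') U x"
    using x UU by (simp add: chart_of_open_submanifold[OF atlas_M U'])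
  then have c: "chart_of ?P (U \<times> points F) (map_prod x y)"
    by (rule chart_of_prod_manifold[OF _ linear_coordsD(1)[OF vspace_F y]
          smooth_atlas_open_submanifold[OF atlas_M U'] atlas_F])
  have d: "diffeomorphism ?S ?P \<psi>"
    using \<psi> by (simp add: local_trivialization_def)
  have O: "points ?S \<inter> \<psi> -` (U \<times> points F) = over B U"
  proof (intro set_eqI iffI)
    fix e assume e: "e \<in> points ?S \<inter> \<psi> -` (U \<times> points F)"
    then have "\<psi> e = (proj B e, snd (\<psi> e))" "e \<in> points E" "\<psi> e \<in> U \<times> points F"
      using trivializationD(2)[OF \<psi>] P(3) by (auto simp: over_def)
    then show "e \<in> over B U"
      unfolding over_def by (metis (mono_tags, lifting) mem_Collect_eq mem_Sigma_iff)
  next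
    fix e assume e: "e \<in> over B U"
    then have e': "e \<in> over B U'" using UU by (auto simp: over_def)
    then have "\<psi> e = (proj B e, snd (\<psi> e))" "snd (\<psi> e) \<in> points F"
      using trivializationD(2,3)[OF \<psi>] by auto
    then have "\<psi> e \<in> U \<times> points F"
      using e by (metis (mono_tags, lifting) mem_Collect_eq mem_Sigma_iff over_def)
    then show "e \<in> points ?S \<inter> \<psi> -` (U \<times> points F)"
      using e' P(3) by simp
  qed
  have eq: "(map_prod x y \<circ> \<psi>) e = bundle_coord B x \<psi> y e" if "e \<in> over B U" for e
  proof -
    have "e \<in> over B U'" using that UU by (auto simp: over_def)
    then have "fst (\<psi> e) = proj B e" using trivializationD(2)[OF \<psi>] by (metis fst_conv)
    then show ?thesis by (simp add: bundle_coord_def map_prod_def split_beta)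
  qed
  have "chart_of ?S (over B U) (map_prod x y \<circ> \<psi>)"
    using chart_of_pullback[OF P(4,2) d c] O by simp
  then have "chart_of E (over B U) (map_prod x y \<circ> \<psi>)"
    by (simp add: chart_of_open_submanifold[OF atlas_E openin_over[OF U']])
  then show "chart_of E (over B U) (bundle_coord B x \<psi> y)"
    by (rule chart_of_cong[OF atlas_E]) (rule eq)
  have "\<psi> ` over B U = U \<times> points F"
  proof -
    have "\<psi> ` points ?S = U' \<times> points F"
      using trivializationD(4)[OF \<psi>] P(3) by (simp add: bij_betw_def)
    moreover have "\<psi> ` (points ?S \<inter> \<psi> -` (U \<times> points F)) = \<psi> ` points ?S \<inter> U \<times> points F" by blast
    ultimately show ?thesis using O UU by auto
  qed
  moreover have "bundle_coord B x \<psi> y ` over B U = map_prod x y ` \<psi> ` over B U"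
    using eq by (auto simp: image_comp image_iff)
  ultimately show "bundle_coord B x \<psi> y ` over B U = x ` U \<times> UNIV"
    using linear_coordsD(2)[OF vspace_F y] by (simp add: map_prod_image)
qed

lemma local_trivialization_restrict:
  fixes x :: "'c \<Rightarrow> 'm"
  assumes x: "chart_of M U x" and \<psi>: "local_trivialization B U' \<psi>" and UU: "U \<subseteq> U'"
  shows "local_trivialization B U \<psi>"
proof -
  obtain y where y: "linear_coords (fibre B) y"
    using vspace_F by (auto simp: smooth_vspace_def)
  note U = chart_of_openin[OF atlas_M x]
  note P = points_trivial[OF U]
  note c = chart_of_bundle_coord[OF x \<psi> UU y]
  have sub: "over B U \<subseteq> over B U'" using UU by (auto simp: over_def)
  have "diffeomorphism (open_submanifold E (over B U)) (prod_manifold (open_submanifold M U) F) \<psi>"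
  proof (rule diffeomorphismI_global_charts[OF P(4,2)])
    show "chart_of (open_submanifold E (over B U)) (points (open_submanifold E (over B U))) (bundle_coord B x \<psi> y)"
      unfolding P(3) chart_of_open_submanifold[OF atlas_E openin_over[OF U]] using c(1) by simp
    have "chart_of (open_submanifold M U) U x"
      using x by (simp add: chart_of_open_submanifold[OF atlas_M U])
    then show "chart_of (prod_manifold (open_submanifold M U) F)
        (points (prod_manifold (open_submanifold M U) F)) (map_prod x y)"
      unfolding P(1)
      by (rule chart_of_prod_manifold[OF _ linear_coordsD(1)[OF vspace_F y]
          smooth_atlas_open_submanifold[OF atlas_M U] atlas_F])
    show "map_prod x y ` points (prod_manifold (open_submanifold M U) F) \<subseteq>
        bundle_coord B x \<psi> y ` points (open_submanifold E (over B U))"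
      unfolding P c(2) by (auto simp: map_prod_image)
    fix e assume "e \<in> points (open_submanifold E (over B U))"
    then have e: "e \<in> over B U" "e \<in> over B U'" using P(3) sub by auto
    have "\<psi> e = (proj B e, snd (\<psi> e))" "snd (\<psi> e) \<in> points F" "proj B e \<in> U"
      using trivializationD(2,3)[OF \<psi> e(2)] e(1) by (auto simp: over_def)
    then show "\<psi> e \<in> points (prod_manifold (open_submanifold M U) F) \<and> map_prod x y (\<psi> e) = bundle_coord B x \<psi> y e"
      unfolding P(1) bundle_coord_def by (metis map_prod_simp mem_Sigma_iff)
  qed
  moreover have "(\<forall>e\<in>over B U. fst (\<psi> e) = proj B e) \<and>
     (\<forall>e\<in>over B U. \<forall>e'\<in>over B U. proj B e = proj B e' \<longrightarrow>
        snd (\<psi> (badd B e e')) = vadd (fibre B) (snd (\<psi> e)) (snd (\<psi> e'))) \<and>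
     (\<forall>r. \<forall>e\<in>over B U. snd (\<psi> (bscale B r e)) = vscale (fibre B) r (snd (\<psi> e)))"
    using \<psi> sub unfolding local_trivialization_def by (meson subsetD)
  ultimately show ?thesis
    using U by (simp add: local_trivialization_def)
qed

lemma bundle_chartsD:
  assumes "(U, x, \<psi>, y) \<in> bundle_charts B"
  shows "chart_of M U x" "local_trivialization B U \<psi>" "linear_coords (fibre B) y"
    and "chart_of E (over B U) (bundle_coord B x \<psi> y)"
    and "bundle_coord B x \<psi> y ` over B U = x ` U \<times> UNIV"
proof -
  show c: "chart_of M U x" "local_trivialization B U \<psi>" "linear_coords (fibre B) y"
    using assms by (auto simp: bundle_charts_def charts_eq[OF atlas_M])
  show "chart_of E (over B U) (bundle_coord B x \<psi> y)" "bundle_coord B x \<psi> y ` over B U = x ` U \<times> UNIV"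
    using chart_of_bundle_coord[OF c(1,2) order_refl c(3)] by auto
qed

lemma bundle_chart_at:
  assumes "p \<in> points M"
  obtains U x \<psi> y where "(U, x, \<psi>, y) \<in> bundle_charts B" "p \<in> U"
proof -
  obtain U' \<psi> where \<psi>: "p \<in> U'" "local_trivialization B U' \<psi>"
    using bundle_axioms assms by (auto simp: smooth_vector_bundle_def)
  obtain V x where V: "(V, x) \<in> M" "chart_of M V x" "p \<in> V"
    using assms by (rule chart_at[OF atlas_M])
  obtain y where y: "linear_coords (fibre B) y"
    using vspace_F by (auto simp: smooth_vspace_def)
  have x: "chart_of M (V \<inter> U') x"
    by (rule chart_of_Int[OF atlas_M V(2) trivializationD(1)[OF \<psi>(2)]])
  then have "(V \<inter> U', x, \<psi>, y) \<in> bundle_charts B"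
    using local_trivialization_restrict[OF x \<psi>(2)] y by (auto simp: bundle_charts_def charts_eq[OF atlas_M])
  then show ?thesis using that \<psi>(1) V(3) by blast
qed

section \<open>Jets in bundle charts\<close>

abbreviation JE :: "((real^'p::finite \<Rightarrow> 'a) set, 't \<times> ('t^'p)) atlas" where "JE \<equiv> jet_manifold E"
abbreviation JM :: "((real^'p::finite \<Rightarrow> 'c) set, 'm \<times> ('m^'p)) atlas" where "JM \<equiv> jet_manifold M"

lemmas points_JE = points_jet_manifold[OF manifold_E]
  and points_JM = points_jet_manifold[OF manifold_M]

lemma jet_over_iff:
  "j \<in> jets_over E (over B U) \<longleftrightarrow> j \<in> points JE \<and> proj B (jet_rep j 0) \<in> U"
  for j :: "(real^'p::finite \<Rightarrow> 'a) set"
  unfolding points_JE using jets_over_iff[OF manifold_E, of j "over B U"] jet_rep_points[OF manifold_E, of j "points E"]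
  by (auto simp: over_def)

lemma bundle_chart_at_jet:
  fixes j :: "(real^'p::finite \<Rightarrow> 'a) set"
  assumes "j \<in> points JE"
  obtains U x \<psi> y where "(U, x, \<psi>, y) \<in> bundle_charts B" "j \<in> jets_over E (over B U)"
proof -
  have "proj B (jet_rep j 0) \<in> points M"
    using assms jet_rep_points[OF manifold_E] by (auto simp: points_JE intro!: proj_points)
  then obtain U x \<psi> y where "(U, x, \<psi>, y) \<in> bundle_charts B" "proj B (jet_rep j 0) \<in> U"
    by (rule bundle_chart_at)
  then show ?thesis using that assms jet_over_iff[of j U] by simp
qed

lemma bundle_coord_germ:
  assumes c: "(U, x, \<psi>, y) \<in> bundle_charts B" and \<Phi>: "differentiable_germ E \<Phi>" "\<Phi> 0 \<in> over B U"
  shows "(x \<circ> proj B \<circ> \<Phi>) differentiable (at 0)" "(y \<circ> snd \<circ> \<psi> \<circ> \<Phi>) differentiable (at 0)"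
    and "partial0 \<alpha> (bundle_coord B x \<psi> y \<circ> \<Phi>) =
      (partial0 \<alpha> (x \<circ> proj B \<circ> \<Phi>), partial0 \<alpha> (y \<circ> snd \<circ> \<psi> \<circ> \<Phi>))"
proof -
  have "(bundle_coord B x \<psi> y \<circ> \<Phi>) differentiable (at 0)"
    by (rule differentiable_germD(2)[OF atlas_E \<Phi>(1) bundle_chartsD(4)[OF c] \<Phi>(2)])
  then obtain D where D: "((bundle_coord B x \<psi> y \<circ> \<Phi>) has_derivative D) (at 0)"
    by (auto simp: differentiable_def)
  have f: "x \<circ> proj B \<circ> \<Phi> = (\<lambda>u. fst ((bundle_coord B x \<psi> y \<circ> \<Phi>) u))"
    and s: "y \<circ> snd \<circ> \<psi> \<circ> \<Phi> = (\<lambda>u. snd ((bundle_coord B x \<psi> y \<circ> \<Phi>) u))"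
    by (auto simp: bundle_coord_def)
  show df: "(x \<circ> proj B \<circ> \<Phi>) differentiable (at 0)"
    unfolding f using has_derivative_fst[OF D] by (auto simp: differentiable_def)
  show ds: "(y \<circ> snd \<circ> \<psi> \<circ> \<Phi>) differentiable (at 0)"
    unfolding s using has_derivative_snd[OF D] by (auto simp: differentiable_def)
  have "bundle_coord B x \<psi> y \<circ> \<Phi> = (\<lambda>u. ((x \<circ> proj B \<circ> \<Phi>) u, (y \<circ> snd \<circ> \<psi> \<circ> \<Phi>) u))"
    by (auto simp: bundle_coord_def)
  then show "partial0 \<alpha> (bundle_coord B x \<psi> y \<circ> \<Phi>) =
      (partial0 \<alpha> (x \<circ> proj B \<circ> \<Phi>), partial0 \<alpha> (y \<circ> snd \<circ> \<psi> \<circ> \<Phi>))"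
    using partial0_Pair[OF df ds] by simp
qed

text \<open>
  The components of a jet are its coordinates in the chart induced by \<^const>\<open>bundle_coord\<close>, listed in a
  different order.
\<close>

lemma jet_comps_eq:
  fixes j :: "(real^'p::finite \<Rightarrow> 'a) set"
  assumes c: "(U, x, \<psi>, y) \<in> bundle_charts B" and j: "j \<in> jets_over E (over B U)"
    and z: "jet_coord (bundle_coord B x \<psi> y) j = ((a, b), Z)"
  shows "jet_comps B (U, x, \<psi>, y) j = (a, b, \<chi> \<alpha>. fst (Z $ \<alpha>), \<chi> \<alpha>. snd (Z $ \<alpha>))"
proof -
  note g = bundle_coord_germ[OF c germ_jet_rep[OF manifold_E j] jet_rep_0[OF manifold_E j]]
  have "bundle_coord B x \<psi> y (jet_rep j 0) = (a, b)"
      "\<And>\<alpha>. Z $ \<alpha> = partial0 \<alpha> (bundle_coord B x \<psi> y \<circ> jet_rep j)"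
    using z by (auto simp: jet_coord_def)
  then show ?thesis
    by (auto simp: jet_comps_def Let_def g(3) bundle_coord_def)
qed

lemma jet_comps_jet:
  assumes c: "(U, x, \<psi>, y) \<in> bundle_charts B" and \<Phi>: "differentiable_germ E \<Phi>" "\<Phi> 0 \<in> over B U"
  shows "jet_comps B (U, x, \<psi>, y) (jet E \<Phi>) = (x (proj B (\<Phi> 0)), y (snd (\<psi> (\<Phi> 0))),
      \<chi> \<alpha>. partial0 \<alpha> (x \<circ> proj B \<circ> \<Phi>), \<chi> \<alpha>. partial0 \<alpha> (y \<circ> snd \<circ> \<psi> \<circ> \<Phi>))"
proof -
  have j: "jet E \<Phi> \<in> jets_over E (over B U)"
    using jet_in_jets_over[OF manifold_E \<Phi>(1)] \<Phi>(2) by simp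
  have "jet_coord (bundle_coord B x \<psi> y) (jet E \<Phi>) =
      ((x (proj B (\<Phi> 0)), y (snd (\<psi> (\<Phi> 0)))), \<chi> \<alpha>. partial0 \<alpha> (bundle_coord B x \<psi> y \<circ> \<Phi>))"
    using jet_coord_jet[OF manifold_E \<Phi>(1) bundle_chartsD(4)[OF c] \<Phi>(2)] by (simp add: bundle_coord_def)
  from jet_comps_eq[OF c j this] show ?thesis
    by (simp add: bundle_coord_germ(3)[OF c \<Phi>])
qed

lemma jet_comps_inj:
  fixes j j' :: "(real^'p::finite \<Rightarrow> 'a) set"
  assumes c: "(U, x, \<psi>, y) \<in> bundle_charts B" and j: "j \<in> jets_over E (over B U)" and j': "j' \<in> jets_over E (over B U)"
    and eq: "jet_comps B (U, x, \<psi>, y) j = jet_comps B (U, x, \<psi>, y) j'"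
  shows "j = j'"
proof -
  obtain a b Z where z: "jet_coord (bundle_coord B x \<psi> y) j = ((a, b), Z)" by (metis prod.exhaust)
  obtain a' b' Z' where z': "jet_coord (bundle_coord B x \<psi> y) j' = ((a', b'), Z')" by (metis prod.exhaust)
  have "a = a'" "b = b'" "Z = Z'"
    using eq unfolding jet_comps_eq[OF c j z] jet_comps_eq[OF c j' z'] by (auto simp: vec_eq_iff prod_eq_iff)
  then have "jet_coord (bundle_coord B x \<psi> y) j = jet_coord (bundle_coord B x \<psi> y) j'" using z z' by simp
  then show ?thesis
    using jet_coord_inj[OF manifold_E bundle_chartsD(4)[OF c]] j j' by (auto dest: inj_onD)
qed

lemma jet_comps_surj:
  fixes X :: "'m^'p::finite" and Y :: "'k^'p"
  assumes c: "(U, x, \<psi>, y) \<in> bundle_charts B" and a: "a \<in> x ` U"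
  obtains j where "j \<in> jets_over E (over B U)" "jet_comps B (U, x, \<psi>, y) j = (a, b, X, Y)"
proof -
  have "((a, b), \<chi> \<alpha>. (X $ \<alpha>, Y $ \<alpha>)) \<in> jet_coord (bundle_coord B x \<psi> y) ` jets_over E (over B U)"
    unfolding jet_coord_image[OF manifold_E bundle_chartsD(4)[OF c]] bundle_chartsD(5)[OF c] using a by simp
  then show ?thesis
  proof (rule imageE)
    fix j assume j: "((a, b), \<chi> \<alpha>. (X $ \<alpha>, Y $ \<alpha>)) = jet_coord (bundle_coord B x \<psi> y) j" "j \<in> jets_over E (over B U)"
    show ?thesis using that[OF j(2)] jet_comps_eq[OF c j(2) j(1)[symmetric]] by simp
  qed
qed

text \<open>
  The components in a single bundle chart determine a jet, so the description that defines
  \<^const>\<open>jet_op\<close> has at most one solution.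
\<close>

lemma jet_op_eqI:
  fixes j :: "(real^'p::finite \<Rightarrow> 'a) set"
  assumes j: "j \<in> points JE" and l: "l \<in> points JE"
    and lc: "\<And>U x \<psi> y. (U, x, \<psi>, y) \<in> bundle_charts B \<Longrightarrow> j \<in> jets_over E (over B U) \<Longrightarrow>
      l \<in> jets_over E (over B U) \<and>
      jet_comps B (U, x, \<psi>, y) l = h (jet_comps B (U, x, \<psi>, y) j) (jet_comps B (U, x, \<psi>, y) j')"
  shows "jet_op B h j j' = l"
  unfolding jet_op_def
proof (rule the_equality)
  show "l \<in> jets_over E (points E) \<and>
     (\<forall>(U, x, \<psi>, y)\<in>bundle_charts B. j \<in> jets_over E (over B U) \<longrightarrow> l \<in> jets_over E (over B U) \<and>
        jet_comps B (U, x, \<psi>, y) l = h (jet_comps B (U, x, \<psi>, y) j) (jet_comps B (U, x, \<psi>, y) j'))"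
    using l lc by (auto simp: points_JE)
next
  fix k assume k: "k \<in> jets_over E (points E) \<and>
     (\<forall>(U, x, \<psi>, y)\<in>bundle_charts B. j \<in> jets_over E (over B U) \<longrightarrow> k \<in> jets_over E (over B U) \<and>
        jet_comps B (U, x, \<psi>, y) k = h (jet_comps B (U, x, \<psi>, y) j) (jet_comps B (U, x, \<psi>, y) j'))"
  obtain U x \<psi> y where c: "(U, x, \<psi>, y) \<in> bundle_charts B" "j \<in> jets_over E (over B U)"
    using j by (rule bundle_chart_at_jet)
  have "k \<in> jets_over E (over B U)"
      "jet_comps B (U, x, \<psi>, y) k = h (jet_comps B (U, x, \<psi>, y) j) (jet_comps B (U, x, \<psi>, y) j')"
    using k c by blast+
  then show "k = l" using lc[OF c] jet_comps_inj[OF c(1)] by metis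
qed

section \<open>The induced atlases\<close>

text \<open>
  \<open>L1\<close> and \<open>L2\<close> list the components of a jet in the order of the primary and of the secondary charts.
  That they are linear isomorphisms is all that the compatibility of the two structures amounts to.
\<close>

lemma linear_rearrangements:
  fixes L1 :: "('m \<times> 'k) \<times> (('m \<times> 'k)^'p::finite) \<Rightarrow> 'm \<times> 'k \<times> (('m \<times> 'k)^'p)"
    and L2 :: "('m \<times> 'k) \<times> (('m \<times> 'k)^'p) \<Rightarrow> ('m \<times> ('m^'p)) \<times> ('k \<times> ('k^'p))"
  defines "L1 \<equiv> \<lambda>z. (fst (fst z), snd (fst z), snd z)"
    and "L2 \<equiv> \<lambda>z. ((fst (fst z), \<chi> \<alpha>. fst (snd z $ \<alpha>)), (snd (fst z), \<chi> \<alpha>. snd (snd z $ \<alpha>)))"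
  shows "chart_of A W \<kappa> \<Longrightarrow> chart_of A W (\<lambda>p. L1 (\<kappa> p))"
    and "chart_of A W \<kappa> \<Longrightarrow> chart_of A W (\<lambda>p. L2 (\<kappa> p))"
proof -
  \<comment> \<open>the inverses of \<open>L1\<close> and \<open>L2\<close>\<close>
  define K1 :: "'m \<times> 'k \<times> (('m \<times> 'k)^'p) \<Rightarrow> _" where "K1 = (\<lambda>z. ((fst z, fst (snd z)), snd (snd z)))"
  define K2 :: "('m \<times> ('m^'p)) \<times> ('k \<times> ('k^'p)) \<Rightarrow> _" where
    "K2 = (\<lambda>z. ((fst (fst z), fst (snd z)), \<chi> \<alpha>. (snd (fst z) $ \<alpha>, snd (snd z) $ \<alpha>)))"
  have lin: "bounded_linear L1" "bounded_linear L2" "bounded_linear K1" "bounded_linear K2"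
    unfolding L1_def L2_def K1_def K2_def
    by (intro linear_imp_bounded_linear linearI; simp add: vec_eq_iff)+
  show "chart_of A W \<kappa> \<Longrightarrow> chart_of A W (\<lambda>p. L1 (\<kappa> p))"
    by (rule chart_of_linear[OF _ lin(1,3)]) (auto simp: L1_def K1_def)
  show "chart_of A W \<kappa> \<Longrightarrow> chart_of A W (\<lambda>p. L2 (\<kappa> p))"
    by (rule chart_of_linear[OF _ lin(2,4)]) (auto simp: L2_def K2_def vec_eq_iff)
qed

text \<open>
  The components depend on the functions \<open>x\<close>, \<open>\<psi>\<close>, \<open>y\<close> but not on the domain that is recorded with
  them; \<^const>\<open>UNIV\<close> serves as a placeholder for it.
\<close>

definition primary_chart :: "('c \<Rightarrow> 'm) \<Rightarrow> ('a \<Rightarrow> 'c \<times> 'f) \<Rightarrow> ('f \<Rightarrow> 'k) \<Rightarrow> (real^'p::finite \<Rightarrow> 'a) set \<Rightarrow> _" where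
  "primary_chart x \<psi> y j = (case jet_comps B (UNIV, x, \<psi>, y) j of (a, b, X, Y) \<Rightarrow> (a, b, \<chi> \<alpha>. (X $ \<alpha>, Y $ \<alpha>)))"

definition secondary_chart :: "('c \<Rightarrow> 'm) \<Rightarrow> ('a \<Rightarrow> 'c \<times> 'f) \<Rightarrow> ('f \<Rightarrow> 'k) \<Rightarrow> (real^'p::finite \<Rightarrow> 'a) set \<Rightarrow> _" where
  "secondary_chart x \<psi> y j = (case jet_comps B (UNIV, x, \<psi>, y) j of (a, b, X, Y) \<Rightarrow> ((a, X), (b, Y)))"

lemma jet_comps_domain: "jet_comps B (U, x, \<psi>, y) = jet_comps B (UNIV, x, \<psi>, y)"
  by (simp add: jet_comps_def fun_eq_iff)

lemma
  assumes c: "(U, x, \<psi>, y) \<in> bundle_charts B"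
  shows chart_of_primary: "chart_of JE (jets_over E (over B U) :: (real^'p::finite \<Rightarrow> 'a) set set) (primary_chart x \<psi> y)"
    and chart_of_secondary: "chart_of JE (jets_over E (over B U) :: (real^'p \<Rightarrow> 'a) set set) (secondary_chart x \<psi> y)"
proof -
  note \<kappa> = chart_of_jet_manifold[OF manifold_E bundle_chartsD(4)[OF c]]
  note atlas_JE = smooth_atlas_jet_manifold[OF manifold_E]
  show "chart_of JE (jets_over E (over B U) :: (real^'p \<Rightarrow> 'a) set set) (primary_chart x \<psi> y)"
  proof (rule chart_of_cong[OF atlas_JE linear_rearrangements(1)[OF \<kappa>]])
    fix j :: "(real^'p \<Rightarrow> 'a) set" assume j: "j \<in> jets_over E (over B U)"
    obtain a b Z where z: "jet_coord (bundle_coord B x \<psi> y) j = ((a, b), Z)" by (metis prod.exhaust)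
    show "(fst (fst (jet_coord (bundle_coord B x \<psi> y) j)), snd (fst (jet_coord (bundle_coord B x \<psi> y) j)),
        snd (jet_coord (bundle_coord B x \<psi> y) j)) = primary_chart x \<psi> y j"
      using jet_comps_eq[OF c j z] unfolding jet_comps_domain[of U]
      by (simp add: z primary_chart_def vec_eq_iff)
  qed
  show "chart_of JE (jets_over E (over B U) :: (real^'p \<Rightarrow> 'a) set set) (secondary_chart x \<psi> y)"
  proof (rule chart_of_cong[OF atlas_JE linear_rearrangements(2)[OF \<kappa>]])
    fix j :: "(real^'p \<Rightarrow> 'a) set" assume j: "j \<in> jets_over E (over B U)"
    obtain a b Z where z: "jet_coord (bundle_coord B x \<psi> y) j = ((a, b), Z)" by (metis prod.exhaust)
    show "((fst (fst (jet_coord (bundle_coord B x \<psi> y) j)), \<chi> \<alpha>. fst (snd (jet_coord (bundle_coord B x \<psi> y) j) $ \<alpha>)),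
        snd (fst (jet_coord (bundle_coord B x \<psi> y) j)), \<chi> \<alpha>. snd (snd (jet_coord (bundle_coord B x \<psi> y) j) $ \<alpha>)) =
        secondary_chart x \<psi> y j"
      using jet_comps_eq[OF c j z] unfolding jet_comps_domain[of U]
      by (simp add: z secondary_chart_def)
  qed
qed

text \<open>
  The two components of \<open>\<psi>\<^sup>1\<close> are jets of the maps \<open>\<pi> \<circ> \<Phi>\<close> and \<open>pr\<^sub>2 \<circ> \<psi> \<circ> \<Phi>\<close>.  The first is smooth
  everywhere, the second only near the origin.
\<close>

lemma germ_proj_jet_rep:
  assumes "j \<in> points JE"
  shows "differentiable_germ M (proj B \<circ> jet_rep j)"
proof -
  have "smooth_map std_manifold E (jet_rep j)"
    using assms smooth_jet_rep[OF manifold_E] by (simp add: points_JE)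
  from smooth_map_compose[OF smooth_atlas_std atlas_E atlas_M this smooth_proj]
  show ?thesis by (rule smooth_map_imp_germ[OF atlas_M])
qed

lemma jet_map_proj_over:
  fixes j :: "(real^'p::finite \<Rightarrow> 'a) set"
  assumes j: "j \<in> points JE"
  shows "jet_map M (proj B) j \<in> jets_over M U \<longleftrightarrow> j \<in> jets_over E (over B U)"
  using j jet_in_jets_over[OF manifold_M germ_proj_jet_rep[OF j], of U] jet_over_iff[of j U]
  by (simp add: jet_map_def)

lemma secondary_trivialization_coords:
  fixes j :: "(real^'p::finite \<Rightarrow> 'a) set"
  assumes c: "(U, x, \<psi>, y) \<in> bundle_charts B" and j: "j \<in> jets_over E (over B U)"
  shows "jet_map M (proj B) j \<in> jets_over M U"
    and "jet_map F (snd \<circ> \<psi>) j \<in> points (jet_manifold F)"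
    and "(jet_coord x (jet_map M (proj B) j), jet_coord y (jet_map F (snd \<circ> \<psi>) j)) = secondary_chart x \<psi> y j"
proof -
  have jE: "j \<in> points JE" using j jet_over_iff by blast
  note e = jet_rep_0[OF manifold_E j] germ_jet_rep[OF manifold_E j]
  show m: "jet_map M (proj B) j \<in> jets_over M U"
    using jet_map_proj_over[OF jE] j by simp
  have p: "proj B (jet_rep j 0) \<in> U" using e(1) by (simp add: over_def)
  have ev: "\<forall>\<^sub>F u in nhds 0. (snd \<circ> \<psi> \<circ> jet_rep j) u \<in> points F"
    using differentiable_germD(1)[OF atlas_E e(2) bundle_chartsD(4)[OF c] e(1)]
    by (rule eventually_mono) (simp add: trivializationD(3)[OF bundle_chartsD(2)[OF c]])
  note yF = linear_coordsD(1)[OF vspace_F bundle_chartsD(3)[OF c]]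
  have p2: "(snd \<circ> \<psi> \<circ> jet_rep j) 0 \<in> points F"
    using trivializationD(3)[OF bundle_chartsD(2)[OF c] e(1)] by simp
  have "(y \<circ> (snd \<circ> \<psi> \<circ> jet_rep j)) differentiable (at 0)"
    using bundle_coord_germ(2)[OF c e(2,1)] by (simp add: o_assoc)
  then have g: "differentiable_germ F (snd \<circ> \<psi> \<circ> jet_rep j)"
    using differentiable_germI[of F "points F" y "snd \<circ> \<psi> \<circ> jet_rep j"] ev p2 yF atlas_F by simp
  show "jet_map F (snd \<circ> \<psi>) j \<in> points (jet_manifold F)"
    using jet_in_jets_over[OF manifold_F g, of "points F"] p2
    by (simp add: points_jet_manifold[OF manifold_F] jet_map_def)
  show "(jet_coord x (jet_map M (proj B) j), jet_coord y (jet_map F (snd \<circ> \<psi>) j)) = secondary_chart x \<psi> y j"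
  proof -
    have "jet_coord x (jet M (proj B \<circ> jet_rep j)) =
        (x (proj B (jet_rep j 0)), \<chi> \<alpha>. partial0 \<alpha> (x \<circ> proj B \<circ> jet_rep j))"
      using jet_coord_jet[OF manifold_M germ_proj_jet_rep[OF jE] bundle_chartsD(1)[OF c]] p
      by (simp only: o_assoc o_apply)
    moreover have "jet_coord y (jet F (snd \<circ> \<psi> \<circ> jet_rep j)) =
        (y (snd (\<psi> (jet_rep j 0))), \<chi> \<alpha>. partial0 \<alpha> (y \<circ> snd \<circ> \<psi> \<circ> jet_rep j))"
    proof -
      have "(snd \<circ> \<psi> \<circ> jet_rep j) 0 = snd (\<psi> (jet_rep j 0))" by simp
      then show ?thesis using jet_coord_jet[OF manifold_F g yF p2] by (simp only: o_assoc)
    qed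
    ultimately show ?thesis
      by (simp add: secondary_chart_def jet_map_def jet_comps_def Let_def)
  qed
qed

lemma primary_chartsE:
  assumes "(J, X) \<in> (primary_charts B :: ((real^'p::finite \<Rightarrow> 'a) set, _) atlas)"
  obtains U x \<psi> y where "(U, x, \<psi>, y) \<in> bundle_charts B" "J = jets_over E (over B U)" "X = primary_chart x \<psi> y"
proof -
  obtain U x \<psi> y where c: "(U, x, \<psi>, y) \<in> bundle_charts B" "J = jets_over E (over B U)"
      "X = (\<lambda>j. case jet_comps B (U, x, \<psi>, y) j of (a, b, X, Y) \<Rightarrow> (a, b, \<chi> \<alpha>. (X $ \<alpha>, Y $ \<alpha>)))"
    using assms unfolding primary_charts_def by auto
  then show ?thesis
    using that[OF c(1,2)] unfolding jet_comps_domain[of U] by (simp add: primary_chart_def fun_eq_iff)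
qed

lemma primary_charts_chart_of:
  "(J, X) \<in> (primary_charts B :: ((real^'p::finite \<Rightarrow> 'a) set, _) atlas) \<Longrightarrow> chart_of JE J X"
  by (metis primary_chartsE chart_of_primary)

lemma secondary_charts_chart_of:
  assumes "(J, X) \<in> (secondary_charts B :: ((real^'p::finite \<Rightarrow> 'a) set, _) atlas)"
  shows "chart_of JE J X"
proof -
  obtain U x \<psi> y where c: "(U, x, \<psi>, y) \<in> bundle_charts B" "J = jets_over E (over B U)"
      "X = map_prod (jet_coord x) (jet_coord y) \<circ> secondary_trivialization B \<psi>"
    using assms unfolding secondary_charts_def by auto
  show ?thesis
    unfolding c(2)
  proof (rule chart_of_cong[OF smooth_atlas_jet_manifold[OF manifold_E] chart_of_secondary[OF c(1)]])
    fix j :: "(real^'p \<Rightarrow> 'a) set" assume j: "j \<in> jets_over E (over B U)"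
    show "secondary_chart x \<psi> y j = X j"
      using secondary_trivialization_coords(3)[OF c(1) j] by (simp add: c(3) secondary_trivialization_def)
  qed
qed

lemma
  shows points_primary_charts: "points (primary_charts B) = points (JE :: ((real^'p::finite \<Rightarrow> 'a) set, _) atlas)"
    and points_secondary_charts: "points (secondary_charts B) = points (JE :: ((real^'p \<Rightarrow> 'a) set, _) atlas)"
proof -
  have "(\<exists>(U, x, \<psi>, y)\<in>bundle_charts B. j \<in> jets_over E (over B U)) \<longleftrightarrow> j \<in> points JE" for j :: "(real^'p \<Rightarrow> 'a) set"
  proof
    assume "j \<in> points JE"
    then obtain U x \<psi> y where "(U, x, \<psi>, y) \<in> bundle_charts B" "j \<in> jets_over E (over B U)"
      by (rule bundle_chart_at_jet)
    then show "\<exists>(U, x, \<psi>, y)\<in>bundle_charts B. j \<in> jets_over E (over B U)" by blast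
  next
    assume "\<exists>(U, x, \<psi>, y)\<in>bundle_charts B. j \<in> jets_over E (over B U)"
    then show "j \<in> points JE" using jet_over_iff by blast
  qed
  then show "points (primary_charts B) = points (JE :: ((real^'p \<Rightarrow> 'a) set, _) atlas)"
    "points (secondary_charts B) = points (JE :: ((real^'p \<Rightarrow> 'a) set, _) atlas)"
    unfolding primary_charts_def secondary_charts_def points_eq_Union[of "_ ` _"]
    by (auto simp: split_beta image_image)
qed

section \<open>The primary bundle\<close>

abbreviation PB :: "((real^'p::finite \<Rightarrow> 'a) set, 't \<times> ('t^'p), 'a, 't, ('m \<times> 'k)^'p, ('m \<times> 'k)^'p) vbundle"
  where "PB \<equiv> primary_bundle B"

lemma over_PB: "over PB W = (jets_over E W :: (real^'p::finite \<Rightarrow> 'a) set set)"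
  unfolding over_def primary_bundle_def
  using jets_over_iff[OF manifold_E] by (auto simp: points_JE jet_proj_def)

text \<open>
  In any coordinates the derivatives of jets over the same point transform by one linear map, so
  forming a linear combination commutes with the change of chart.
\<close>

lemma primary_combination:
  fixes j j' :: "(real^'p::finite \<Rightarrow> 'a) set"
  assumes j: "j \<in> points JE" and j': "j' \<in> points JE" and base: "jet_rep j 0 = jet_rep j' 0"
  obtains l where "l \<in> points JE" "jet_rep l 0 = jet_rep j 0"
    "\<And>U x \<psi> y. (U, x, \<psi>, y) \<in> bundle_charts B \<Longrightarrow> j \<in> jets_over E (over B U) \<Longrightarrow>
       snd (jet_coord (bundle_coord B x \<psi> y) l) =
       r *\<^sub>R snd (jet_coord (bundle_coord B x \<psi> y) j) + s *\<^sub>R snd (jet_coord (bundle_coord B x \<psi> y) j')"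
proof -
  have J: "j \<in> jets_over E (points E)" "j' \<in> jets_over E (points E)" using j j' by (auto simp: points_JE)
  let ?e = "jet_rep j 0"
  obtain Z z where Z: "(Z, z) \<in> E" "chart_of E Z z" "?e \<in> Z"
    using jet_rep_points[OF manifold_E J(1)] by (rule chart_at[OF atlas_E])
  \<comment> \<open>the combination is formed in an arbitrary chart of \<open>E\<close>\<close>
  obtain \<xi> :: "real^'p \<Rightarrow> 'a" where \<xi>: "smooth_map std_manifold E \<xi>" "\<xi> 0 = ?e"
      "\<And>\<alpha>. partial0 \<alpha> (z \<circ> \<xi>) = (r *\<^sub>R snd (jet_coord z j) + s *\<^sub>R snd (jet_coord z j')) $ \<alpha>"
    using smooth_curve_with_jet[OF atlas_E Z(2,3)] by blast
  note g = smooth_map_imp_germ[OF atlas_E \<xi>(1)]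
  have l: "jet E \<xi> \<in> points JE" "jet_rep (jet E \<xi>) 0 = ?e"
    using jet_rep_germ_0[OF manifold_E g] jet_in_jets_over[OF manifold_E g, of "points E"] \<xi>(2)
      jet_rep_points[OF manifold_E J(1)] by (simp_all add: points_JE)
  show ?thesis
  proof (rule that[OF l])
    fix U x \<psi> y assume c: "(U, x, \<psi>, y) \<in> bundle_charts B" and jU: "j \<in> jets_over E (over B U)"
    let ?\<beta> = "bundle_coord B x \<psi> y"
    note \<beta> = bundle_chartsD(4)[OF c]
    let ?W = "Z \<inter> over B U"
    have W: "chart_of E ?W z"
      by (rule chart_of_Int[OF atlas_E Z(2) chart_of_openin[OF atlas_E \<beta>]])
    have eW: "?e \<in> ?W" using Z(3) jet_rep_0[OF manifold_E jU] by simp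
    obtain \<tau> where \<tau>: "Cinf_on (z ` ?W) \<tau>" "\<And>q. q \<in> ?W \<Longrightarrow> ?\<beta> q = \<tau> (z q)"
      using chart_of_transition[OF atlas_E Z(2) \<beta>] by (auto simp: smooth_in_def)
    let ?D = "frechet_derivative \<tau> (at (z ?e))"
    have lin: "linear ?D"
      using Cinf_on_has_derivative[OF \<tau>(1), of "z ?e"] eW has_derivative_linear by blast
    have D: "snd (jet_coord ?\<beta> k) $ \<alpha> = ?D (snd (jet_coord z k) $ \<alpha>)"
      if "k \<in> jets_over E (points E)" "jet_rep k 0 = ?e" for k and \<alpha> :: 'p
      using partial0_coordinates[OF atlas_E germ_jet_rep[OF manifold_E that(1)] W _ \<tau>, where \<alpha>=\<alpha>] that(2) eW
      by (simp add: jet_coord_def)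
    have z: "snd (jet_coord z (jet E \<xi>)) = r *\<^sub>R snd (jet_coord z j) + s *\<^sub>R snd (jet_coord z j')"
      using jet_coord_jet[OF manifold_E g Z(2)] \<xi>(2,3) Z(3) by (simp add: vec_eq_iff)
    have "jet E \<xi> \<in> jets_over E (points E)" using l(1) by (simp add: points_JE)
    from D[OF this l(2)] show "snd (jet_coord ?\<beta> (jet E \<xi>)) = r *\<^sub>R snd (jet_coord ?\<beta> j) + s *\<^sub>R snd (jet_coord ?\<beta> j')"
      using D[OF J(1) refl] D[OF J(2) base[symmetric]]
      by (simp add: vec_eq_iff z linear_add[OF lin] linear_scale[OF lin])
  qed
qed

lemma jet_comps_snd:
  fixes j :: "(real^'p::finite \<Rightarrow> 'a) set"
  assumes c: "(U, x, \<psi>, y) \<in> bundle_charts B" and j: "j \<in> jets_over E (over B U)"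
  shows "jet_comps B (U, x, \<psi>, y) j =
    (x (proj B (jet_rep j 0)), y (snd (\<psi> (jet_rep j 0))),
      \<chi> \<alpha>. fst (snd (jet_coord (bundle_coord B x \<psi> y) j) $ \<alpha>), \<chi> \<alpha>. snd (snd (jet_coord (bundle_coord B x \<psi> y) j) $ \<alpha>))"
  by (rule jet_comps_eq[OF c j]) (simp add: jet_coord_def bundle_coord_def)

lemma jets_same_base:
  fixes j l :: "(real^'p::finite \<Rightarrow> 'a) set"
  assumes "j \<in> jets_over E (over B U)" "l \<in> points JE" "jet_rep l 0 = jet_rep j 0"
  shows "l \<in> jets_over E (over B U)"
  using assms jet_over_iff[of j U] jet_over_iff[of l U] by simp

text \<open>
  Addition and scalar multiplication are both of this form, with \<open>r = s = 1\<close> and with \<open>s = 0\<close>, \<open>j' = j\<close>.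
\<close>

lemma primary_jet_op:
  fixes j j' :: "(real^'p::finite \<Rightarrow> 'a) set"
  assumes j: "j \<in> points JE" and j': "j' \<in> points JE" and base: "jet_rep j 0 = jet_rep j' 0"
    and h: "\<And>a b X X' Y Y'. h (a, b, X, Y) (a, b, X', Y') = (a, b, r *\<^sub>R X + s *\<^sub>R X', r *\<^sub>R Y + s *\<^sub>R Y')"
  shows "jet_op B h j j' \<in> points JE" "jet_rep (jet_op B h j j') 0 = jet_rep j 0"
    and "(U, x, \<psi>, y) \<in> bundle_charts B \<Longrightarrow> j \<in> jets_over E (over B U) \<Longrightarrow>
      snd (jet_coord (bundle_coord B x \<psi> y) (jet_op B h j j')) =
      r *\<^sub>R snd (jet_coord (bundle_coord B x \<psi> y) j) + s *\<^sub>R snd (jet_coord (bundle_coord B x \<psi> y) j')"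
proof -
  obtain l where l: "l \<in> points JE" "jet_rep l 0 = jet_rep j 0"
    "\<And>U x \<psi> y. (U, x, \<psi>, y) \<in> bundle_charts B \<Longrightarrow> j \<in> jets_over E (over B U) \<Longrightarrow>
       snd (jet_coord (bundle_coord B x \<psi> y) l) =
       r *\<^sub>R snd (jet_coord (bundle_coord B x \<psi> y) j) + s *\<^sub>R snd (jet_coord (bundle_coord B x \<psi> y) j')"
    using primary_combination[OF j j' base, of r s] by blast
  have "jet_op B h j j' = l"
  proof (rule jet_op_eqI[OF j l(1)])
    fix U x \<psi> y assume c: "(U, x, \<psi>, y) \<in> bundle_charts B" and jU: "j \<in> jets_over E (over B U)"
    have U: "l \<in> jets_over E (over B U)" "j' \<in> jets_over E (over B U)"
      using jets_same_base[OF jU] l(1,2) j' base by auto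
    show "l \<in> jets_over E (over B U) \<and>
        jet_comps B (U, x, \<psi>, y) l = h (jet_comps B (U, x, \<psi>, y) j) (jet_comps B (U, x, \<psi>, y) j')"
      unfolding jet_comps_snd[OF c jU] jet_comps_snd[OF c U(1)] jet_comps_snd[OF c U(2)]
      using U(1) l(2) l(3)[OF c jU] base by (simp add: h vec_eq_iff)
  qed
  then show "jet_op B h j j' \<in> points JE" "jet_rep (jet_op B h j j') 0 = jet_rep j 0"
    and "(U, x, \<psi>, y) \<in> bundle_charts B \<Longrightarrow> j \<in> jets_over E (over B U) \<Longrightarrow>
      snd (jet_coord (bundle_coord B x \<psi> y) (jet_op B h j j')) =
      r *\<^sub>R snd (jet_coord (bundle_coord B x \<psi> y) j) + s *\<^sub>R snd (jet_coord (bundle_coord B x \<psi> y) j')"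
    using l by auto
qed

lemma primary_add:
  fixes j j' :: "(real^'p::finite \<Rightarrow> 'a) set"
  assumes "j \<in> points JE" "j' \<in> points JE" "jet_rep j 0 = jet_rep j' 0"
  shows "badd PB j j' \<in> points JE" "jet_rep (badd PB j j') 0 = jet_rep j 0"
    and "(U, x, \<psi>, y) \<in> bundle_charts B \<Longrightarrow> j \<in> jets_over E (over B U) \<Longrightarrow>
      snd (jet_coord (bundle_coord B x \<psi> y) (badd PB j j')) =
      snd (jet_coord (bundle_coord B x \<psi> y) j) + snd (jet_coord (bundle_coord B x \<psi> y) j')"
  using primary_jet_op[OF assms, where r=1 and s=1 and
      h="\<lambda>(x, y, X, Y) (x', y', X', Y'). (x, y, X + X', Y + Y')"]
  by (simp_all add: primary_bundle_def)

lemma primary_scale: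
  fixes j :: "(real^'p::finite \<Rightarrow> 'a) set"
  assumes "j \<in> points JE"
  shows "bscale PB r j \<in> points JE" "jet_rep (bscale PB r j) 0 = jet_rep j 0"
    and "(U, x, \<psi>, y) \<in> bundle_charts B \<Longrightarrow> j \<in> jets_over E (over B U) \<Longrightarrow>
      snd (jet_coord (bundle_coord B x \<psi> y) (bscale PB r j)) = r *\<^sub>R snd (jet_coord (bundle_coord B x \<psi> y) j)"
  using primary_jet_op[OF assms assms refl, where r=r and s=0 and
      h="\<lambda>(x, y, X, Y) _. (x, y, r *\<^sub>R X, r *\<^sub>R Y)"]
  by (simp_all add: primary_bundle_def)

text \<open>
  Together with \<^const>\<open>bundle_coord\<close> on the base, the trivialization is the jet chart induced by
  \<^const>\<open>bundle_coord\<close>.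
\<close>

lemma primary_trivialization_eq:
  fixes j :: "(real^'p::finite \<Rightarrow> 'a) set"
  assumes c: "(U, x, \<psi>, y) \<in> bundle_charts B" and j: "j \<in> jets_over E (over B U)"
  shows "primary_trivialization B (U, x, \<psi>, y) j = (jet_rep j 0, snd (jet_coord (bundle_coord B x \<psi> y) j))"
  unfolding primary_trivialization_def jet_comps_snd[OF c j] by (simp add: jet_proj_def vec_eq_iff)

lemma local_trivialization_primary:
  assumes c: "(U, x, \<psi>, y) \<in> bundle_charts B"
  shows "local_trivialization PB (over B U) (primary_trivialization B (U, x, \<psi>, y) :: (real^'p::finite \<Rightarrow> 'a) set \<Rightarrow> _)"
proof -
  let ?\<beta> = "bundle_coord B x \<psi> y" and ?O = "over B U"
  let ?J = "jets_over E ?O :: (real^'p \<Rightarrow> 'a) set set"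
  let ?T = "primary_trivialization B (U, x, \<psi>, y) :: (real^'p \<Rightarrow> 'a) set \<Rightarrow> _"
  let ?R = "std_manifold :: (('m \<times> 'k)^'p, ('m \<times> 'k)^'p) atlas"
  note \<beta> = bundle_chartsD(4)[OF c]
  note T = primary_trivialization_eq[OF c]
  note opO = chart_of_openin[OF atlas_E \<beta>]
  note atlas_JE = smooth_atlas_jet_manifold[OF manifold_E]
  note opJ = openin_jets_over[OF manifold_E opO]
  let ?S = "open_submanifold JE ?J" and ?P = "prod_manifold (open_submanifold E ?O) ?R"
  have P: "points ?P = ?O \<times> UNIV"
    by (simp add: points_prod_manifold points_std points_open_submanifold[OF atlas_E opO])
  have "diffeomorphism ?S ?P ?T"
  proof (rule diffeomorphismI_global_charts)
    show "smooth_atlas ?S" by (rule smooth_atlas_open_submanifold[OF atlas_JE opJ])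
    show "smooth_atlas ?P"
      by (rule smooth_atlas_prod_manifold[OF smooth_atlas_open_submanifold[OF atlas_E opO] smooth_atlas_std])
    show "chart_of ?S (points ?S) (jet_coord ?\<beta>)"
      unfolding points_open_submanifold[OF atlas_JE opJ] chart_of_open_submanifold[OF atlas_JE opJ]
      using chart_of_jet_manifold[OF manifold_E \<beta>] by simp
    have "chart_of (open_submanifold E ?O) ?O ?\<beta>"
      using \<beta> by (simp add: chart_of_open_submanifold[OF atlas_E opO])
    then show "chart_of ?P (points ?P) (map_prod ?\<beta> (\<lambda>X. X))"
      unfolding P by (rule chart_of_prod_manifold[OF _ chart_of_std
            smooth_atlas_open_submanifold[OF atlas_E opO] smooth_atlas_std])
    show "map_prod ?\<beta> (\<lambda>X. X) ` points ?P \<subseteq> jet_coord ?\<beta> ` points ?S"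
      unfolding points_open_submanifold[OF atlas_JE opJ] jet_coord_image[OF manifold_E \<beta>] P by auto
    fix j assume "j \<in> points ?S"
    then have j: "j \<in> ?J" by (simp add: points_open_submanifold[OF atlas_JE opJ])
    show "?T j \<in> points ?P \<and> map_prod ?\<beta> (\<lambda>X. X) (?T j) = jet_coord ?\<beta> j"
      unfolding P T[OF j] using jet_rep_0[OF manifold_E j] by (simp add: jet_coord_def)
  qed
  moreover have "snd (?T (badd PB j j')) = snd (?T j) + snd (?T j')"
    if "j \<in> ?J" "j' \<in> ?J" "jet_rep j 0 = jet_rep j' 0" for j j'
  proof -
    have J: "j \<in> points JE" "j' \<in> points JE" using that jet_over_iff by blast+
    note a = primary_add[OF J that(3)]
    have "badd PB j j' \<in> ?J" by (rule jets_same_base[OF that(1) a(1,2)])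
    then show ?thesis using a(3)[OF c that(1)] that by (simp add: T)
  qed
  moreover have "snd (?T (bscale PB r j)) = r *\<^sub>R snd (?T j)" if "j \<in> ?J" for r j
  proof -
    have J: "j \<in> points JE" using that jet_over_iff by blast
    note a = primary_scale[OF J, where r=r]
    have "bscale PB r j \<in> ?J" by (rule jets_same_base[OF that(1) a(1,2)])
    then show ?thesis using a(3)[OF c that(1)] that by (simp add: T)
  qed
  ultimately show ?thesis
    unfolding local_trivialization_def over_PB
    using opO by (auto simp: T primary_bundle_def std_vspace_def jet_proj_def)
qed

lemma smooth_jet_proj: "smooth_map (JE :: ((real^'p::finite \<Rightarrow> 'a) set, _) atlas) E jet_proj"
proof (rule smooth_mapI[OF smooth_atlas_jet_manifold[OF manifold_E] atlas_E])
  fix j :: "(real^'p \<Rightarrow> 'a) set" assume "j \<in> points JE"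
  then have j: "j \<in> jets_over E (points E)" by (simp add: points_JE)
  obtain Z z where Z: "(Z, z) \<in> E" "chart_of E Z z" "jet_rep j 0 \<in> Z"
    using jet_rep_points[OF manifold_E j] by (rule chart_at[OF atlas_E])
  let ?J = "jets_over E Z :: (real^'p \<Rightarrow> 'a) set set"
  have ch: "chart_of JE ?J (jet_coord z)" by (rule chart_of_jet_manifold[OF manifold_E Z(2)])
  moreover have "smooth_in ?J (jet_coord z) (z \<circ> jet_proj)"
    by (rule smooth_in_cong[OF smooth_in_linear[OF bounded_linear_fst smooth_in_self[OF chart_of_open_image[OF ch]]
          chart_of_open_image[OF ch]]])
      (simp add: jet_coord_def jet_proj_def)
  moreover have "j \<in> ?J" using j Z(3) jets_over_iff[OF manifold_E, of j Z] by simp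
  moreover have "jet_proj ` ?J \<subseteq> Z" using jet_rep_0[OF manifold_E] by (auto simp: jet_proj_def)
  ultimately show "\<exists>U (x :: _ \<Rightarrow> 't \<times> ('t^'p)) V (y :: 'a \<Rightarrow> 't). j \<in> U \<and> chart_of JE U x \<and> chart_of E V y \<and>
      jet_proj ` U \<subseteq> V \<and> smooth_in U x (y \<circ> jet_proj)"
    using Z(2) by blast
qed

lemma smooth_vector_bundle_primary:
  "smooth_vector_bundle (PB :: ((real^'p::finite \<Rightarrow> 'a) set, _, _, _, _, _) vbundle)"
  unfolding smooth_vector_bundle_def
proof (intro conjI ballI)
  let ?PB = "PB :: ((real^'p \<Rightarrow> 'a) set, _, _, _, _, _) vbundle"
  have simps: "total_man ?PB = JE" "base_man ?PB = E" "proj ?PB = jet_proj" "fibre ?PB = std_vspace"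
    by (simp_all add: primary_bundle_def)
  show "smooth_manifold (total_man ?PB)" "smooth_manifold (base_man ?PB)" "smooth_vspace (fibre ?PB)"
      "smooth_map (total_man ?PB) (base_man ?PB) (proj ?PB)"
    unfolding simps using smooth_manifold_jet_manifold[OF manifold_E] manifold_E smooth_vspace_std smooth_jet_proj by auto
  fix e assume "e \<in> points (base_man ?PB)"
  then have e: "e \<in> points E" by (simp add: simps)
  obtain U x \<psi> y where c: "(U, x, \<psi>, y) \<in> bundle_charts B" "proj B e \<in> U"
    using proj_points[OF e] by (rule bundle_chart_at)
  have eU: "e \<in> over B U" using e c(2) by (simp add: over_def)
  let ?\<beta> = "bundle_coord B x \<psi> y"
  note \<beta> = bundle_chartsD(4)[OF c(1)]
  show "\<exists>U \<psi>. e \<in> U \<and> local_trivialization ?PB U \<psi>"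
    using local_trivialization_primary[OF c(1)] eU by blast
  have sub: "j \<in> jets_over E (over B U)" "j \<in> points JE" "jet_rep j 0 = e"
    if "j \<in> jets_over E {e}" for j :: "(real^'p \<Rightarrow> 'a) set"
    using that eU jets_over_iff[OF manifold_E, of j "{e}"] jets_over_iff[OF manifold_E, of j "over B U"]
    by (auto simp: points_JE)
  have mem: "j \<in> jets_over E {e} \<longleftrightarrow> j \<in> points JE \<and> jet_rep j 0 = e" for j :: "(real^'p \<Rightarrow> 'a) set"
    using jets_over_iff[OF manifold_E, of j "{e}"] by (simp add: points_JE)
  show "vector_space_on (over ?PB {e}) (badd ?PB) (bscale ?PB)"
    unfolding over_PB
  proof (rule vector_space_onI[where T="\<lambda>j. snd (jet_coord ?\<beta> j)"])
    show "bij_betw (\<lambda>j. snd (jet_coord ?\<beta> j)) (jets_over E {e} :: (real^'p \<Rightarrow> 'a) set set) UNIV"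
      unfolding bij_betw_def
    proof (intro conjI)
      show "inj_on (\<lambda>j. snd (jet_coord ?\<beta> j)) (jets_over E {e} :: (real^'p \<Rightarrow> 'a) set set)"
      proof (rule inj_onI)
        fix j j' :: "(real^'p \<Rightarrow> 'a) set"
        assume j: "j \<in> jets_over E {e}" "j' \<in> jets_over E {e}"
          and eq: "snd (jet_coord ?\<beta> j) = snd (jet_coord ?\<beta> j')"
        have "jet_coord ?\<beta> j = jet_coord ?\<beta> j'"
          using eq sub(3)[OF j(1)] sub(3)[OF j(2)] by (simp add: jet_coord_def)
        then show "j = j'"
          using jet_coord_inj[OF manifold_E \<beta>] sub(1)[OF j(1)] sub(1)[OF j(2)] by (auto dest: inj_onD)
      qed
      have "Z \<in> (\<lambda>j. snd (jet_coord ?\<beta> j)) ` (jets_over E {e} :: (real^'p \<Rightarrow> 'a) set set)" for Z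
      proof -
      have "(?\<beta> e, Z) \<in> jet_coord ?\<beta> ` (jets_over E (over B U) :: (real^'p \<Rightarrow> 'a) set set)"
        unfolding jet_coord_image[OF manifold_E \<beta>] using eU by simp
      then obtain j :: "(real^'p \<Rightarrow> 'a) set" where j: "j \<in> jets_over E (over B U)" "jet_coord ?\<beta> j = (?\<beta> e, Z)"
        by (elim imageE) simp
      have "?\<beta> (jet_rep j 0) = ?\<beta> e" using j(2) by (simp add: jet_coord_def)
      then have "jet_rep j 0 = e"
        using chart_of_inj[OF \<beta>] jet_rep_0[OF manifold_E j(1)] eU by (auto dest: inj_onD)
      then have "j \<in> jets_over E {e}" using j(1) jet_over_iff mem by blast
      then show "Z \<in> (\<lambda>j. snd (jet_coord ?\<beta> j)) ` (jets_over E {e} :: (real^'p \<Rightarrow> 'a) set set)"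
        using j(2) by (intro image_eqI[of _ _ j]) auto
      qed
      then show "(\<lambda>j. snd (jet_coord ?\<beta> j)) ` (jets_over E {e} :: (real^'p \<Rightarrow> 'a) set set) = UNIV"
        by blast
    qed
    show "badd ?PB j j' \<in> jets_over E {e} \<and>
        snd (jet_coord ?\<beta> (badd ?PB j j')) = snd (jet_coord ?\<beta> j) + snd (jet_coord ?\<beta> j')"
      if "j \<in> jets_over E {e}" "j' \<in> jets_over E {e}" for j j'
      using primary_add[OF sub(2)[OF that(1)] sub(2)[OF that(2)]] sub(3)[OF that(1)] sub(3)[OF that(2)]
        sub(1)[OF that(1)] c(1) mem by simp
    show "bscale ?PB r j \<in> jets_over E {e} \<and>
        snd (jet_coord ?\<beta> (bscale ?PB r j)) = r *\<^sub>R snd (jet_coord ?\<beta> j)"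
      if "j \<in> jets_over E {e}" for r j
      using primary_scale[OF sub(2)[OF that(1)]] sub(3)[OF that(1)] sub(1)[OF that(1)] c(1) mem by simp
  qed
qed

section \<open>The secondary bundle\<close>

abbreviation SB :: "((real^'p::finite \<Rightarrow> 'a) set, 't \<times> ('t^'p), (real^'p \<Rightarrow> 'c) set, 'm \<times> ('m^'p),
    (real^'p \<Rightarrow> 'f) set, 'k \<times> ('k^'p)) vbundle"
  where "SB \<equiv> secondary_bundle B"

lemma secondary_chart_comps:
  fixes j :: "(real^'p::finite \<Rightarrow> 'a) set"
  shows "secondary_chart x \<psi> y j = ((a, X), (b, Y)) \<longleftrightarrow> jet_comps B (U, x, \<psi>, y) j = (a, b, X, Y)"
  unfolding jet_comps_domain[of U] secondary_chart_def by (auto split: prod.splits)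

text \<open>
  Jets with the same projection have representatives with the same projection.  For these, linear
  combinations can be taken pointwise in the fibres of the bundle, where no chart is involved.
\<close>

lemma secondary_combination:
  fixes j j' :: "(real^'p::finite \<Rightarrow> 'a) set"
  assumes j: "j \<in> points JE" and j': "j' \<in> points JE"
    and base: "jet_map M (proj B) j = jet_map M (proj B) j'"
  obtains l where "l \<in> points JE"
    "\<And>U x \<psi> y. (U, x, \<psi>, y) \<in> bundle_charts B \<Longrightarrow> j \<in> jets_over E (over B U) \<Longrightarrow>
       j' \<in> jets_over E (over B U) \<and> l \<in> jets_over E (over B U) \<and>
       fst (secondary_chart x \<psi> y j') = fst (secondary_chart x \<psi> y j) \<and>
       secondary_chart x \<psi> y l = (fst (secondary_chart x \<psi> y j),
         r *\<^sub>R snd (secondary_chart x \<psi> y j) + s *\<^sub>R snd (secondary_chart x \<psi> y j'))"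
proof -
  have over: "j' \<in> jets_over E (over B U)" if "j \<in> jets_over E (over B U)" for U
    using jet_map_proj_over[OF j, of U] jet_map_proj_over[OF j', of U] base that by simp
  obtain U x \<psi> y where c: "(U, x, \<psi>, y) \<in> bundle_charts B" and jU: "j \<in> jets_over E (over B U)"
    using j by (rule bundle_chart_at_jet)
  let ?\<beta> = "bundle_coord B x \<psi> y"
  note \<beta> = bundle_chartsD(4)[OF c]
  obtain a b X Y where cj: "jet_comps B (U, x, \<psi>, y) j = (a, b, X, Y)" by (metis prod.exhaust)
  obtain a' b' X' Y' where cj': "jet_comps B (U, x, \<psi>, y) j' = (a', b', X', Y')" by (metis prod.exhaust)
  have S: "secondary_chart x \<psi> y j = ((a, X), (b, Y))" "secondary_chart x \<psi> y j' = ((a', X'), (b', Y'))"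
    using cj cj' by (auto simp: secondary_chart_comps[where U=U])
  \<comment> \<open>equal projections mean equal components over the base\<close>
  have aX: "a' = a" "X' = X"
    using secondary_trivialization_coords(3)[OF c jU] secondary_trivialization_coords(3)[OF c over[OF jU]] base S
    by auto
  have "a = x (proj B (jet_rep j 0))"
    using cj by (simp add: jet_comps_def Let_def)
  then have "a \<in> x ` U"
    using jet_rep_0[OF manifold_E jU] by (auto simp: over_def)
  then obtain \<gamma> :: "real^'p \<Rightarrow> 'm" where \<gamma>: "Cinf_on UNIV \<gamma>" "\<gamma> 0 = a" "\<And>u. \<gamma> u \<in> x ` U" "\<And>\<alpha>. partial0 \<alpha> \<gamma> = X $ \<alpha>"
    using smooth_curve_with_derivative[OF chart_of_open_image[OF bundle_chartsD(1)[OF c]]] by metis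
  obtain \<delta> :: "real^'p \<Rightarrow> 'k" where \<delta>: "Cinf_on UNIV \<delta>" "\<delta> 0 = b" "\<And>\<alpha>. partial0 \<alpha> \<delta> = Y $ \<alpha>"
    using smooth_curve_with_derivative[OF open_UNIV UNIV_I] by metis
  obtain \<delta>' :: "real^'p \<Rightarrow> 'k" where \<delta>': "Cinf_on UNIV \<delta>'" "\<delta>' 0 = b'" "\<And>\<alpha>. partial0 \<alpha> \<delta>' = Y' $ \<alpha>"
    using smooth_curve_with_derivative[OF open_UNIV UNIV_I] by metis
  \<comment> \<open>\<open>\<Phi> d\<close> has bundle coordinates \<open>(\<gamma>, d)\<close>; its projection to the base is the same for all \<open>d\<close>\<close>
  define \<Phi> where "\<Phi> d = inv_into (over B U) ?\<beta> \<circ> (\<lambda>u. (\<gamma> u, d u))" for d :: "real^'p \<Rightarrow> 'k"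
  have im: "(\<gamma> u, d u) \<in> ?\<beta> ` over B U" for d u
    unfolding bundle_chartsD(5)[OF c] using \<gamma>(3) by simp
  have \<Phi>smooth: "smooth_map std_manifold E (\<Phi> d)" if "Cinf_on UNIV d" for d
    unfolding \<Phi>_def
    by (rule smooth_curve_in_chart[OF atlas_E \<beta> Cinf_on_Pair[OF open_UNIV \<gamma>(1) that]]) (rule im)
  have \<Phi>over: "\<Phi> d u \<in> over B U" and \<Phi>\<beta>: "?\<beta> (\<Phi> d u) = (\<gamma> u, d u)" for d u
    using im[of u d] by (simp_all add: \<Phi>_def inv_into_into f_inv_into_f)
  have \<Phi>x: "x (proj B (\<Phi> d u)) = \<gamma> u" and \<Phi>y: "y (snd (\<psi> (\<Phi> d u))) = d u" for d u
    using \<Phi>\<beta>[of d u] by (simp_all add: bundle_coord_def)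
  have \<Phi>E: "\<Phi> d u \<in> points E" and \<Phi>U: "proj B (\<Phi> d u) \<in> U" for d u
    using \<Phi>over[of d u] by (auto simp: over_def)
  have same: "proj B (\<Phi> d u) = proj B (\<Phi> d' u)" for d d' u
    using \<Phi>x[of d u] \<Phi>x[of d' u] \<Phi>U chart_of_inj[OF bundle_chartsD(1)[OF c]] by (metis inj_onD)
  have germ: "differentiable_germ E (\<Phi> d)" if "Cinf_on UNIV d" for d
    by (rule smooth_map_imp_germ[OF atlas_E \<Phi>smooth[OF that]])
  have comps: "jet_comps B (U, x, \<psi>, y) (jet E (\<Phi> d)) = (a, d 0, X, \<chi> \<alpha>. partial0 \<alpha> d)"
    if "Cinf_on UNIV d" for d
  proof -
    have "x \<circ> proj B \<circ> \<Phi> d = \<gamma>" "y \<circ> snd \<circ> \<psi> \<circ> \<Phi> d = d"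
      by (auto simp: \<Phi>x \<Phi>y)
    then show ?thesis
      using jet_comps_jet[OF c germ[OF that] \<Phi>over] \<gamma>(2,4) by (simp add: \<Phi>x \<Phi>y)
  qed
  have in_over: "jet E (\<Phi> d) \<in> jets_over E (over B V) \<longleftrightarrow> proj B (\<Phi> d 0) \<in> V" if "Cinf_on UNIV d" for d V
    using jet_in_jets_over[OF manifold_E germ[OF that], of "over B V"] \<Phi>E by (simp add: over_def)
  have jj: "jet E (\<Phi> \<delta>) = j"
    by (rule jet_comps_inj[OF c _ jU])
      (use in_over[OF \<delta>(1)] \<Phi>U comps[OF \<delta>(1)] \<delta> cj in \<open>auto simp: vec_eq_iff\<close>)
  have jj': "jet E (\<Phi> \<delta>') = j'"
    by (rule jet_comps_inj[OF c _ over[OF jU]])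
      (use in_over[OF \<delta>'(1)] \<Phi>U comps[OF \<delta>'(1)] \<delta>' cj' aX in \<open>auto simp: vec_eq_iff\<close>)
  let ?d = "\<lambda>u. r *\<^sub>R \<delta> u + s *\<^sub>R \<delta>' u"
  have d: "Cinf_on UNIV ?d"
    by (intro Cinf_on_add Cinf_on_linear[OF bounded_linear_scaleR_right] \<delta>(1) \<delta>'(1) open_UNIV)
  \<comment> \<open>this description of the combined curve refers to the fibres of the bundle only, and can be read in any bundle chart\<close>
  have pointwise: "\<Phi> ?d u = badd B (bscale B r (\<Phi> \<delta> u)) (bscale B s (\<Phi> \<delta>' u))" for u
  proof -
    note t = trivialization_linear[OF bundle_chartsD(2,3)[OF c] \<Phi>over[of \<delta> u] \<Phi>over[of \<delta>' u] same, of r s]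
    have "?\<beta> (badd B (bscale B r (\<Phi> \<delta> u)) (bscale B s (\<Phi> \<delta>' u))) = ?\<beta> (\<Phi> ?d u)"
      unfolding \<Phi>\<beta> using t(2,3) by (simp add: bundle_coord_def \<Phi>x \<Phi>y)
    from inj_onD[OF chart_of_inj[OF \<beta>] this t(1) \<Phi>over] show ?thesis by (rule sym)
  qed
  let ?l = "jet E (\<Phi> ?d)"
  show ?thesis
  proof (rule that)
    show "?l \<in> points JE" using in_over[OF d, of U] \<Phi>U jet_over_iff[of ?l U] by simp
    fix V z \<psi>' w assume v: "(V, z, \<psi>', w) \<in> bundle_charts B" and jV: "j \<in> jets_over E (over B V)"
    have V0: "\<Phi> d 0 \<in> over B V" for d
      using in_over[OF \<delta>(1), of V] jV jj same[of \<delta> 0 d] \<Phi>E[of d 0] by (simp add: over_def)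
    have lV: "?l \<in> jets_over E (over B V)"
      using in_over[OF d] V0 by (simp add: over_def)
    have jcomps: "secondary_chart z \<psi>' w (jet E (\<Phi> d)) = ((z (proj B (\<Phi> d 0)), \<chi> \<alpha>. partial0 \<alpha> (z \<circ> proj B \<circ> \<Phi> d)),
        (w (snd (\<psi>' (\<Phi> d 0))), \<chi> \<alpha>. partial0 \<alpha> (w \<circ> snd \<circ> \<psi>' \<circ> \<Phi> d)))" if "Cinf_on UNIV d" for d
      unfolding secondary_chart_comps[where U=V] by (rule jet_comps_jet[OF v germ[OF that] V0])
    have x: "z (proj B (\<Phi> d 0)) = z (proj B (\<Phi> \<delta> 0))" "z \<circ> proj B \<circ> \<Phi> d = z \<circ> proj B \<circ> \<Phi> \<delta>" for d
      using same[of d _ \<delta>] by auto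
    note lin = trivialization_linear(3)[OF bundle_chartsD(2,3)[OF v]]
    have y0: "w (snd (\<psi>' (\<Phi> ?d 0))) = r *\<^sub>R w (snd (\<psi>' (\<Phi> \<delta> 0))) + s *\<^sub>R w (snd (\<psi>' (\<Phi> \<delta>' 0)))"
      unfolding pointwise by (rule lin[OF V0 V0 same])
    have "\<forall>\<^sub>F u in nhds 0. \<Phi> \<delta> u \<in> over B V"
      by (rule differentiable_germD(1)[OF atlas_E germ[OF \<delta>(1)] bundle_chartsD(4)[OF v] V0])
    then have "\<forall>\<^sub>F u in nhds 0. (w \<circ> snd \<circ> \<psi>' \<circ> \<Phi> ?d) u =
        r *\<^sub>R (w \<circ> snd \<circ> \<psi>' \<circ> \<Phi> \<delta>) u + s *\<^sub>R (w \<circ> snd \<circ> \<psi>' \<circ> \<Phi> \<delta>') u"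
    proof (rule eventually_mono)
      fix u assume u: "\<Phi> \<delta> u \<in> over B V"
      then have "\<Phi> \<delta>' u \<in> over B V"
        using same[of \<delta> u \<delta>'] \<Phi>E by (simp add: over_def)
      from lin[OF u this same, of r s] show "(w \<circ> snd \<circ> \<psi>' \<circ> \<Phi> ?d) u =
          r *\<^sub>R (w \<circ> snd \<circ> \<psi>' \<circ> \<Phi> \<delta>) u + s *\<^sub>R (w \<circ> snd \<circ> \<psi>' \<circ> \<Phi> \<delta>') u"
        by (simp add: pointwise)
    qed
    then have "partial0 \<alpha> (w \<circ> snd \<circ> \<psi>' \<circ> \<Phi> ?d) =
        partial0 \<alpha> (\<lambda>u. r *\<^sub>R (w \<circ> snd \<circ> \<psi>' \<circ> \<Phi> \<delta>) u + s *\<^sub>R (w \<circ> snd \<circ> \<psi>' \<circ> \<Phi> \<delta>') u)" for \<alpha>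
      by (rule partial0_cong)
    moreover
    have w: "(w \<circ> snd \<circ> \<psi>' \<circ> \<Phi> \<delta>) differentiable (at 0)" "(w \<circ> snd \<circ> \<psi>' \<circ> \<Phi> \<delta>') differentiable (at 0)"
      using bundle_coord_germ(2)[OF v germ V0] \<delta>(1) \<delta>'(1) by auto
    then have "partial0 \<alpha> (\<lambda>u. r *\<^sub>R (w \<circ> snd \<circ> \<psi>' \<circ> \<Phi> \<delta>) u + s *\<^sub>R (w \<circ> snd \<circ> \<psi>' \<circ> \<Phi> \<delta>') u) =
        r *\<^sub>R partial0 \<alpha> (w \<circ> snd \<circ> \<psi>' \<circ> \<Phi> \<delta>) + s *\<^sub>R partial0 \<alpha> (w \<circ> snd \<circ> \<psi>' \<circ> \<Phi> \<delta>')" for \<alpha>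
      using partial0_add[OF differentiable_scaleR[OF differentiable_const w(1)] differentiable_scaleR[OF differentiable_const w(2)]]
        partial0_linear[OF w(1) bounded_linear_scaleR_right] partial0_linear[OF w(2) bounded_linear_scaleR_right]
      by simp
    ultimately have yp: "partial0 \<alpha> (w \<circ> snd \<circ> \<psi>' \<circ> \<Phi> ?d) =
        r *\<^sub>R partial0 \<alpha> (w \<circ> snd \<circ> \<psi>' \<circ> \<Phi> \<delta>) + s *\<^sub>R partial0 \<alpha> (w \<circ> snd \<circ> \<psi>' \<circ> \<Phi> \<delta>')" for \<alpha>
      by simp
    show "j' \<in> jets_over E (over B V) \<and> ?l \<in> jets_over E (over B V) \<and>
       fst (secondary_chart z \<psi>' w j') = fst (secondary_chart z \<psi>' w j) \<and>
       secondary_chart z \<psi>' w ?l = (fst (secondary_chart z \<psi>' w j),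
         r *\<^sub>R snd (secondary_chart z \<psi>' w j) + s *\<^sub>R snd (secondary_chart z \<psi>' w j'))"
      using over[OF jV] lV jcomps[OF \<delta>(1)] jcomps[OF \<delta>'(1)] jcomps[OF d] x(1)[of \<delta>'] x(2)[of \<delta>'] x(1)[of ?d] x(2)[of ?d]
      unfolding jj jj' by (simp add: y0 yp vec_eq_iff)
  qed
qed

lemma secondary_chart_inj:
  fixes j j' :: "(real^'p::finite \<Rightarrow> 'a) set"
  assumes c: "(U, x, \<psi>, y) \<in> bundle_charts B" and "j \<in> jets_over E (over B U)" "j' \<in> jets_over E (over B U)"
    and "secondary_chart x \<psi> y j = secondary_chart x \<psi> y j'"
  shows "j = j'"
  using chart_of_inj[OF chart_of_secondary[OF c]] assms(2-4) by (auto dest: inj_onD)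

text \<open>
  The first half of the secondary coordinates consists of the coordinates of the projected jet.
\<close>

lemma proj_of_combination:
  fixes j l :: "(real^'p::finite \<Rightarrow> 'a) set"
  assumes c: "(U, x, \<psi>, y) \<in> bundle_charts B" and j: "j \<in> jets_over E (over B U)" and l: "l \<in> jets_over E (over B U)"
  shows "jet_map M (proj B) l = jet_map M (proj B) j \<longleftrightarrow> fst (secondary_chart x \<psi> y l) = fst (secondary_chart x \<psi> y j)"
proof -
  have "fst (secondary_chart x \<psi> y k) = jet_coord x (jet_map M (proj B) k)" if "k \<in> jets_over E (over B U)"
    for k :: "(real^'p \<Rightarrow> 'a) set"
    using secondary_trivialization_coords(3)[OF c that] by (metis fst_conv)
  then show ?thesis
    using jet_coord_inj[OF manifold_M bundle_chartsD(1)[OF c]] secondary_trivialization_coords(1)[OF c] j l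
    by (metis inj_onD)
qed

lemma secondary_jet_op:
  fixes j j' :: "(real^'p::finite \<Rightarrow> 'a) set"
  assumes j: "j \<in> points JE" and j': "j' \<in> points JE"
    and base: "jet_map M (proj B) j = jet_map M (proj B) j'"
    and h: "\<And>a b b' X Y Y'. h (a, b, X, Y) (a, b', X, Y') = (a, r *\<^sub>R b + s *\<^sub>R b', X, r *\<^sub>R Y + s *\<^sub>R Y')"
    and c: "(U, x, \<psi>, y) \<in> bundle_charts B" "j \<in> jets_over E (over B U)"
  shows "jet_op B h j j' \<in> jets_over E (over B U)"
    "jet_map M (proj B) (jet_op B h j j') = jet_map M (proj B) j"
    "snd (secondary_chart x \<psi> y (jet_op B h j j')) =
       r *\<^sub>R snd (secondary_chart x \<psi> y j) + s *\<^sub>R snd (secondary_chart x \<psi> y j')"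
proof -
  obtain l where l: "l \<in> points JE"
    "\<And>U x \<psi> y. (U, x, \<psi>, y) \<in> bundle_charts B \<Longrightarrow> j \<in> jets_over E (over B U) \<Longrightarrow>
       j' \<in> jets_over E (over B U) \<and> l \<in> jets_over E (over B U) \<and>
       fst (secondary_chart x \<psi> y j') = fst (secondary_chart x \<psi> y j) \<and>
       secondary_chart x \<psi> y l = (fst (secondary_chart x \<psi> y j),
         r *\<^sub>R snd (secondary_chart x \<psi> y j) + s *\<^sub>R snd (secondary_chart x \<psi> y j'))"
    using secondary_combination[OF j j' base, of r s] by blast
  have "jet_op B h j j' = l"
  proof (rule jet_op_eqI[OF j l(1)])
    fix U x \<psi> y assume c: "(U, x, \<psi>, y) \<in> bundle_charts B" and jU: "j \<in> jets_over E (over B U)"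
    obtain a b X Y where cj: "jet_comps B (U, x, \<psi>, y) j = (a, b, X, Y)" by (metis prod.exhaust)
    obtain a' b' X' Y' where cj': "jet_comps B (U, x, \<psi>, y) j' = (a', b', X', Y')" by (metis prod.exhaust)
    have S: "secondary_chart x \<psi> y j = ((a, X), (b, Y))" "secondary_chart x \<psi> y j' = ((a', X'), (b', Y'))"
      using cj cj' by (auto simp: secondary_chart_comps[where U=U])
    then have "a' = a" "X' = X" using l(2)[OF c jU] by auto
    moreover have "jet_comps B (U, x, \<psi>, y) l = (a, r *\<^sub>R b + s *\<^sub>R b', X, r *\<^sub>R Y + s *\<^sub>R Y')"
      using l(2)[OF c jU] S secondary_chart_comps[where U=U and j=l] by simp
    ultimately show "l \<in> jets_over E (over B U) \<and>
        jet_comps B (U, x, \<psi>, y) l = h (jet_comps B (U, x, \<psi>, y) j) (jet_comps B (U, x, \<psi>, y) j')"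
      using l(2)[OF c jU] cj cj' h by simp
  qed
  then show "jet_op B h j j' \<in> jets_over E (over B U)"
    "jet_map M (proj B) (jet_op B h j j') = jet_map M (proj B) j"
    "snd (secondary_chart x \<psi> y (jet_op B h j j')) =
       r *\<^sub>R snd (secondary_chart x \<psi> y j) + s *\<^sub>R snd (secondary_chart x \<psi> y j')"
    using l(2)[OF c] proj_of_combination[OF c, of l] by auto
qed

lemma secondary_add:
  fixes j j' :: "(real^'p::finite \<Rightarrow> 'a) set"
  assumes "j \<in> points JE" "j' \<in> points JE" "jet_map M (proj B) j = jet_map M (proj B) j'"
    and "(U, x, \<psi>, y) \<in> bundle_charts B" "j \<in> jets_over E (over B U)"
  shows "badd SB j j' \<in> jets_over E (over B U)"
    "jet_map M (proj B) (badd SB j j') = jet_map M (proj B) j"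
    "snd (secondary_chart x \<psi> y (badd SB j j')) = snd (secondary_chart x \<psi> y j) + snd (secondary_chart x \<psi> y j')"
  using secondary_jet_op[OF assms(1-3) _ assms(4,5), where r=1 and s=1 and
      h="\<lambda>(x, y, X, Y) (x', y', X', Y'). (x, y + y', X, Y + Y')"]
  by (simp_all add: secondary_bundle_def)

lemma secondary_scale:
  fixes j :: "(real^'p::finite \<Rightarrow> 'a) set"
  assumes "j \<in> points JE" "(U, x, \<psi>, y) \<in> bundle_charts B" "j \<in> jets_over E (over B U)"
  shows "bscale SB r j \<in> jets_over E (over B U)"
    "jet_map M (proj B) (bscale SB r j) = jet_map M (proj B) j"
    "snd (secondary_chart x \<psi> y (bscale SB r j)) = r *\<^sub>R snd (secondary_chart x \<psi> y j)"
  using secondary_jet_op[OF assms(1,1) refl _ assms(2,3), where r=r and s=0 and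
      h="\<lambda>(x, y, X, Y) _. (x, r *\<^sub>R y, X, r *\<^sub>R Y)"]
  by (simp_all add: secondary_bundle_def)

lemma secondary_chart_image:
  assumes c: "(U, x, \<psi>, y) \<in> bundle_charts B"
  shows "secondary_chart x \<psi> y ` (jets_over E (over B U) :: (real^'p::finite \<Rightarrow> 'a) set set) = (x ` U \<times> UNIV) \<times> UNIV"
proof (intro subset_antisym subsetI)
  fix z :: "('m \<times> ('m^'p)) \<times> ('k \<times> ('k^'p))" assume z: "z \<in> (x ` U \<times> UNIV) \<times> UNIV"
  obtain a X b Y where z': "z = ((a, X), (b, Y))" by (metis prod.exhaust)
  then have "a \<in> x ` U" using z by simp
  then obtain j :: "(real^'p \<Rightarrow> 'a) set"
    where j: "j \<in> jets_over E (over B U)" "jet_comps B (U, x, \<psi>, y) j = (a, b, X, Y)"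
    by (rule jet_comps_surj[OF c])
  then have "secondary_chart x \<psi> y j = z" using z' by (simp add: secondary_chart_comps[where U=U])
  then show "z \<in> secondary_chart x \<psi> y ` (jets_over E (over B U) :: (real^'p \<Rightarrow> 'a) set set)" using j(1) by blast
next
  fix z assume "z \<in> secondary_chart x \<psi> y ` (jets_over E (over B U) :: (real^'p \<Rightarrow> 'a) set set)"
  then obtain j :: "(real^'p \<Rightarrow> 'a) set" where j: "j \<in> jets_over E (over B U)" "z = secondary_chart x \<psi> y j" by blast
  have "proj B (jet_rep j 0) \<in> U" using jet_rep_0[OF manifold_E j(1)] by (simp add: over_def)
  then show "z \<in> (x ` U \<times> UNIV) \<times> UNIV"
    using j(2) by (simp add: secondary_chart_def jet_comps_def Let_def)
qed

lemma over_SB: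
  "over SB K = {j \<in> points JE. jet_map M (proj B) j \<in> K}"
  by (simp add: over_def secondary_bundle_def)

lemma over_SB_jets: "over SB (jets_over M U) = (jets_over E (over B U) :: (real^'p::finite \<Rightarrow> 'a) set set)"
  unfolding over_SB
proof (intro set_eqI)
  fix j :: "(real^'p \<Rightarrow> 'a) set"
  show "j \<in> {j \<in> points JE. jet_map M (proj B) j \<in> jets_over M U} \<longleftrightarrow> j \<in> jets_over E (over B U)"
    using jet_map_proj_over[of j U] jet_over_iff[of j U] by auto
qed

lemma local_trivialization_secondary:
  assumes c: "(U, x, \<psi>, y) \<in> bundle_charts B"
  shows "local_trivialization SB (jets_over M U) (secondary_trivialization B \<psi> :: (real^'p::finite \<Rightarrow> 'a) set \<Rightarrow> _)"
proof -
  let ?J = "jets_over E (over B U) :: (real^'p \<Rightarrow> 'a) set set"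
  let ?K = "jets_over M U :: (real^'p \<Rightarrow> 'c) set set"
  let ?T = "secondary_trivialization B \<psi> :: (real^'p \<Rightarrow> 'a) set \<Rightarrow> _"
  let ?V = "jet_vspace (fibre B) :: ((real^'p \<Rightarrow> 'f) set, _) vspace"
  let ?JF = "jet_manifold F :: ((real^'p \<Rightarrow> 'f) set, _) atlas"
  note cD = bundle_chartsD[OF c]
  note opO = chart_of_openin[OF atlas_E cD(4)]
  note atlas_JE = smooth_atlas_jet_manifold[OF manifold_E]
  note atlas_JM = smooth_atlas_jet_manifold[OF manifold_M]
  note atlas_JF = smooth_atlas_jet_manifold[OF manifold_F]
  note opJ = openin_jets_over[OF manifold_E opO]
  note opK = openin_jets_over[OF manifold_M chart_of_openin[OF atlas_M cD(1)]]
  have V: "smooth_vspace ?V" by (rule smooth_vspace_jet[OF vspace_F])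
  have man: "vman ?V = ?JF" by (simp add: jet_vspace_def)
  have y: "linear_coords ?V (jet_coord y)" by (rule linear_coords_jet[OF vspace_F cD(3)])
  note yD = linear_coordsD[OF V y, unfolded man]
  have T: "fst (?T j) = jet_map M (proj B) j" "fst (?T j) \<in> ?K" "snd (?T j) \<in> points ?JF"
      "map_prod (jet_coord x) (jet_coord y) (?T j) = secondary_chart x \<psi> y j"
      "jet_coord y (snd (?T j)) = snd (secondary_chart x \<psi> y j)" if "j \<in> ?J" for j
    using secondary_trivialization_coords[OF c that] by (simp_all add: secondary_trivialization_def) (metis snd_conv)
  let ?S = "open_submanifold JE ?J" and ?P = "prod_manifold (open_submanifold JM ?K) ?JF"
  have P: "points ?P = ?K \<times> points ?JF"
    by (simp add: points_prod_manifold points_open_submanifold[OF atlas_JM opK])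
  have "diffeomorphism ?S ?P ?T"
  proof (rule diffeomorphismI_global_charts)
    show "smooth_atlas ?S" by (rule smooth_atlas_open_submanifold[OF atlas_JE opJ])
    show "smooth_atlas ?P"
      by (rule smooth_atlas_prod_manifold[OF smooth_atlas_open_submanifold[OF atlas_JM opK] atlas_JF])
    show "chart_of ?S (points ?S) (secondary_chart x \<psi> y)"
      unfolding points_open_submanifold[OF atlas_JE opJ] chart_of_open_submanifold[OF atlas_JE opJ]
      using chart_of_secondary[OF c] by simp
    have "chart_of (open_submanifold JM ?K) ?K (jet_coord x)"
      using chart_of_jet_manifold[OF manifold_M cD(1)] by (simp add: chart_of_open_submanifold[OF atlas_JM opK])
    then show "chart_of ?P (points ?P) (map_prod (jet_coord x) (jet_coord y))"
      unfolding P by (rule chart_of_prod_manifold[OF _ yD(1) smooth_atlas_open_submanifold[OF atlas_JM opK] atlas_JF])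
    show "map_prod (jet_coord x) (jet_coord y) ` points ?P \<subseteq> secondary_chart x \<psi> y ` points ?S"
      unfolding points_open_submanifold[OF atlas_JE opJ] secondary_chart_image[OF c] P
      using jet_coord_image[OF manifold_M cD(1), where 'p='p] by (auto simp: map_prod_image)
    fix j assume "j \<in> points ?S"
    then have j: "j \<in> ?J" by (simp add: points_open_submanifold[OF atlas_JE opJ])
    show "?T j \<in> points ?P \<and> map_prod (jet_coord x) (jet_coord y) (?T j) = secondary_chart x \<psi> y j"
      unfolding P using T[OF j] by (simp add: mem_Times_iff)
  qed
  moreover have "snd (?T (badd SB j j')) = vadd ?V (snd (?T j)) (snd (?T j'))"
    if J: "j \<in> ?J" "j' \<in> ?J" "jet_map M (proj B) j = jet_map M (proj B) j'" for j j'
  proof -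
    have "j \<in> points JE" "j' \<in> points JE" using J jet_over_iff by blast+
    note a = secondary_add[OF this J(3) c J(1)]
    have "jet_coord y (snd (?T (badd SB j j'))) = jet_coord y (vadd ?V (snd (?T j)) (snd (?T j')))"
      using T(5)[OF a(1)] a(3) T(5)[OF J(1)] T(5)[OF J(2)] yD(3)[OF T(3)[OF J(1)] T(3)[OF J(2)]] by simp
    then show ?thesis
      using chart_of_inj[OF yD(1)] T(3)[OF a(1)] smooth_vspaceD(2)[OF V, unfolded man, OF T(3)[OF J(1)] T(3)[OF J(2)]]
      by (auto dest: inj_onD)
  qed
  moreover have "snd (?T (bscale SB r j)) = vscale ?V r (snd (?T j))" if J: "j \<in> ?J" for r j
  proof -
    have "j \<in> points JE" using J jet_over_iff by blast
    note a = secondary_scale[OF this c J, where r=r]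
    have "jet_coord y (snd (?T (bscale SB r j))) = jet_coord y (vscale ?V r (snd (?T j)))"
      using T(5)[OF a(1)] a(3) T(5)[OF J] yD(4)[OF T(3)[OF J]] by simp
    then show ?thesis
      using chart_of_inj[OF yD(1)] T(3)[OF a(1)] smooth_vspaceD(3)[OF V, unfolded man, OF T(3)[OF J]]
      by (auto dest: inj_onD)
  qed
  ultimately show ?thesis
    unfolding local_trivialization_def over_SB_jets
    using opK T(1) by (simp add: secondary_bundle_def man)
qed

lemma smooth_jet_map_proj: "smooth_map (JE :: ((real^'p::finite \<Rightarrow> 'a) set, _) atlas) JM (jet_map M (proj B))"
proof (rule smooth_mapI[OF smooth_atlas_jet_manifold[OF manifold_E] smooth_atlas_jet_manifold[OF manifold_M]])
  fix j :: "(real^'p \<Rightarrow> 'a) set" assume "j \<in> points JE"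
  then obtain U x \<psi> y where c: "(U, x, \<psi>, y) \<in> bundle_charts B" and j: "j \<in> jets_over E (over B U)"
    by (rule bundle_chart_at_jet)
  let ?J = "jets_over E (over B U) :: (real^'p \<Rightarrow> 'a) set set"
  have ch: "chart_of JE ?J (secondary_chart x \<psi> y)" by (rule chart_of_secondary[OF c])
  have "smooth_in ?J (secondary_chart x \<psi> y) (jet_coord x \<circ> jet_map M (proj B))"
  proof (rule smooth_in_cong[OF smooth_in_linear[OF bounded_linear_fst smooth_in_self[OF chart_of_open_image[OF ch]]
          chart_of_open_image[OF ch]]])
    fix i assume "i \<in> ?J"
    from secondary_trivialization_coords(3)[OF c this]
    show "fst (secondary_chart x \<psi> y i) = (jet_coord x \<circ> jet_map M (proj B)) i" by (metis comp_apply fst_conv)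
  qed
  moreover have "jet_map M (proj B) ` ?J \<subseteq> jets_over M U"
    using secondary_trivialization_coords(1)[OF c] by blast
  ultimately show "\<exists>U (x :: _ \<Rightarrow> ('m \<times> ('m^'p)) \<times> ('k \<times> ('k^'p))) V (y :: _ \<Rightarrow> 'm \<times> ('m^'p)).
      j \<in> U \<and> chart_of JE U x \<and> chart_of JM V y \<and>
      jet_map M (proj B) ` U \<subseteq> V \<and> smooth_in U x (y \<circ> jet_map M (proj B))"
    using j ch chart_of_jet_manifold[OF manifold_M bundle_chartsD(1)[OF c]] by blast
qed

lemma smooth_vector_bundle_secondary:
  "smooth_vector_bundle (SB :: ((real^'p::finite \<Rightarrow> 'a) set, _, (real^'p \<Rightarrow> 'c) set, _, (real^'p \<Rightarrow> 'f) set, _) vbundle)"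
  unfolding smooth_vector_bundle_def
proof (intro conjI ballI)
  let ?SB = "SB :: ((real^'p \<Rightarrow> 'a) set, _, (real^'p \<Rightarrow> 'c) set, _, (real^'p \<Rightarrow> 'f) set, _) vbundle"
  have simps: "total_man ?SB = JE" "base_man ?SB = JM" "proj ?SB = jet_map M (proj B)" "fibre ?SB = jet_vspace (fibre B)"
    by (simp_all add: secondary_bundle_def)
  show "smooth_manifold (total_man ?SB)" "smooth_manifold (base_man ?SB)" "smooth_vspace (fibre ?SB)"
      "smooth_map (total_man ?SB) (base_man ?SB) (proj ?SB)"
    unfolding simps using smooth_manifold_jet_manifold[OF manifold_E] smooth_manifold_jet_manifold[OF manifold_M]
      smooth_vspace_jet[OF vspace_F] smooth_jet_map_proj by auto
  fix k assume "k \<in> points (base_man ?SB)"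
  then have k: "k \<in> jets_over M (points M)" by (simp add: simps points_JM)
  obtain U x \<psi> y where c: "(U, x, \<psi>, y) \<in> bundle_charts B" "jet_rep k 0 \<in> U"
    using jet_rep_points[OF manifold_M k] by (rule bundle_chart_at)
  have kU: "k \<in> jets_over M U" using k c(2) jets_over_iff[OF manifold_M, of k U] by simp
  show "\<exists>U \<psi>. k \<in> U \<and> local_trivialization ?SB U \<psi>"
    using local_trivialization_secondary[OF c(1)] kU by blast
  let ?\<sigma> = "secondary_chart x \<psi> y" and ?F = "{j \<in> points JE. jet_map M (proj B) j \<in> {k}} :: (real^'p \<Rightarrow> 'a) set set"
  have sub: "j \<in> jets_over E (over B U)" "j \<in> points JE" "jet_map M (proj B) j = k" if "j \<in> ?F" for j
    using that kU jet_map_proj_over[of j U] by auto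
  have fst: "fst (?\<sigma> j) = jet_coord x (jet_map M (proj B) j)" if "j \<in> jets_over E (over B U)" for j :: "(real^'p \<Rightarrow> 'a) set"
    using secondary_trivialization_coords(3)[OF c(1) that] by (metis fst_conv)
  show "vector_space_on (over ?SB {k}) (badd ?SB) (bscale ?SB)"
    unfolding over_SB
  proof (rule vector_space_onI[where T="\<lambda>j. snd (?\<sigma> j)"])
    show "bij_betw (\<lambda>j. snd (?\<sigma> j)) ?F UNIV"
      unfolding bij_betw_def
    proof (intro conjI)
      show "inj_on (\<lambda>j. snd (?\<sigma> j)) ?F"
      proof (rule inj_onI)
        fix j j' assume j: "j \<in> ?F" "j' \<in> ?F" and eq: "snd (?\<sigma> j) = snd (?\<sigma> j')"
        have "fst (?\<sigma> j) = fst (?\<sigma> j')"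
          using fst sub[OF j(1)] sub[OF j(2)] by simp
        then show "j = j'"
          using secondary_chart_inj[OF c(1) sub(1)[OF j(1)] sub(1)[OF j(2)]] eq by (simp add: prod_eq_iff)
      qed
      have "z \<in> (\<lambda>j. snd (?\<sigma> j)) ` ?F" for z
      proof -
        have "jet_coord x k \<in> x ` U \<times> UNIV"
          using jet_coord_image[OF manifold_M bundle_chartsD(1)[OF c(1)], where 'p='p] kU by blast
        then have "(jet_coord x k, z) \<in> ?\<sigma> ` (jets_over E (over B U) :: (real^'p \<Rightarrow> 'a) set set)"
          unfolding secondary_chart_image[OF c(1)] by simp
        then obtain j :: "(real^'p \<Rightarrow> 'a) set" where j: "j \<in> jets_over E (over B U)" "?\<sigma> j = (jet_coord x k, z)"
          by (elim imageE) simp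
        have "jet_coord x (jet_map M (proj B) j) = jet_coord x k"
          using fst[OF j(1)] j(2) by simp
        then have "jet_map M (proj B) j = k"
          using jet_coord_inj[OF manifold_M bundle_chartsD(1)[OF c(1)]]
            secondary_trivialization_coords(1)[OF c(1) j(1)] kU by (auto dest: inj_onD)
        then have "j \<in> ?F" using j(1) jet_over_iff by blast
        then show ?thesis using j(2) by (intro image_eqI[of _ _ j]) auto
      qed
      then show "(\<lambda>j. snd (?\<sigma> j)) ` ?F = UNIV" by blast
    qed
    show "badd ?SB j j' \<in> ?F \<and> snd (?\<sigma> (badd ?SB j j')) = snd (?\<sigma> j) + snd (?\<sigma> j')"
      if j: "j \<in> ?F" "j' \<in> ?F" for j j'
    proof -
      have "jet_map M (proj B) j = jet_map M (proj B) j'" using sub(3)[OF j(1)] sub(3)[OF j(2)] by simp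
      note a = secondary_add[OF sub(2)[OF j(1)] sub(2)[OF j(2)] this c(1) sub(1)[OF j(1)]]
      show ?thesis using a sub(3)[OF j(1)] jet_over_iff[of "badd ?SB j j'" U] by simp
    qed
    show "bscale ?SB r j \<in> ?F \<and> snd (?\<sigma> (bscale ?SB r j)) = r *\<^sub>R snd (?\<sigma> j)" if j: "j \<in> ?F" for r j
    proof -
      note a = secondary_scale[OF sub(2)[OF j] c(1) sub(1)[OF j], where r=r]
      show ?thesis using a sub(3)[OF j] jet_over_iff[of "bscale ?SB r j" U] by simp
    qed
  qed
qed

text \<open>
  The value of an induced map at a jet is independent of the representative, because smooth functions on
  \<open>M\<close> pull back to smooth functions on \<open>E\<close>.
\<close>

lemma jet_proj_and_jet_map_of_jet:
  assumes \<Phi>: "smooth_map std_manifold E \<Phi>"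
  shows "jet_proj (jet E \<Phi>) = \<Phi> 0" "jet_map M (proj B) (jet E \<Phi>) = jet M (proj B \<circ> \<Phi>)"
proof -
  show "jet_proj (jet E \<Phi>) = \<Phi> 0"
    unfolding jet_proj_def by (rule jet_rep_germ_0[OF manifold_E smooth_map_imp_germ[OF atlas_E \<Phi>]])
  have "jet_equiv M (proj B \<circ> jet_rep (jet E \<Phi>)) (proj B \<circ> \<Phi>)"
    unfolding jet_equiv_def
  proof (intro allI impI)
    fix f :: "'c \<Rightarrow> real" assume "smooth_map M std_manifold f"
    from smooth_map_compose[OF atlas_E atlas_M smooth_atlas_std smooth_proj this]
    show "f ((proj B \<circ> jet_rep (jet E \<Phi>)) 0) = f ((proj B \<circ> \<Phi>) 0) \<and>
        (\<forall>\<alpha>. partial0 \<alpha> (f \<circ> (proj B \<circ> jet_rep (jet E \<Phi>))) = partial0 \<alpha> (f \<circ> (proj B \<circ> \<Phi>)))"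
      using jet_rep_of_smooth(2)[OF \<Phi>] by (auto simp: jet_equiv_def o_assoc)
  qed
  then show "jet_map M (proj B) (jet E \<Phi>) = jet M (proj B \<circ> \<Phi>)"
    unfolding jet_map_def by (rule jet_cong)
qed

section \<open>Compatibility of the two structures\<close>

lemma smooth_manifold_primary_charts: "smooth_manifold (primary_charts B :: ((real^'p::finite \<Rightarrow> 'a) set, _) atlas)"
  by (rule manifold_of_charts[OF smooth_manifold_jet_manifold[OF manifold_E] primary_charts_chart_of points_primary_charts])

lemma smooth_manifold_secondary_charts: "smooth_manifold (secondary_charts B :: ((real^'p::finite \<Rightarrow> 'a) set, _) atlas)"
  by (rule manifold_of_charts[OF smooth_manifold_jet_manifold[OF manifold_E] secondary_charts_chart_of points_secondary_charts])

lemma diffeomorphism_jet_primary: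
  "diffeomorphism (JE :: ((real^'p::finite \<Rightarrow> 'a) set, _) atlas) (primary_charts B) id"
  by (rule diffeomorphism_id(1)[OF smooth_atlas_jet_manifold[OF manifold_E]
        smooth_manifold_atlas[OF smooth_manifold_primary_charts] primary_charts_chart_of points_primary_charts])

lemma diffeomorphism_primary_secondary:
  "diffeomorphism (primary_charts B :: ((real^'p::finite \<Rightarrow> 'a) set, _) atlas) (secondary_charts B) id"
proof (rule diffeomorphism_id(1))
  show "chart_of (primary_charts B) J X" if "(J, X) \<in> secondary_charts B" for J and X :: "(real^'p \<Rightarrow> 'a) set \<Rightarrow> _"
    by (rule atlas_of_charts(3)[OF smooth_atlas_jet_manifold[OF manifold_E]
          primary_charts_chart_of points_primary_charts secondary_charts_chart_of[OF that]])
qed (simp_all add: smooth_manifold_atlas smooth_manifold_primary_charts smooth_manifold_secondary_charts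
    points_primary_charts points_secondary_charts)

end

theorem proposition5:
  fixes B :: "('a, 't::fin_dim_inner, 'c, 'm::fin_dim_inner, 'f, 'k::fin_dim_inner) vbundle"
  assumes "smooth_vector_bundle B"
  shows
    "(\<forall>\<Phi>::real^'p::finite \<Rightarrow> 'a. smooth_map std_manifold (total_man B) \<Phi> \<longrightarrow>
        jet_proj (jet (total_man B) \<Phi>) = \<Phi> 0 \<and>
        jet_map (base_man B) (proj B) (jet (total_man B) \<Phi>) = jet (base_man B) (proj B \<circ> \<Phi>)) \<and>
     smooth_vector_bundle (primary_bundle B ::
       ((real^'p \<Rightarrow> 'a) set, 't \<times> ('t^'p), 'a, 't, ('m \<times> 'k)^'p, ('m \<times> 'k)^'p) vbundle) \<and>
     smooth_vector_bundle (secondary_bundle B ::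
       ((real^'p \<Rightarrow> 'a) set, 't \<times> ('t^'p), (real^'p \<Rightarrow> 'c) set, 'm \<times> ('m^'p),
        (real^'p \<Rightarrow> 'f) set, 'k \<times> ('k^'p)) vbundle) \<and>
     (\<forall>(U, x, \<psi>, y)\<in>bundle_charts B.
        local_trivialization (primary_bundle B) (over B U)
          (primary_trivialization B (U, x, \<psi>, y) :: (real^'p \<Rightarrow> 'a) set \<Rightarrow> _) \<and>
        local_trivialization (secondary_bundle B) (jets_over (base_man B) U)
          (secondary_trivialization B \<psi> :: (real^'p \<Rightarrow> 'a) set \<Rightarrow> _)) \<and>
     smooth_manifold (primary_charts B :: ((real^'p \<Rightarrow> 'a) set, _) atlas) \<and>
     smooth_manifold (secondary_charts B :: ((real^'p \<Rightarrow> 'a) set, _) atlas) \<and>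
     diffeomorphism (primary_charts B :: ((real^'p \<Rightarrow> 'a) set, _) atlas) (secondary_charts B) id \<and>
     diffeomorphism (jet_manifold (total_man B) :: ((real^'p \<Rightarrow> 'a) set, _) atlas)
       (primary_charts B) id"
proof -
  interpret smooth_bundle B using assms by unfold_locales
  have "\<forall>(U, x, \<psi>, y)\<in>bundle_charts B.
        local_trivialization (primary_bundle B) (over B U)
          (primary_trivialization B (U, x, \<psi>, y) :: (real^'p \<Rightarrow> 'a) set \<Rightarrow> _) \<and>
        local_trivialization (secondary_bundle B) (jets_over (base_man B) U)
          (secondary_trivialization B \<psi> :: (real^'p \<Rightarrow> 'a) set \<Rightarrow> _)"
    using local_trivialization_primary local_trivialization_secondary by blast
  then show ?thesis
    using jet_proj_and_jet_map_of_jet smooth_vector_bundle_primary smooth_vector_bundle_secondary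
      smooth_manifold_primary_charts smooth_manifold_secondary_charts
      diffeomorphism_primary_secondary diffeomorphism_jet_primary by (intro conjI allI impI) auto
qed

end
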